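(* Let $(X_t,P^\mu)$ be a Markov process on $\mathcal X=\mathcal Q\times\mathcal P$ with generator $A$ on $L^2(\mu_* )$ and invariant ergodic probability measure $\mu_*=\nu_*\times\rho_*$ (the baseline process, as in the context). Let $\lambda_q,\lambda_p,R_0>0$ be the constants of the model, let $\epsilon\in(0,1)$ satisfy $$0<\epsilon<\frac{4\lambda_q\lambda_p}{4\lambda_q+R_0^2},$$ let $$\Lambda(\epsilon)=\frac{(\lambda_q-1)\epsilon+\lambda_p-\sqrt{\left((\lambda_q+1)\epsilon-\lambda_p\right)^2+\epsilon^2R_0^2}}{2}$$ (which is positive), and suppose that the baseline process satisfies the hypocoercive estimate $$\langle -Ag,g\rangle_\epsilon\ \ge\ \Lambda(\epsilon)\,\mathrm{Var}_{\mu_*}(g)\qquad\text{for all } g\in D(A),$$ where $\langle\cdot,\cdot\rangle_\epsilon$ is the modified scalar product defined in the context. Let $(\widetilde X_t,\widetilde P^{\widetilde\mu})$ be a (not necessarily Markov) $\mathcal X$-valued stochastic process with initial distribution $\widetilde\mu$, let $T>0$, and suppose that the path-space relative entropy on $[0,T]$ satisfies $$R\big(\widetilde P^{\widetilde\mu}_T\,\|\,P^{\mu_*}_T\big)<\infty .$$ Then for any bounded measurable $f:\mathcal X\to\mathbb R$, $$\left|\widetilde E^{\widetilde\mu}\left[\frac1T\int_0^T f(\widetilde X_t)\,dt\right]-\mu_*[f]\right|\ \le\ \sqrt{2v\,\eta_T}+b\,\eta_T,$$ where $$v=\frac{(1+\epsilon)\left(1-\frac{\epsilon^2}{4}\right)}{1-\epsilon}\,\frac{2\,\mathrm{Var}_{\mu_*}[f]}{\Lambda(\epsilon)},\qquad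 b=\frac{(1+\epsilon)^2}{1-\epsilon}\,\frac{\|\widehat f\|_\infty}{\Lambda(\epsilon)},\qquad \widehat f=f-\mu_*[f],$$ $$\eta_T=\frac1T\left(\log\left((1-\epsilon)^{-1/2}\right)+R\big(\widetilde P^{\widetilde\mu}_T\,\|\,P^{\mu_*}_T\big)\right).$$
   Context: Setting. $\mathcal X=\mathcal Q\times\mathcal P$ is an extended phase space (a Polish space) with $\mathcal Q\subset\mathbb R^d$ and $\mathcal P$ the momentum/velocity space (for example $\mathbb R^d$ or $\{-1,1\}^d$). $\nu_*$ is the probability measure $d\nu_*=Z^{-1}e^{-\beta V(q)}dq$ on $\mathcal Q$, $\rho_*$ is a probability measure on $\mathcal P$ with mean zero and nonzero covariance, and $\mu_*=\nu_*\times\rho_*$. $\langle\cdot,\cdot\rangle$ and $\|\cdot\|$ are the scalar product and norm of the real Hilbert space $L^2(\mu_* )$; $\mu_*[f]=\int f\,d\mu_*$ and $\mathrm{Var}_{\mu_*}$ is the variance under $\mu_*$. $(X_t,P^x)$, $x\in\mathcal X$, are time-homogeneous càdlàg $\mathcal X$-valued Markov processes with $X_0=x$ $P^x$-a.s., and $P^\mu=\int P^x\,d\mu(x)$ is the law with $X_0\sim\mu$. The measure $\mu_*$ is invariant and ergodic, $T_t[g](x)=E^x[g(X_t)]$ defines a strongly continuous semigroup on $L^2(\mu_* )$, and $(A,D(A))$ is its generator. $P^{\mu_*}_T$ and $\widetilde P^{\widetilde\mu}_T$ denote the distributions on path space over the time window $[0,T]$ of the baseline process started from $\mu_*$ and of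 the alternative process $\widetilde X$ (with càdlàg paths), respectively; $\widetilde E^{\widetilde\mu}$ is expectation under $\widetilde P^{\widetilde\mu}$. $R(Q_1\|Q_2)$ is relative entropy (Kullback–Leibler divergence): $\int\log(dQ_1/dQ_2)\,dQ_1$ if $Q_1\ll Q_2$, and $+\infty$ otherwise. Modified scalar product. Write $A=S+T$ with $S=\frac{A+A^*}{2}$ symmetric and $T=\frac{A-A^*}{2}$ antisymmetric on $L^2(\mu_* )$ (this operator $T$ is not to be confused with the time $T$). Let $\Pi$ be the projection $\Pi(f)(q)=\int f(q,p)\,d\rho_*(p)$ and $$B=\left(I+(T\Pi)^*(T\Pi)\right)^{-1}(-T\Pi)^*.$$ Standing properties: $B$ is a bounded operator on $L^2(\mu_* )$ with $B=\Pi B(I-\Pi)$, $\|Bf\|\le\frac12\|(I-\Pi)f\|$ and $B1=B^*1=0$. Put $G=B+B^*$ (so $G$ is bounded and self-adjoint, $\|G\|\le1$, $G1=0$) and, for $\epsilon\in(0,1)$, $$\langle f,g\rangle_\epsilon=\langle f,(I+\epsilon G)g\rangle .$$ Constants. The positive constants $\lambda_q,\lambda_p,R_0$ (with $\lambda_q\in(0,1)$) are those for which, for suitable $f$ with $\mu_*[f]=0$, $\langle f,-Sf\rangle\ge\lambda_p\|(I-\Pi)f\|^2$, $\langle -BT\Pi f,\Pi f\rangle\ge\lambda_q\|\Pi f\|^2$ and $\|BT(I-\Pi)f\|+\|BS(I-\Pi)f\|\le R_0\|(I-\Pi)f\|$. The number $\Lambda(\epsilon)$ is the smallest eigenvalue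 of the matrix $\begin{bmatrix}\epsilon\lambda_q&-\epsilon R_0/2\\-\epsilon R_0/2&\lambda_p-\epsilon\end{bmatrix}$. *)

theory Defs
  imports "HOL-Probability.Probability"
begin

section \<open>The extended phase space and the target measure\<close>

definition Polish_subset :: "'a::topological_space set \<Rightarrow> bool" where
  "Polish_subset X \<longleftrightarrow>
     completely_metrizable_space (top_of_set X) \<and> separable_space (top_of_set X)"

definition gibbs_measure :: "'q::euclidean_space set \<Rightarrow> real \<Rightarrow> ('q \<Rightarrow> real) \<Rightarrow> 'q measure" where
  "gibbs_measure Q \<beta> V =
     (let Z = (\<integral>q. exp (- \<beta> * V q) \<partial>restrict_space lborel Q)
      in density (restrict_space lborel Q) (\<lambda>q. ennreal (exp (- \<beta> * V q) / Z)))"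

text \<open>A nonzero covariance means that the covariance matrix is not the zero matrix; its entries
  are finite because second moments exist.\<close>

definition centred_nonzero_cov :: "'p::euclidean_space measure \<Rightarrow> bool" where
  "centred_nonzero_cov \<rho> \<longleftrightarrow>
     integrable \<rho> (\<lambda>p. (norm p)\<^sup>2) \<and> (\<integral>p. p \<partial>\<rho>) = 0 \<and>
     (\<exists>i\<in>Basis. \<exists>j\<in>Basis. (\<integral>p. (p \<bullet> i) * (p \<bullet> j) \<partial>\<rho>) \<noteq> 0)"

section \<open>The real Hilbert space of square-integrable functions\<close>

text \<open>Elements of the Hilbert space are represented by square-integrable functions, and equality
  of elements by equality almost everywhere.  Partially defined operators are represented by their
  graphs, which are relations that contain every representative of each pair.\<close>

definition L2 :: "'a measure \<Rightarrow> ('a \<Rightarrow> real) set" where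
  "L2 M = {f \<in> borel_measurable M. integrable M (\<lambda>x. (f x)\<^sup>2)}"

definition L2_inner :: "'a measure \<Rightarrow> ('a \<Rightarrow> real) \<Rightarrow> ('a \<Rightarrow> real) \<Rightarrow> real" where
  "L2_inner M f g = (\<integral>x. f x * g x \<partial>M)"

definition L2_norm :: "'a measure \<Rightarrow> ('a \<Rightarrow> real) \<Rightarrow> real" where
  "L2_norm M f = sqrt (L2_inner M f f)"

definition Var :: "'a measure \<Rightarrow> ('a \<Rightarrow> real) \<Rightarrow> real" where
  "Var M f = (\<integral>x. (f x - (\<integral>y. f y \<partial>M))\<^sup>2 \<partial>M)"

type_synonym 'a L2_op = "(('a \<Rightarrow> real) \<times> ('a \<Rightarrow> real)) set"

definition L2_bounded_operator :: "'a measure \<Rightarrow> (('a \<Rightarrow> real) \<Rightarrow> ('a \<Rightarrow> real)) \<Rightarrow> bool" where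
  "L2_bounded_operator M U \<longleftrightarrow>
     (\<forall>f\<in>L2 M. U f \<in> L2 M) \<and>
     (\<forall>f\<in>L2 M. \<forall>g\<in>L2 M. \<forall>a b. AE x in M. U (\<lambda>y. a * f y + b * g y) x = a * U f x + b * U g x) \<and>
     (\<exists>C. \<forall>f\<in>L2 M. L2_norm M (U f) \<le> C * L2_norm M f)"

definition L2_graph :: "'a measure \<Rightarrow> (('a \<Rightarrow> real) \<Rightarrow> ('a \<Rightarrow> real)) \<Rightarrow> 'a L2_op" where
  "L2_graph M U = {(f, g). f \<in> L2 M \<and> g \<in> L2 M \<and> (AE x in M. g x = U f x)}"

definition L2_add :: "'a measure \<Rightarrow> 'a L2_op \<Rightarrow> 'a L2_op \<Rightarrow> 'a L2_op" where
  "L2_add M R S = {(f, h). h \<in> L2 M \<and>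
     (\<exists>a b. (f, a) \<in> R \<and> (f, b) \<in> S \<and> (AE x in M. h x = a x + b x))}"

definition L2_scale :: "'a measure \<Rightarrow> real \<Rightarrow> 'a L2_op \<Rightarrow> 'a L2_op" where
  "L2_scale M c R = {(f, h). h \<in> L2 M \<and> (\<exists>a. (f, a) \<in> R \<and> (AE x in M. h x = c * a x))}"

definition L2_adjoint :: "'a measure \<Rightarrow> 'a L2_op \<Rightarrow> 'a L2_op" where
  "L2_adjoint M R = {(g, h). g \<in> L2 M \<and> h \<in> L2 M \<and>
     (\<forall>(f, k)\<in>R. L2_inner M k g = L2_inner M f h)}"

definition L2_closure :: "'a measure \<Rightarrow> 'a L2_op \<Rightarrow> 'a L2_op" where
  "L2_closure M R = {(f, g). f \<in> L2 M \<and> g \<in> L2 M \<and>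
     (\<exists>F G. (\<forall>n::nat. (F n, G n) \<in> R) \<and>
        (\<lambda>n. L2_norm M (\<lambda>x. F n x - f x)) \<longlonglongrightarrow> 0 \<and>
        (\<lambda>n. L2_norm M (\<lambda>x. G n x - g x)) \<longlonglongrightarrow> 0)}"

section \<open>Processes, semigroup and generator\<close>

definition cadlag_on :: "real set \<Rightarrow> 'x::topological_space set \<Rightarrow> (real \<Rightarrow> 'x) \<Rightarrow> bool" where
  "cadlag_on I X w \<longleftrightarrow>
     (\<forall>t\<in>I. w t \<in> X) \<and>
     (\<forall>t\<in>I. (w \<longlongrightarrow> w t) (at t within (I \<inter> {t..}))) \<and>
     (\<forall>t\<in>I. \<exists>l\<in>X. (w \<longlongrightarrow> l) (at t within (I \<inter> {..<t})))"

definition cadlag_process ::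
  "'w measure \<Rightarrow> 'x::topological_space set \<Rightarrow> (real \<Rightarrow> 'w \<Rightarrow> 'x) \<Rightarrow> bool" where
  "cadlag_process \<Omega> X \<xi> \<longleftrightarrow>
     (\<forall>t\<ge>0. \<xi> t \<in> \<Omega> \<rightarrow>\<^sub>M restrict_space borel X) \<and>
     (\<forall>\<omega>\<in>space \<Omega>. cadlag_on {0..} X (\<lambda>t. \<xi> t \<omega>))"

definition natural_filtration ::
  "'w measure \<Rightarrow> 'x::topological_space set \<Rightarrow> (real \<Rightarrow> 'w \<Rightarrow> 'x) \<Rightarrow> real \<Rightarrow> 'w measure" where
  "natural_filtration \<Omega> X \<xi> s =
     sigma (space \<Omega>)
       (\<Union>u\<in>{0..s}. {\<xi> u -` B \<inter> space \<Omega> |B. B \<in> sets (restrict_space borel X)})"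

definition transition ::
  "(real \<Rightarrow> 'w \<Rightarrow> 'x) \<Rightarrow> ('x \<Rightarrow> 'w measure) \<Rightarrow> real \<Rightarrow> ('x \<Rightarrow> real) \<Rightarrow> 'x \<Rightarrow> real" where
  "transition \<xi> P t g x = (\<integral>\<omega>. g (\<xi> t \<omega>) \<partial>P x)"

text \<open>Only the \<open>\<sigma>\<close>-algebra of the measure \<open>\<Omega>\<close> is used: the laws are the \<open>P x\<close>.\<close>

definition cadlag_markov_process ::
  "'w measure \<Rightarrow> 'x::topological_space set \<Rightarrow> (real \<Rightarrow> 'w \<Rightarrow> 'x) \<Rightarrow> ('x \<Rightarrow> 'w measure) \<Rightarrow> bool"
  where
  "cadlag_markov_process \<Omega> X \<xi> P \<longleftrightarrow>
     cadlag_process \<Omega> X \<xi> \<and>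
     P \<in> restrict_space borel X \<rightarrow>\<^sub>M prob_algebra \<Omega> \<and>
     (\<forall>x\<in>X. AE \<omega> in P x. \<xi> 0 \<omega> = x) \<and>
     (\<forall>x\<in>X. \<forall>s\<ge>0. \<forall>t\<ge>0. \<forall>g\<in>borel_measurable (restrict_space borel X). bounded (g ` X) \<longrightarrow>
        (AE \<omega> in P x.
           real_cond_exp (P x) (natural_filtration \<Omega> X \<xi> s) (\<lambda>\<omega>'. g (\<xi> (s + t) \<omega>')) \<omega>
             = transition \<xi> P t g (\<xi> s \<omega>)))"

definition invariant_measure ::
  "(real \<Rightarrow> 'w \<Rightarrow> 'x) \<Rightarrow> ('x \<Rightarrow> 'w measure) \<Rightarrow> 'x measure \<Rightarrow> bool" where
  "invariant_measure \<xi> P \<mu> \<longleftrightarrow> (\<forall>t\<ge>0. distr (\<mu> \<bind> P) \<mu> (\<xi> t) = \<mu>)"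

definition ergodic_measure ::
  "(real \<Rightarrow> 'w \<Rightarrow> 'x) \<Rightarrow> ('x \<Rightarrow> 'w measure) \<Rightarrow> 'x measure \<Rightarrow> bool" where
  "ergodic_measure \<xi> P \<mu> \<longleftrightarrow>
     (\<forall>B\<in>sets \<mu>. (\<forall>t\<ge>0. AE x in \<mu>. transition \<xi> P t (indicator B) x = indicator B x) \<longrightarrow>
        measure \<mu> B = 0 \<or> measure \<mu> B = 1)"

definition strongly_continuous_semigroup ::
  "'x measure \<Rightarrow> (real \<Rightarrow> ('x \<Rightarrow> real) \<Rightarrow> 'x \<Rightarrow> real) \<Rightarrow> bool" where
  "strongly_continuous_semigroup \<mu> U \<longleftrightarrow>
     (\<forall>t\<ge>0. L2_bounded_operator \<mu> (U t)) \<and>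
     (\<forall>g\<in>L2 \<mu>. AE x in \<mu>. U 0 g x = g x) \<and>
     (\<forall>s\<ge>0. \<forall>t\<ge>0. \<forall>g\<in>L2 \<mu>. AE x in \<mu>. U (s + t) g x = U s (U t g) x) \<and>
     (\<forall>g\<in>L2 \<mu>. ((\<lambda>t. L2_norm \<mu> (\<lambda>x. U t g x - g x)) \<longlongrightarrow> 0) (at_right 0))"

definition generator ::
  "'x measure \<Rightarrow> (real \<Rightarrow> ('x \<Rightarrow> real) \<Rightarrow> 'x \<Rightarrow> real) \<Rightarrow> 'x L2_op" where
  "generator \<mu> U = {(g, h). g \<in> L2 \<mu> \<and> h \<in> L2 \<mu> \<and>
     ((\<lambda>t. L2_norm \<mu> (\<lambda>x. (U t g x - g x) / t - h x)) \<longlongrightarrow> 0) (at_right 0)}"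

section \<open>The modified scalar product\<close>

definition symmetric_part :: "'x measure \<Rightarrow> 'x L2_op \<Rightarrow> 'x L2_op" where
  "symmetric_part \<mu> A = L2_scale \<mu> (1/2) (L2_add \<mu> A (L2_adjoint \<mu> A))"

definition antisymmetric_part :: "'x measure \<Rightarrow> 'x L2_op \<Rightarrow> 'x L2_op" where
  "antisymmetric_part \<mu> A =
     L2_scale \<mu> (1/2) (L2_add \<mu> A (L2_scale \<mu> (-1) (L2_adjoint \<mu> A)))"

definition velocity_avg ::
  "'p measure \<Rightarrow> ('q \<times> 'p \<Rightarrow> real) \<Rightarrow> 'q \<times> 'p \<Rightarrow> real" where
  "velocity_avg \<rho> f = (\<lambda>x. \<integral>p. f (fst x, p) \<partial>\<rho>)"

definition velocity_fluct ::
  "'p measure \<Rightarrow> ('q \<times> 'p \<Rightarrow> real) \<Rightarrow> 'q \<times> 'p \<Rightarrow> real" where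
  "velocity_fluct \<rho> f = (\<lambda>x. f x - velocity_avg \<rho> f x)"

text \<open>As usual for products of unbounded operators, \<open>T\<Pi>\<close> and the product defining \<open>B\<close> are
  understood as closed operators; if they are already closed the closures change nothing.  Note
  that \<open>R O S\<close> applies \<open>R\<close> first.\<close>

definition TPi :: "('q \<times> 'p) measure \<Rightarrow> 'p measure \<Rightarrow> ('q \<times> 'p) L2_op \<Rightarrow> ('q \<times> 'p) L2_op" where
  "TPi \<mu> \<rho> A = L2_closure \<mu> (L2_graph \<mu> (velocity_avg \<rho>) O antisymmetric_part \<mu> A)"

definition B_graph ::
  "('q \<times> 'p) measure \<Rightarrow> 'p measure \<Rightarrow> ('q \<times> 'p) L2_op \<Rightarrow> ('q \<times> 'p) L2_op" where
  "B_graph \<mu> \<rho> A =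
     L2_closure \<mu>
       (L2_adjoint \<mu> (L2_scale \<mu> (-1) (TPi \<mu> \<rho> A)) O
        (L2_add \<mu> (L2_graph \<mu> (\<lambda>f. f)) (TPi \<mu> \<rho> A O L2_adjoint \<mu> (TPi \<mu> \<rho> A)))\<inverse>)"

text \<open>The functions \<open>B\<close> and \<open>B'\<close> represent the bounded operators \<open>B\<close> and \<open>B\<^sup>*\<close>.  The two graph
  equations determine them up to almost-everywhere equality; boundedness and the last four
  conditions are the standing properties.\<close>

definition hypocoercive_B ::
  "('q \<times> 'p) measure \<Rightarrow> 'p measure \<Rightarrow> ('q \<times> 'p) L2_op \<Rightarrow>
   (('q \<times> 'p \<Rightarrow> real) \<Rightarrow> 'q \<times> 'p \<Rightarrow> real) \<Rightarrow>
   (('q \<times> 'p \<Rightarrow> real) \<Rightarrow> 'q \<times> 'p \<Rightarrow> real) \<Rightarrow> bool" where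
  "hypocoercive_B \<mu> \<rho> A B B' \<longleftrightarrow>
     L2_bounded_operator \<mu> B \<and> L2_graph \<mu> B = B_graph \<mu> \<rho> A \<and>
     L2_bounded_operator \<mu> B' \<and> L2_graph \<mu> B' = L2_adjoint \<mu> (L2_graph \<mu> B) \<and>
     (\<forall>f\<in>L2 \<mu>. AE x in \<mu>. B f x = velocity_avg \<rho> (B (velocity_fluct \<rho> f)) x) \<and>
     (\<forall>f\<in>L2 \<mu>. L2_norm \<mu> (B f) \<le> 1/2 * L2_norm \<mu> (velocity_fluct \<rho> f)) \<and>
     (AE x in \<mu>. B (\<lambda>_. 1) x = 0) \<and>
     (AE x in \<mu>. B' (\<lambda>_. 1) x = 0)"

text \<open>\<open>\<langle>f, g\<rangle>\<^sub>\<epsilon> = \<langle>f, (I + \<epsilon>G)g\<rangle>\<close> with \<open>G = B + B\<^sup>*\<close>.\<close>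

definition modified_inner ::
  "'x measure \<Rightarrow> (('x \<Rightarrow> real) \<Rightarrow> 'x \<Rightarrow> real) \<Rightarrow> (('x \<Rightarrow> real) \<Rightarrow> 'x \<Rightarrow> real) \<Rightarrow> real \<Rightarrow>
   ('x \<Rightarrow> real) \<Rightarrow> ('x \<Rightarrow> real) \<Rightarrow> real" where
  "modified_inner \<mu> B B' \<epsilon> f g = L2_inner \<mu> f (\<lambda>x. g x + \<epsilon> * (B g x + B' g x))"

text \<open>\<open>\<C>\<close> is the set of suitable test functions on which the constants are required to work: mean
  zero functions, dense among all of these, on which every operator that occurs is defined.  It
  need not be all of the common domain of the operators.\<close>

definition hypocoercivity_constants ::
  "('q \<times> 'p) measure \<Rightarrow> 'p measure \<Rightarrow> ('q \<times> 'p) L2_op \<Rightarrow>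
   (('q \<times> 'p \<Rightarrow> real) \<Rightarrow> 'q \<times> 'p \<Rightarrow> real) \<Rightarrow> ('q \<times> 'p \<Rightarrow> real) set \<Rightarrow>
   real \<Rightarrow> real \<Rightarrow> real \<Rightarrow> bool" where
  "hypocoercivity_constants \<mu> \<rho> A B \<C> l\<^sub>q l\<^sub>p R\<^sub>0 \<longleftrightarrow>
     (let S = symmetric_part \<mu> A; T = antisymmetric_part \<mu> A;
          Av = velocity_avg \<rho>; Fl = velocity_fluct \<rho>
      in 0 < l\<^sub>q \<and> l\<^sub>q < 1 \<and> 0 < l\<^sub>p \<and> 0 < R\<^sub>0 \<and>
         (\<forall>f\<in>\<C>. f \<in> L2 \<mu> \<and> (\<integral>x. f x \<partial>\<mu>) = 0 \<and>
            f \<in> Domain S \<and> Av f \<in> Domain T \<and> Fl f \<in> Domain S \<inter> Domain T) \<and>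
         (\<forall>f\<in>L2 \<mu>. (\<integral>x. f x \<partial>\<mu>) = 0 \<longrightarrow>
            (\<forall>\<delta>>0. \<exists>g\<in>\<C>. L2_norm \<mu> (\<lambda>x. f x - g x) < \<delta>)) \<and>
         (\<forall>f\<in>\<C>. \<forall>h. (f, h) \<in> S \<longrightarrow>
            L2_inner \<mu> f (\<lambda>x. - h x) \<ge> l\<^sub>p * (L2_norm \<mu> (Fl f))\<^sup>2) \<and>
         (\<forall>f\<in>\<C>. \<forall>h. (Av f, h) \<in> T \<longrightarrow>
            L2_inner \<mu> (\<lambda>x. - B h x) (Av f) \<ge> l\<^sub>q * (L2_norm \<mu> (Av f))\<^sup>2) \<and>
         (\<forall>f\<in>\<C>. \<forall>h k. (Fl f, h) \<in> T \<and> (Fl f, k) \<in> S \<longrightarrow>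
            L2_norm \<mu> (B h) + L2_norm \<mu> (B k) \<le> R\<^sub>0 * L2_norm \<mu> (Fl f)))"

definition Lam :: "real \<Rightarrow> real \<Rightarrow> real \<Rightarrow> real \<Rightarrow> real" where
  "Lam l\<^sub>q l\<^sub>p R\<^sub>0 \<epsilon> =
     ((l\<^sub>q - 1) * \<epsilon> + l\<^sub>p - sqrt (((l\<^sub>q + 1) * \<epsilon> - l\<^sub>p)\<^sup>2 + \<epsilon>\<^sup>2 * R\<^sub>0\<^sup>2)) / 2"

section \<open>Path space and relative entropy\<close>

text \<open>On the space of cadlag paths the evaluations generate the Borel \<open>\<sigma>\<close>-algebra of the Skorokhod
  topology.\<close>

definition path_space :: "'x::topological_space set \<Rightarrow> real \<Rightarrow> (real \<Rightarrow> 'x) measure" where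
  "path_space X T =
     restrict_space (PiM {0..T} (\<lambda>_. restrict_space borel X)) {w. cadlag_on {0..T} X w}"

definition path_law ::
  "'w measure \<Rightarrow> 'x::topological_space set \<Rightarrow> (real \<Rightarrow> 'w \<Rightarrow> 'x) \<Rightarrow> real \<Rightarrow> (real \<Rightarrow> 'x) measure"
  where
  "path_law M X \<xi> T = distr M (path_space X T) (\<lambda>\<omega>. \<lambda>t\<in>{0..T}. \<xi> t \<omega>)"

text \<open>For probability measures with \<open>Q\<^sub>1 \<lless> Q\<^sub>2\<close> the negative part of \<open>ln (dQ\<^sub>1/dQ\<^sub>2)\<close> is always
  \<open>Q\<^sub>1\<close>-integrable, so non-integrability means that the integral is \<open>\<infinity>\<close>.  The library function
  \<open>KL_divergence b M N\<close> is the integral of \<open>log b (dN/dM)\<close> with respect to \<open>N\<close>, so its arguments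
  are in the opposite order.\<close>

definition rel_entropy :: "'a measure \<Rightarrow> 'a measure \<Rightarrow> ereal" where
  "rel_entropy Q\<^sub>1 Q\<^sub>2 =
     (if absolutely_continuous Q\<^sub>2 Q\<^sub>1 \<and> integrable Q\<^sub>1 (entropy_density (exp 1) Q\<^sub>2 Q\<^sub>1)
      then ereal (KL_divergence (exp 1) Q\<^sub>2 Q\<^sub>1) else \<infinity>)"

end

theory Submission
  imports Defs
begin

text \<open>The time average of \<open>f\<close> along the alternative process is compared with its average along the
stationary baseline process by the Gibbs variational principle: for a bounded path functional \<open>Y\<close>,
the mean of \<open>Y\<close> under one law is at most the logarithm of the mean of \<open>exp Y\<close> under another law plus
the relative entropy (\<open>Donsker_Varadhan\<close>).  With \<open>Y = c \<integral> f(X\<^sub>t) dt\<close>, where \<open>f\<close> is centred and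
\<open>c > 0\<close>, everything is reduced to a bound on an exponential moment of the stationary process,
followed by optimisation over \<open>c\<close> (\<open>Legendre_optimisation\<close>).

The exponential moment is \<open>\<integral> u\<^sub>T d\<mu>\<close>, where \<open>u\<^sub>t(x) = E\<^sup>x exp (\<integral>\<^sub>0\<^sup>t V(X\<^sub>s) ds)\<close> and \<open>V = c f\<close>.
Formally \<open>u\<close> solves \<open>du/dt = (A + V) u\<close>, so that
\<open>d/dt \<langle>u,u\<rangle>\<^sub>\<epsilon> = 2 \<langle>(A + V) u, u\<rangle>\<^sub>\<epsilon>\<close>.  The hypocoercive estimate bounds the right-hand side by
\<open>2 (- \<Lambda> Var u + \<langle>V u, u\<rangle>\<^sub>\<epsilon>)\<close>.  Splitting \<open>u\<close> into its mean and its fluctuation shows that this is at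
most \<open>2 \<kappa> \<langle>u,u\<rangle>\<^sub>\<epsilon>\<close>: the term that is quadratic in the fluctuation is absorbed by
\<open>\<Lambda> Var u\<close> as long as \<open>(1 + \<epsilon>) \<parallel>V\<parallel>\<^sub>\<infinity> < \<Lambda>\<close>, and the mixed term is linear both in \<open>V\<close> and in the
fluctuation, so that Young's inequality leaves a constant \<open>\<kappa>\<close> of second order in \<open>V\<close>
(\<open>perturbed_form_bound\<close>).  Gronwall's inequality then gives
\<open>\<langle>u\<^sub>T,u\<^sub>T\<rangle>\<^sub>\<epsilon> \<le> exp (2 \<kappa> T)\<close> (\<open>form_growth\<close>), and comparing the two norms costs the factor
\<open>1 / sqrt (1 - \<epsilon>)\<close> that becomes the logarithm in \<open>\<eta>\<close>.

The differential equation is obtained from the path representation.  If \<open>V\<close> is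
bounded and continuous, then \<open>t \<mapsto> V(X\<^sub>t)\<close> is right-continuous, and the Markov property in the form
\<open>E\<^sup>x u\<^sub>t(X\<^sub>h) = E\<^sup>x exp (\<integral>\<^sub>0\<^sup>t V(X\<^sub>h\<^sub>+\<^sub>s) ds)\<close> (\<open>transition_u\<close>) shows by dominated convergence that the
difference quotients of \<open>u\<close> in time and those that define the generator converge in \<open>L\<^sup>2\<close>
(\<open>u_right_derivative\<close>, \<open>u_generator\<close>).  Only right derivatives are obtained, which is enough for
Gronwall's inequality.  A bounded measurable \<open>f\<close> is then approximated in \<open>L\<^sup>1(\<mu>)\<close> by continuous
functions with the same bound; by invariance of \<open>\<mu>\<close> the occupation integrals converge in \<open>L\<^sup>1\<close>
(\<open>exponential_moment_bound\<close>).

The constants obtained in this way are \<open>(1 + \<epsilon>/2)\<^sup>2 2 Var f / \<Lambda>\<close> and \<open>(1 + \<epsilon>) \<parallel>f\<parallel>\<^sub>\<infinity> / \<Lambda>\<close>; elementary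
inequalities show that they do not exceed \<open>v\<close> and \<open>b\<close>.\<close>

section \<open>Square-integrable functions\<close>

lemma L2_measurable: "f \<in> L2 M \<Longrightarrow> f \<in> borel_measurable M"
  by (simp add: L2_def)

lemma L2_square_integrable: "f \<in> L2 M \<Longrightarrow> integrable M (\<lambda>x. (f x)\<^sup>2)"
  by (simp add: L2_def)

lemma L2_mult_integrable:
  assumes "f \<in> L2 M" "g \<in> L2 M"
  shows "integrable M (\<lambda>x. f x * g x)"
proof (rule Bochner_Integration.integrable_bound)
  note [measurable] = assms[THEN L2_measurable]
  show "integrable M (\<lambda>x. (f x)\<^sup>2 + (g x)\<^sup>2)"
    using assms by (intro Bochner_Integration.integrable_add L2_square_integrable)
  show "(\<lambda>x. f x * g x) \<in> borel_measurable M" by measurable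
  have "\<bar>a * b\<bar> \<le> a\<^sup>2 + b\<^sup>2" for a b :: real
    using sum_squares_bound[of "\<bar>a\<bar>" "\<bar>b\<bar>"] mult_nonneg_nonneg[OF abs_ge_zero[of a] abs_ge_zero[of b]]
    unfolding abs_mult power2_abs by linarith
  then show "AE x in M. norm (f x * g x) \<le> norm ((f x)\<^sup>2 + (g x)\<^sup>2)"
    by (auto simp: abs_of_nonneg)
qed

lemma L2_lincomb:
  assumes "f \<in> L2 M" "g \<in> L2 M"
  shows "(\<lambda>x. a * f x + b * g x) \<in> L2 M"
proof -
  note [measurable] = assms[THEN L2_measurable]
  have "integrable M (\<lambda>x. a\<^sup>2 * (f x)\<^sup>2 + b\<^sup>2 * (g x)\<^sup>2 + 2 * a * b * (f x * g x))"
    using assms by (intro Bochner_Integration.integrable_add Bochner_Integration.integrable_mult_right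
        L2_square_integrable L2_mult_integrable)
  then have "integrable M (\<lambda>x. (a * f x + b * g x)\<^sup>2)"
    by (simp add: power2_eq_square algebra_simps)
  then show ?thesis by (simp add: L2_def)
qed

lemma L2_diff: "f \<in> L2 M \<Longrightarrow> g \<in> L2 M \<Longrightarrow> (\<lambda>x. f x - g x) \<in> L2 M"
  using L2_lincomb[of f M g 1 "-1"] by simp

lemma L2_cmult: "f \<in> L2 M \<Longrightarrow> (\<lambda>x. a * f x) \<in> L2 M"
  using L2_lincomb[of f M f a 0] by simp

lemma L2_bounded:
  assumes "finite_measure M" "f \<in> borel_measurable M" "\<And>x. x \<in> space M \<Longrightarrow> \<bar>f x\<bar> \<le> C"
  shows "f \<in> L2 M"
proof -
  interpret finite_measure M by fact
  note [measurable] = assms(2)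
  have "integrable M (\<lambda>x. (f x)\<^sup>2)"
  proof (rule integrable_const_bound[where B="C\<^sup>2"])
    show "AE x in M. norm ((f x)\<^sup>2) \<le> C\<^sup>2"
    proof (rule AE_I2)
      fix x assume "x \<in> space M"
      from power_mono[OF assms(3)[OF this], of 2] show "norm ((f x)\<^sup>2) \<le> C\<^sup>2" by simp
    qed
  qed measurable
  then show ?thesis by (simp add: L2_def)
qed

lemma L2_bounded_mult:
  assumes "v \<in> borel_measurable M" "\<And>x. x \<in> space M \<Longrightarrow> \<bar>v x\<bar> \<le> C" "f \<in> L2 M"
  shows "(\<lambda>x. v x * f x) \<in> L2 M"
proof -
  note [measurable] = assms(1) L2_measurable[OF assms(3)]
  have "integrable M (\<lambda>x. (v x * f x)\<^sup>2)"
  proof (rule Bochner_Integration.integrable_bound)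
    show "integrable M (\<lambda>x. C\<^sup>2 * (f x)\<^sup>2)" using L2_square_integrable[OF assms(3)] by simp
    show "AE x in M. norm ((v x * f x)\<^sup>2) \<le> norm (C\<^sup>2 * (f x)\<^sup>2)"
    proof (rule AE_I2)
      fix x assume "x \<in> space M"
      from power_mono[OF assms(2)[OF this], of 2]
      show "norm ((v x * f x)\<^sup>2) \<le> norm (C\<^sup>2 * (f x)\<^sup>2)"
        by (simp add: power_mult_distrib mult_right_mono abs_mult)
    qed
  qed measurable
  then show ?thesis by (simp add: L2_def)
qed

lemma L2_norm_nonneg [simp]: "0 \<le> L2_norm M f"
  by (simp add: L2_norm_def L2_inner_def)

lemma L2_norm_power2: "(L2_norm M f)\<^sup>2 = L2_inner M f f"
  by (simp add: L2_norm_def L2_inner_def)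

lemma L2_inner_commute: "L2_inner M f g = L2_inner M g f"
  by (simp add: L2_inner_def mult.commute)

lemma L2_inner_lincomb_left:
  assumes "f \<in> L2 M" "g \<in> L2 M" "h \<in> L2 M"
  shows "L2_inner M (\<lambda>x. a * f x + b * g x) h = a * L2_inner M f h + b * L2_inner M g h"
proof -
  have "L2_inner M (\<lambda>x. a * f x + b * g x) h = (\<integral>x. a * (f x * h x) + b * (g x * h x) \<partial>M)"
    by (simp add: L2_inner_def algebra_simps)
  then show ?thesis using L2_mult_integrable[OF assms(1,3)] L2_mult_integrable[OF assms(2,3)]
    by (simp add: L2_inner_def)
qed

lemma L2_inner_cong_AE:
  assumes "AE x in M. f x = f' x" "f \<in> borel_measurable M" "f' \<in> borel_measurable M"
    "g \<in> borel_measurable M"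
  shows "L2_inner M f g = L2_inner M f' g"
  unfolding L2_inner_def using assms by (intro integral_cong_AE) auto

text \<open>Elements of \<open>L\<^sup>2\<close> are functions here, not classes, so the inner product is only semidefinite; hence
the separate case in which \<open>g\<close> vanishes almost everywhere.\<close>
lemma L2_Cauchy_Schwarz:
  assumes "f \<in> L2 M" "g \<in> L2 M"
  shows "\<bar>L2_inner M f g\<bar> \<le> L2_norm M f * L2_norm M g"
proof -
  let ?a = "L2_inner M f f" and ?b = "L2_inner M f g" and ?c = "L2_inner M g g"
  have expand: "0 \<le> s\<^sup>2 * ?a + 2 * s * t * ?b + t\<^sup>2 * ?c" for s t
  proof -
    let ?h = "\<lambda>x. s * f x + t * g x"
    have h: "?h \<in> L2 M" by (rule L2_lincomb[OF assms])
    have "0 \<le> L2_inner M ?h ?h" by (simp add: L2_inner_def)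
    also have "\<dots> = s * L2_inner M ?h f + t * L2_inner M ?h g"
      by (subst L2_inner_lincomb_left[OF assms h]) (simp only: L2_inner_commute[of M f ?h] L2_inner_commute[of M g ?h])
    also have "\<dots> = s\<^sup>2 * ?a + 2 * s * t * ?b + t\<^sup>2 * ?c"
      unfolding L2_inner_lincomb_left[OF assms assms(1)] L2_inner_lincomb_left[OF assms assms(2)]
        L2_inner_commute[of M g f]
      by (simp add: power2_eq_square algebra_simps)
    finally show ?thesis .
  qed
  have nn: "0 \<le> ?a" "0 \<le> ?c" by (simp_all add: L2_inner_def)
  have "?b\<^sup>2 \<le> ?a * ?c"
  proof (cases "?c = 0")
    case True
    have "?b = 0"
    proof (rule ccontr)
      assume "?b \<noteq> 0"
      \<comment> \<open>a quadratic form without \<open>t\<^sup>2\<close> term takes the value \<open>- 1\<close> at this point\<close>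
      with expand[of 1 "- (?a + 1) / (2 * ?b)"] True nn show False by (simp add: field_simps)
    qed
    then show ?thesis using nn by simp
  next
    case False
    with nn have c: "0 < ?c" by simp
    from expand[of ?c "- ?b"] have "0 \<le> ?c * (?a * ?c - ?b\<^sup>2)"
      by (simp add: power2_eq_square algebra_simps)
    with c show ?thesis by (simp add: zero_le_mult_iff)
  qed
  then have "sqrt (?b\<^sup>2) \<le> sqrt (?a * ?c)" by (rule real_sqrt_le_mono)
  then show ?thesis by (simp add: L2_norm_def real_sqrt_mult)
qed

lemma L2_norm_cmult: "L2_norm M (\<lambda>x. a * f x) = \<bar>a\<bar> * L2_norm M f"
proof -
  have "L2_inner M (\<lambda>x. a * f x) (\<lambda>x. a * f x) = a\<^sup>2 * L2_inner M f f"
    by (simp add: L2_inner_def power2_eq_square mult_ac)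
  then show ?thesis by (simp add: L2_norm_def real_sqrt_mult)
qed

lemma (in prob_space) L2_norm_le_bound:
  assumes "f \<in> borel_measurable M" "\<And>x. x \<in> space M \<Longrightarrow> \<bar>f x\<bar> \<le> C"
  shows "L2_norm M f \<le> C"
proof -
  obtain x where "x \<in> space M" using not_empty by auto
  with assms(2)[of x] have C: "0 \<le> C" by linarith
  have f: "f \<in> L2 M" by (rule L2_bounded[OF _ assms]) unfold_locales
  have "L2_inner M f f \<le> (\<integral>x. C\<^sup>2 \<partial>M)"
    unfolding L2_inner_def
  proof (rule integral_mono)
    show "integrable M (\<lambda>x. f x * f x)" by (rule L2_mult_integrable[OF f f])
    fix x assume "x \<in> space M"
    from power_mono[OF assms(2)[OF this], of 2] show "f x * f x \<le> C\<^sup>2"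
      by (simp add: power2_eq_square)
  qed simp
  then have "L2_norm M f \<le> sqrt (C\<^sup>2)"
    unfolding L2_norm_def by (intro real_sqrt_le_mono) (simp add: prob_space)
  with C show ?thesis by simp
qed

text \<open>All \<open>L\<^sup>2\<close> limits below come from this form of bounded convergence: on a probability space it turns
pointwise limits with a uniform bound into limits in norm.\<close>
lemma (in prob_space) L2_norm_tendsto_0:
  assumes "\<And>n. f n \<in> borel_measurable M" "\<And>n x. x \<in> space M \<Longrightarrow> \<bar>f n x\<bar> \<le> C"
    and "\<And>x. x \<in> space M \<Longrightarrow> (\<lambda>n. f n x) \<longlonglongrightarrow> 0"
  shows "(\<lambda>n::nat. L2_norm M (f n)) \<longlonglongrightarrow> 0"
proof -
  have "(\<lambda>n. \<integral>x. f n x * f n x \<partial>M) \<longlonglongrightarrow> (\<integral>x. 0 \<partial>M)"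
  proof (rule integral_dominated_convergence[where w="\<lambda>_. C\<^sup>2"])
    show "AE x in M. (\<lambda>n. f n x * f n x) \<longlonglongrightarrow> 0"
      using tendsto_mult[OF assms(3) assms(3)] by auto
    show "AE x in M. norm (f n x * f n x) \<le> C\<^sup>2" for n
    proof (rule AE_I2)
      fix x assume "x \<in> space M"
      from power_mono[OF assms(2)[OF this, of n], of 2] show "norm (f n x * f n x) \<le> C\<^sup>2"
        by (simp add: power2_eq_square abs_mult)
    qed
  qed (use assms(1) in auto)
  from tendsto_real_sqrt[OF this] show ?thesis by (simp add: L2_norm_def L2_inner_def)
qed

section \<open>Growth bounds from right derivatives\<close>

text \<open>For every \<open>e > 0\<close>, the last time \<open>s\<close> at which \<open>\<phi>\<close> is below the line with slope \<open>e\<close> through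
\<open>(a, \<phi> a)\<close> must be \<open>b\<close>, since the right derivative at an earlier \<open>s\<close> is less than \<open>e\<close> and so
produces a later such time.\<close>
lemma right_derivative_nonpos_imp_le:
  fixes \<phi> :: "real \<Rightarrow> real"
  assumes ab: "a \<le> b" and cont: "continuous_on {a..b} \<phi>"
    and der: "\<And>t. a \<le> t \<Longrightarrow> t < b \<Longrightarrow>
      \<exists>d\<le>0. ((\<lambda>h. (\<phi> (t + h) - \<phi> t) / h) \<longlongrightarrow> d) (at_right 0)"
  shows "\<phi> b \<le> \<phi> a"
proof -
  have weak: "\<phi> b \<le> \<phi> a + e * (b - a)" if e: "0 < e" for e
  proof -
    define S where "S = {t \<in> {a..b}. \<phi> t - e * (t - a) \<le> \<phi> a}"
    have "closed S"
      unfolding S_def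
      by (intro continuous_closed_preimage_constant continuous_on_closed_Collect_le
          continuous_intros cont closed_atLeastAtMost)
    moreover have "bounded S" by (rule bounded_subset[of "{a..b}"]) (auto simp: S_def)
    ultimately have "compact S" by (simp add: compact_eq_bounded_closed)
    moreover have "a \<in> S" using ab by (simp add: S_def)
    ultimately obtain s where s: "s \<in> S" "\<And>t. t \<in> S \<Longrightarrow> t \<le> s"
      using compact_attains_sup[of S] by blast
    have "s = b"
    proof (rule ccontr)
      assume "s \<noteq> b"
      with s have sb: "a \<le> s" "s < b" by (auto simp: S_def)
      from der[OF this] obtain d where d: "d \<le> 0"
        "((\<lambda>h. (\<phi> (s + h) - \<phi> s) / h) \<longlongrightarrow> d) (at_right 0)" by blast
      from order_tendstoD(2)[OF d(2), of e] d(1) e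
      have "eventually (\<lambda>h. (\<phi> (s + h) - \<phi> s) / h < e) (at_right 0)" by simp
      then obtain h0 where h0: "0 < h0" "\<And>h. 0 < h \<Longrightarrow> h < h0 \<Longrightarrow> (\<phi> (s + h) - \<phi> s) / h < e"
        by (auto simp: eventually_at_right_field)
      define h where "h = min (h0 / 2) (b - s)"
      have h: "0 < h" "h < h0" "s + h \<le> b" using h0 sb by (auto simp: h_def)
      have "\<phi> (s + h) - \<phi> s < e * h" using h0(2)[OF h(1,2)] h(1) by (simp add: field_simps)
      with s(1) h sb have "s + h \<in> S" by (auto simp: S_def algebra_simps)
      from s(2)[OF this] h show False by simp
    qed
    with s(1) show ?thesis by (simp add: S_def)
  qed
  show ?thesis
  proof (rule field_le_epsilon)
    fix e :: real assume e: "0 < e"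
    define e' where "e' = e / (b - a + 1)"
    have "0 < e'" "e' * (b - a) \<le> e" using e ab by (auto simp: e'_def field_simps)
    with weak[of e'] show "\<phi> b \<le> \<phi> a + e" by linarith
  qed
qed

text \<open>The usual argument: \<open>N t * exp (- k * t)\<close> has nonpositive right derivative.\<close>
lemma Gronwall_right_derivative:
  fixes N :: "real \<Rightarrow> real"
  assumes T: "0 \<le> T" and cont: "continuous_on {0..T} N"
    and der: "\<And>t. 0 \<le> t \<Longrightarrow> t < T \<Longrightarrow>
      \<exists>d \<le> k * N t. ((\<lambda>h. (N (t + h) - N t) / h) \<longlongrightarrow> d) (at_right 0)"
  shows "N T \<le> N 0 * exp (k * T)"
proof -
  define \<phi> where "\<phi> t = N t * exp (- k * t)" for t
  have "\<phi> T \<le> \<phi> 0"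
  proof (rule right_derivative_nonpos_imp_le[OF T])
    show "continuous_on {0..T} \<phi>" unfolding \<phi>_def by (intro continuous_intros cont)
    fix t assume t: "0 \<le> t" "t < T"
    then obtain d where d: "d \<le> k * N t" "((\<lambda>h. (N (t + h) - N t) / h) \<longlongrightarrow> d) (at_right 0)"
      using der by blast
    have "((\<lambda>h. exp (- k * (t + h))) has_real_derivative (- k * exp (- k * t))) (at 0)"
      by (auto intro!: derivative_eq_intros)
    then have e: "((\<lambda>h. (exp (- k * (t + h)) - exp (- k * t)) / h) \<longlongrightarrow> - k * exp (- k * t)) (at_right 0)"
      by (auto simp: has_field_derivative_iff intro: filterlim_at_split[THEN iffD1, THEN conjunct2])
    have c: "((\<lambda>h. exp (- k * (t + h))) \<longlongrightarrow> exp (- k * (t + 0))) (at_right 0)"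
      by (intro tendsto_intros)
    have "((\<lambda>h. (N (t + h) - N t) / h * exp (- k * (t + h)) +
        N t * ((exp (- k * (t + h)) - exp (- k * t)) / h))
      \<longlongrightarrow> d * exp (- k * (t + 0)) + N t * (- k * exp (- k * t))) (at_right 0)"
      by (intro tendsto_add tendsto_mult d(2) c e tendsto_const)
    moreover have "(N (t + h) - N t) / h * exp (- k * (t + h)) +
        N t * ((exp (- k * (t + h)) - exp (- k * t)) / h) = (\<phi> (t + h) - \<phi> t) / h" for h
      by (simp add: \<phi>_def add_divide_distrib[symmetric] diff_divide_distrib algebra_simps)
    ultimately have "((\<lambda>h. (\<phi> (t + h) - \<phi> t) / h) \<longlongrightarrow> (d - k * N t) * exp (- k * t)) (at_right 0)"
      by (simp add: algebra_simps)
    moreover have "(d - k * N t) * exp (- k * t) \<le> 0"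
      using d(1) by (simp add: mult_le_0_iff)
    ultimately show "\<exists>d\<le>0. ((\<lambda>h. (\<phi> (t + h) - \<phi> t) / h) \<longlongrightarrow> d) (at_right 0)" by blast
  qed
  then have "N T * exp (- k * T) * exp (k * T) \<le> N 0 * exp (k * T)"
    by (intro mult_right_mono) (auto simp: \<phi>_def)
  then show ?thesis by (simp add: exp_minus field_simps)
qed

section \<open>Right-continuous functions of time\<close>

text \<open>The time \<open>s\<close> is replaced by the first point of the grid with mesh \<open>\<delta>\<close> that is strictly later than
\<open>s\<close>, so that \<open>s\<close> is approached from the right only.  This single approximation yields both joint
measurability and convergence of Riemann sums.\<close>
lemma right_continuous_grid_tendsto:
  fixes \<phi> :: "real \<Rightarrow> 'b::topological_space"
  assumes "(\<phi> \<longlongrightarrow> \<phi> s) (at_right s)" and "\<And>n. 0 < \<delta> n" and "\<delta> \<longlonglongrightarrow> 0"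
  shows "(\<lambda>n::nat. \<phi> (\<delta> n * (of_int \<lfloor>s / \<delta> n\<rfloor> + 1))) \<longlonglongrightarrow> \<phi> s"
proof (rule filterlim_compose[OF assms(1)])
  have gt: "s < \<delta> n * (of_int \<lfloor>s / \<delta> n\<rfloor> + 1)" for n
    using assms(2)[of n] floor_correct[of "s / \<delta> n"] by (simp add: field_simps)
  have le: "\<delta> n * (of_int \<lfloor>s / \<delta> n\<rfloor> + 1) \<le> s + \<delta> n" for n
    using mult_left_mono[OF of_int_floor_le[of "s / \<delta> n"], of "\<delta> n"] assms(2)[of n]
    by (simp add: algebra_simps)
  have "(\<lambda>n. \<delta> n * (of_int \<lfloor>s / \<delta> n\<rfloor> + 1)) \<longlonglongrightarrow> s"
  proof (rule tendsto_sandwich[of "\<lambda>_. s" _ _ "\<lambda>n. s + \<delta> n"])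
    show "(\<lambda>n. s + \<delta> n) \<longlonglongrightarrow> s" using tendsto_add[OF tendsto_const[of s] assms(3)] by simp
  qed (use gt le in \<open>auto intro!: always_eventually less_imp_le\<close>)
  then show "filterlim (\<lambda>n. \<delta> n * (of_int \<lfloor>s / \<delta> n\<rfloor> + 1)) (at_right s) sequentially"
    using gt less_imp_neq[OF gt, THEN not_sym] by (auto simp: filterlim_at)
qed

lemma right_continuous_jointly_measurable:
  fixes \<zeta> :: "real \<Rightarrow> 'w \<Rightarrow> 'x::metric_space"
  assumes meas: "\<And>s. \<zeta> s \<in> borel_measurable M"
    and rc: "\<And>\<omega> s. \<omega> \<in> space M \<Longrightarrow> ((\<lambda>r. \<zeta> r \<omega>) \<longlongrightarrow> \<zeta> s \<omega>) (at_right s)"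
  shows "(\<lambda>(s, \<omega>). \<zeta> s \<omega>) \<in> borel_measurable (borel \<Otimes>\<^sub>M M)"
proof (rule borel_measurable_LIMSEQ_metric)
  define \<delta> :: "nat \<Rightarrow> real" where "\<delta> n = inverse (real (Suc n))" for n
  have \<delta>: "\<And>n. 0 < \<delta> n" "\<delta> \<longlonglongrightarrow> 0"
    using LIMSEQ_inverse_real_of_nat by (auto simp: \<delta>_def[abs_def])
  let ?Z = "\<lambda>n (s, \<omega>). \<zeta> (\<delta> n * (of_int \<lfloor>s / \<delta> n\<rfloor> + 1)) \<omega>"
  show "?Z n \<in> borel_measurable (borel \<Otimes>\<^sub>M M)" for n
  proof -
    have "(\<lambda>p. \<zeta> (\<delta> n * (of_int \<lfloor>fst p / \<delta> n\<rfloor> + 1)) (snd p)) \<in> borel_measurable (borel \<Otimes>\<^sub>M M)"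
    proof (rule measurable_compose_countable[where f="\<lambda>k p. \<zeta> (\<delta> n * (of_int k + 1)) (snd p)"
            and g="\<lambda>p. \<lfloor>fst p / \<delta> n\<rfloor>"])
      show "(\<lambda>p. \<zeta> (\<delta> n * (real_of_int k + 1)) (snd p)) \<in> borel_measurable (borel \<Otimes>\<^sub>M M)" for k
        by (rule measurable_compose[OF measurable_snd meas])
    qed measurable
    then show ?thesis by (simp add: case_prod_beta')
  qed
  show "(\<lambda>n. ?Z n p) \<longlonglongrightarrow> (case p of (s, \<omega>) \<Rightarrow> \<zeta> s \<omega>)" if "p \<in> space (borel \<Otimes>\<^sub>M M)" for p
    using that right_continuous_grid_tendsto[OF rc \<delta>] by (auto simp: space_pair_measure)
qed

lemma set_integral_jointly_measurable:
  fixes Z :: "real \<Rightarrow> 'w \<Rightarrow> real"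
  assumes "(\<lambda>(s, \<omega>). Z s \<omega>) \<in> borel_measurable (borel \<Otimes>\<^sub>M M)" and [measurable]: "A \<in> sets borel"
  shows "(\<lambda>\<omega>. LINT s:A|lborel. Z s \<omega>) \<in> borel_measurable M"
proof -
  have "sets (M \<Otimes>\<^sub>M borel) = sets (M \<Otimes>\<^sub>M lborel)" by (intro sets_pair_measure_cong) simp_all
  from measurable_cong_sets[OF this refl] measurable_pair_swap[OF assms(1)]
  have [measurable]: "(\<lambda>p. Z (snd p) (fst p)) \<in> borel_measurable (M \<Otimes>\<^sub>M lborel)"
    by (simp add: case_prod_beta')
  show ?thesis
    unfolding set_lebesgue_integral_def
    by (rule lborel.borel_measurable_lebesgue_integral) (simp add: case_prod_beta')
qed

lemma right_continuous_borel_measurable: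
  fixes \<phi> :: "real \<Rightarrow> 'b::metric_space"
  assumes "\<And>s. (\<phi> \<longlongrightarrow> \<phi> s) (at_right s)"
  shows "\<phi> \<in> borel_measurable borel"
proof -
  have "(\<lambda>(s, \<omega>::unit). \<phi> s) \<in> borel_measurable (borel \<Otimes>\<^sub>M count_space UNIV)"
    using assms by (intro right_continuous_jointly_measurable) auto
  from measurable_compose[OF measurable_Pair2'[of "()"] this] show ?thesis by simp
qed

lemma bounded_measurable_set_integrable:
  fixes \<phi> :: "real \<Rightarrow> real"
  assumes "\<phi> \<in> borel_measurable borel" "\<And>s. \<bar>\<phi> s\<bar> \<le> C" "A \<in> sets borel" "bounded A"
  shows "set_integrable lborel A \<phi>"
  unfolding set_integrable_def
proof (rule Bochner_Integration.integrable_bound)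
  show "integrable lborel (\<lambda>s. C * indicator A s)"
    using assms(3) emeasure_bounded_finite[OF assms(4)]
    by (intro Bochner_Integration.integrable_mult_right) (simp add: integrable_indicator_iff)
  show "AE x in lborel. norm (indicator A x *\<^sub>R \<phi> x) \<le> norm (C * indicator A x)"
    using assms(2) order_trans[OF assms(2) abs_ge_self[of C]] by (auto simp: indicator_def)
qed (use assms in auto)

lemma integral_0_add:
  fixes \<phi> :: "real \<Rightarrow> real"
  assumes "\<phi> \<in> borel_measurable borel" "\<And>s. \<bar>\<phi> s\<bar> \<le> C" "0 \<le> a" "0 \<le> h"
  shows "(LINT s:{0..a+h}|lborel. \<phi> s) = (LINT s:{0..a}|lborel. \<phi> s) + (LINT s:{a..a+h}|lborel. \<phi> s)"
proof -
  note I = bounded_measurable_set_integrable[OF assms(1,2)]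
  have "(LINT s:{0..a+h}|lborel. \<phi> s) = integral {0..a+h} \<phi>"
    by (intro set_borel_integral_eq_integral I) auto
  also have "\<dots> = integral {0..a} \<phi> + integral {a..a+h} \<phi>"
    by (intro Henstock_Kurzweil_Integration.integral_combine[symmetric] set_borel_integral_eq_integral I)
      (use assms in auto)
  also have "\<dots> = (LINT s:{0..a}|lborel. \<phi> s) + (LINT s:{a..a+h}|lborel. \<phi> s)"
    by (intro arg_cong2[where f="(+)"] set_borel_integral_eq_integral(2)[symmetric] I) auto
  finally show ?thesis .
qed

lemma abs_set_integral_le:
  fixes \<phi> :: "real \<Rightarrow> real"
  assumes bound: "\<And>s. s \<in> {a..b} \<Longrightarrow> \<bar>\<phi> s\<bar> \<le> C" and ab: "a \<le> b"
  shows "\<bar>LINT s:{a..b}|lborel. \<phi> s\<bar> \<le> C * (b - a)"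
proof (cases "set_integrable lborel {a..b} \<phi>")
  case True
  have "\<bar>LINT s:{a..b}|lborel. \<phi> s\<bar> \<le> (LINT s:{a..b}|lborel. \<bar>\<phi> s\<bar>)"
    using set_integral_norm_bound[OF True] by simp
  also have "\<dots> \<le> (LINT s:{a..b}|lborel. C)"
    using bound by (intro set_integral_mono set_integrable_abs[OF True]
        bounded_measurable_set_integrable[where C="\<bar>C\<bar>"]) auto
  also have "\<dots> = C * (b - a)" using ab by (simp add: set_lebesgue_integral_def)
  finally show ?thesis .
next
  case False
  \<comment> \<open>the integral then has the default value \<open>0\<close>\<close>
  have "0 \<le> C" using bound[of a] ab by force
  with False ab show ?thesis
    by (simp add: set_lebesgue_integral_def set_integrable_def not_integrable_integral_eq)
qed

lemma right_derivative_integral: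
  fixes \<phi> :: "real \<Rightarrow> real"
  assumes meas: "\<phi> \<in> borel_measurable borel" and bnd: "\<And>s. \<bar>\<phi> s\<bar> \<le> C"
    and rc: "(\<phi> \<longlongrightarrow> \<phi> a) (at_right a)" and a: "0 \<le> a"
  shows "((\<lambda>h. LINT s:{0..a+h}|lborel. \<phi> s) has_real_derivative \<phi> a) (at 0 within {0..})"
proof -
  note I = bounded_measurable_set_integrable[OF meas bnd]
  let ?F = "\<lambda>u. integral {a..u} \<phi>"
  have "(?F has_vector_derivative \<phi> a) (at a within ({a..a+1} - {}))"
  proof (rule integral_has_vector_derivative_continuous_at)
    show "\<phi> integrable_on {a..a+1}" by (intro set_borel_integral_eq_integral I) auto
    show "continuous (at a within {a..a+1} - {}) \<phi>"
      using rc by (simp add: continuous_within at_within_Icc_at_right)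
  qed auto
  then have "((\<lambda>u. (?F u - ?F a) / (u - a)) \<longlongrightarrow> \<phi> a) (at_right a)"
    by (simp add: has_real_derivative_iff_has_vector_derivative[symmetric] has_field_derivative_iff
        at_within_Icc_at_right)
  then have lim: "((\<lambda>h. (?F (h + a) - ?F a) / h) \<longlongrightarrow> \<phi> a) (at_right 0)"
    by (simp add: filterlim_at_right_to_0[of _ _ a])
  have eq: "(LINT s:{0..a+h}|lborel. \<phi> s) = (LINT s:{0..a}|lborel. \<phi> s) + ?F (h + a)" if "0 \<le> h" for h
    using integral_0_add[OF meas bnd a that] set_borel_integral_eq_integral(2)[OF I, of "{a..a+h}"]
    by (simp add: add.commute)
  have at0: "at 0 within {0..} = at_right (0::real)"
    by (simp add: at_within_Ici_at_right)
  show ?thesis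
    unfolding has_field_derivative_iff at0
  proof (rule Lim_transform_eventually[OF lim])
    show "\<forall>\<^sub>F h in at_right 0. (?F (h + a) - ?F a) / h =
        ((LINT s:{0..a+h}|lborel. \<phi> s) - (LINT s:{0..a+0}|lborel. \<phi> s)) / (h - 0)"
      using eq eq[of 0] by (auto simp: eventually_at_right_field intro!: exI[of _ 1])
  qed
qed

text \<open>On a cell of the grid the step function has the value of \<open>\<phi>\<close> at the right end point, so its
integral is a Riemann sum.\<close>
lemma integral_grid_step:
  fixes \<phi> :: "real \<Rightarrow> real"
  assumes meas: "\<phi> \<in> borel_measurable borel" and bnd: "\<And>s. \<bar>\<phi> s\<bar> \<le> C" and \<delta>: "0 < \<delta>"
  shows "(LINT s:{0..<\<delta> * real n}|lborel. \<phi> (\<delta> * (of_int \<lfloor>s / \<delta>\<rfloor> + 1))) =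
    (\<Sum>k<n. \<delta> * \<phi> (\<delta> * (real k + 1)))"
proof (induction n)
  case (Suc n)
  let ?D = "\<lambda>s. \<phi> (\<delta> * (of_int \<lfloor>s / \<delta>\<rfloor> + 1))"
  have D: "?D \<in> borel_measurable borel" using meas by measurable
  note I = bounded_measurable_set_integrable[OF D bnd]
  let ?A = "{0..<\<delta> * real n}" and ?B = "{\<delta> * real n..<\<delta> * real (Suc n)}"
  have "(LINT s:{0..<\<delta> * real (Suc n)}|lborel. ?D s) = (LINT s:?A \<union> ?B|lborel. ?D s)"
    using \<delta> by (intro arg_cong[where f="\<lambda>S. LINT s:S|lborel. ?D s"])
      (auto simp: algebra_simps intro: order_trans[OF mult_nonneg_nonneg[OF less_imp_le[OF \<delta>] of_nat_0_le_iff]])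
  also have "\<dots> = (LINT s:?A|lborel. ?D s) + (LINT s:?B|lborel. ?D s)"
    by (intro set_integral_Un I) (use \<delta> in auto)
  also have "(LINT s:?B|lborel. ?D s) = (LINT s:?B|lborel. \<phi> (\<delta> * (real n + 1)))"
  proof (rule set_lebesgue_integral_cong, simp, intro ballI allI impI)
    fix s assume "s \<in> ?B"
    then have "\<lfloor>s / \<delta>\<rfloor> = int n" using \<delta> by (auto simp: floor_eq_iff field_simps)
    then show "?D s = \<phi> (\<delta> * (real n + 1))" by simp
  qed
  also have "\<dots> = \<delta> * \<phi> (\<delta> * (real n + 1))"
    using \<delta> by (simp add: set_lebesgue_integral_def algebra_simps)
  finally show ?case by (simp add: Suc.IH)
qed (simp add: set_lebesgue_integral_def)

text \<open>A right-continuous bounded function is approximated pointwise by its step functions, and dominated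
convergence applies.\<close>
lemma Riemann_sum_tendsto_integral:
  fixes \<phi> :: "real \<Rightarrow> real"
  assumes meas: "\<phi> \<in> borel_measurable borel" and bnd: "\<And>s. \<bar>\<phi> s\<bar> \<le> C"
    and rc: "\<And>s. (\<phi> \<longlongrightarrow> \<phi> s) (at_right s)" and t: "0 < t"
  shows "(\<lambda>n. \<Sum>k<Suc n. t / real (Suc n) * \<phi> (t / real (Suc n) * (real k + 1)))
    \<longlonglongrightarrow> (LINT s:{0..t}|lborel. \<phi> s)"
proof -
  define \<delta> where "\<delta> n = t / real (Suc n)" for n
  have \<delta>: "0 < \<delta> n" "\<delta> n * real (Suc n) = t" for n using t by (auto simp: \<delta>_def)
  have \<delta>0: "\<delta> \<longlonglongrightarrow> 0"
    using tendsto_mult[OF tendsto_const[of t] LIMSEQ_inverse_real_of_nat]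
    by (simp add: \<delta>_def[abs_def] divide_inverse)
  have "(\<lambda>n. LINT s:{0..<t}|lborel. \<phi> (\<delta> n * (of_int \<lfloor>s / \<delta> n\<rfloor> + 1))) \<longlonglongrightarrow> (LINT s:{0..<t}|lborel. \<phi> s)"
    unfolding set_lebesgue_integral_def
  proof (rule integral_dominated_convergence[where w="\<lambda>s. \<bar>C\<bar> * indicator {0..<t} s"])
    show "AE s in lborel. (\<lambda>n. indicator {0..<t} s *\<^sub>R \<phi> (\<delta> n * (of_int \<lfloor>s / \<delta> n\<rfloor> + 1)))
        \<longlonglongrightarrow> indicator {0..<t} s *\<^sub>R \<phi> s"
      by (intro AE_I2 tendsto_intros right_continuous_grid_tendsto rc \<delta> \<delta>0)
    show "AE s in lborel. norm (indicator {0..<t} s *\<^sub>R \<phi> (\<delta> n * (of_int \<lfloor>s / \<delta> n\<rfloor> + 1)))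
        \<le> \<bar>C\<bar> * indicator {0..<t} s" for n
      using order_trans[OF bnd abs_ge_self] by (intro AE_I2) (auto simp: indicator_def)
    show "integrable lborel (\<lambda>s. \<bar>C\<bar> * indicator {0..<t} s :: real)"
      using t by (intro Bochner_Integration.integrable_mult_right) auto
  qed (use meas in measurable)
  moreover have "(LINT s:{0..<t}|lborel. \<phi> s) = (LINT s:{0..t}|lborel. \<phi> s)"
    unfolding set_lebesgue_integral_def
  proof (rule integral_cong_AE)
    show "AE s in lborel. indicator {0..<t} s *\<^sub>R \<phi> s = indicator {0..t} s *\<^sub>R \<phi> s"
      using AE_lborel_singleton[of t] by eventually_elim (auto simp: indicator_def)
  qed (use meas in measurable)
  moreover have "(LINT s:{0..<t}|lborel. \<phi> (\<delta> n * (of_int \<lfloor>s / \<delta> n\<rfloor> + 1))) =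
      (\<Sum>k<Suc n. \<delta> n * \<phi> (\<delta> n * (real k + 1)))" for n
    using integral_grid_step[OF meas bnd \<delta>(1), of n "Suc n"] by (simp only: \<delta>(2))
  ultimately show ?thesis by (simp add: \<delta>_def)
qed

lemma cadlag_right_limit:
  assumes "cadlag_on I X w" "t \<in> I"
  shows "(w \<longlongrightarrow> w t) (at t within (I \<inter> {t..}))" "w t \<in> X"
  using assms by (auto simp: cadlag_on_def)

text \<open>Freezing the path before time \<open>0\<close> makes it right-continuous on the whole real line, as the lemmas
above require.\<close>
lemma cadlag_clamp_right_continuous:
  fixes w :: "real \<Rightarrow> 'x::topological_space"
  assumes "cadlag_on {0..} X w"
  shows "((\<lambda>r. w (max 0 r)) \<longlongrightarrow> w (max 0 s)) (at_right s)"
proof (cases "0 \<le> s")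
  case True
  have "(w \<longlongrightarrow> w s) (at_right s)"
    using cadlag_right_limit(1)[OF assms, of s] True by (rule_tac tendsto_within_subset) auto
  moreover have "\<forall>\<^sub>F r in at_right s. w r = w (max 0 r)"
    using True by (auto simp: eventually_at_filter max_def)
  ultimately have "((\<lambda>r. w (max 0 r)) \<longlongrightarrow> w s) (at_right s)" by (rule Lim_transform_eventually)
  then show ?thesis using True by (simp add: max_def)
next
  case False
  then show ?thesis
    by (intro tendsto_eventually eventually_at_rightI[of s 0]) auto
qed

section \<open>Approximation by continuous functions\<close>

lemma measurable_of_restrict_borel:
  assumes "sets M = sets (restrict_space borel X)" "g \<in> borel \<rightarrow>\<^sub>M N"
  shows "g \<in> M \<rightarrow>\<^sub>M N"
  using measurable_restrict_space1[OF assms(2), of X] measurable_cong_sets[OF assms(1) refl] by blast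

text \<open>For the indicator of a measurable set, inner regularity provides a compact subset \<open>K\<close> of almost the
same measure, and the indicator of \<open>K\<close> is the limit of the continuous functions
\<open>max 0 (1 - n * infdist x K)\<close>.  The measure lives on the subspace \<open>X\<close>, which need not be a Borel set,
so regularity is applied to its image on the whole space.\<close>
lemma continuous_L1_approximation:
  fixes M :: "'x::{complete_space,second_countable_topology} measure"
  assumes sets: "sets M = sets (restrict_space borel X)" and fin: "finite_measure M"
    and f: "integrable M f" and e: "0 < e"
  shows "\<exists>g::'x \<Rightarrow> real. continuous_on UNIV g \<and> bounded (range g) \<and> (\<integral>x. \<bar>f x - g x\<bar> \<partial>M) < e"
  using f e
proof (induction arbitrary: e rule: integrable_induct)
  interpret finite_measure M by fact
  have meas: "g \<in> borel_measurable M" if "continuous_on UNIV g" for g :: "'x \<Rightarrow> real"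
    using that by (intro measurable_of_restrict_borel[OF sets] borel_measurable_continuous_onI)
  have int: "integrable M g" if "continuous_on UNIV g" "bounded (range g)" for g :: "'x \<Rightarrow> real"
  proof -
    from that(2) obtain C where "\<And>x. norm (g x) \<le> C" by (auto simp: bounded_iff)
    then show ?thesis by (intro integrable_const_bound[of _ C] meas that AE_I2)
  qed
  {
    case (base A c)
    from base(1) obtain D where D: "D \<in> sets borel" "A = D \<inter> X"
      by (auto simp: sets sets_restrict_space)
    define N where "N = distr M borel (\<lambda>x. x)"
    have idm: "(\<lambda>x. x) \<in> borel_measurable M"
      by (rule measurable_of_restrict_borel[OF sets]) simp
    have spM: "space M = X" using sets_eq_imp_space_eq[OF sets] by (simp add: space_restrict_space)
    interpret N: finite_measure N unfolding N_def by (rule finite_measure_distr[OF idm])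
    have N: "measure N S = measure M (S \<inter> X)" if "S \<in> sets borel" for S
      using that unfolding N_def by (subst measure_distr[OF idm]) (simp_all add: spM)
    \<comment> \<open>the error is incurred twice, in passing from \<open>A\<close> to \<open>K\<close> and from \<open>K\<close> to \<open>g\<close>, and multiplied by \<open>\<bar>c\<bar>\<close>\<close>
    define e' where "e' = e / (2 * (\<bar>c\<bar> + 1))"
    have e': "0 < e'" using base(3) by (simp add: e'_def)
    obtain K where K: "K \<subseteq> D" "compact K" "measure N D - e' < measure N K"
    proof (cases "measure N D < e'")
      case True
      then show ?thesis using that[of "{}"] by simp
    next
      case False
      have "ennreal (measure N D - e') < emeasure N D"
        using False e' unfolding N.emeasure_eq_measure by (intro ennreal_lessI) auto
      also have "emeasure N D = (SUP K \<in> {K. K \<subseteq> D \<and> compact K}. emeasure N K)"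
        by (rule inner_regular) (simp_all add: N_def D N.emeasure_finite[unfolded N_def])
      finally obtain K where "K \<subseteq> D" "compact K" "ennreal (measure N D - e') < emeasure N K"
        by (auto simp: less_SUP_iff)
      then show ?thesis using that[of K] False
        unfolding N.emeasure_eq_measure by (simp add: ennreal_less_iff)
    qed
    have Kb: "K \<in> sets borel" "closed K" using K(2) by (auto intro: borel_compact compact_imp_closed)
    have KM: "K \<inter> X \<in> sets M"
      unfolding sets sets_restrict_space using imageI[OF Kb(1), of "(\<inter>) X"] by (simp add: Int_commute)
    have indK: "(indicator K :: 'x \<Rightarrow> real) \<in> borel_measurable M"
      using Kb by (intro measurable_of_restrict_borel[OF sets]) auto
    have "\<exists>g::'x \<Rightarrow> real. continuous_on UNIV g \<and> bounded (range g) \<and> (\<integral>x. \<bar>indicator K x - g x\<bar> \<partial>M) < e'"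
    proof (cases "K = {}")
      case True
      then show ?thesis using e' by (intro exI[of _ "\<lambda>_. 0"]) (auto intro: continuous_intros)
    next
      case False
      define g where "g n x = max 0 (1 - real n * infdist x K)" for n x
      have g: "continuous_on UNIV (g n)" for n
        unfolding g_def[abs_def] by (intro continuous_intros)
      have g01: "0 \<le> g n x" "g n x \<le> 1" for n x by (auto simp: g_def infdist_nonneg)
      then have gb: "bounded (range (g n))" for n by (auto simp: bounded_iff intro!: exI[of _ 1])
      have "(\<lambda>n. \<integral>x. \<bar>indicator K x - g n x\<bar> \<partial>M) \<longlonglongrightarrow> (\<integral>x. 0 \<partial>M)"
      proof (rule integral_dominated_convergence[where w="\<lambda>_. 1"])
        show "AE x in M. (\<lambda>n. \<bar>indicator K x - g n x\<bar>) \<longlonglongrightarrow> 0"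
        proof (rule AE_I2, rule tendsto_eventually)
          fix x
          show "\<forall>\<^sub>F n in sequentially. \<bar>indicator K x - g n x\<bar> = 0"
          proof (cases "x \<in> K")
            case True
            then show ?thesis by (simp add: g_def)
          next
            case xK: False
            have pos: "0 < infdist x K" using xK in_closed_iff_infdist_zero[OF Kb(2) False, of x] infdist_nonneg[of x K]
              by linarith
            obtain m where m: "1 < real m * infdist x K" using reals_Archimedean3[OF pos] by blast
            have "1 < real n * infdist x K" if "m \<le> n" for n
              using m mult_right_mono[OF of_nat_mono[OF that] infdist_nonneg[of x K]] by (rule less_le_trans)
            then show ?thesis using xK
              by (intro eventually_sequentiallyI[of m]) (simp add: g_def less_imp_le)
          qed
        qed
        show "AE x in M. norm \<bar>indicator K x - g n x\<bar> \<le> 1" for n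
        proof (rule AE_I2)
          fix x show "norm \<bar>indicator K x - g n x\<bar> \<le> 1"
            using g01[of n x] by (auto simp: indicator_def abs_if)
        qed
      qed (use meas[OF g] indK in auto)
      from order_tendstoD(2)[OF this, of e'] e'
      obtain n where "(\<integral>x. \<bar>indicator K x - g n x\<bar> \<partial>M) < e'" by (auto simp: eventually_sequentially)
      with g gb show ?thesis by blast
    qed
    then obtain g :: "'x \<Rightarrow> real" where g: "continuous_on UNIV g" "bounded (range g)"
      "(\<integral>x. \<bar>indicator K x - g x\<bar> \<partial>M) < e'" by blast
    have indA: "(indicator A :: 'x \<Rightarrow> real) \<in> borel_measurable M" using base(1) by simp
    have iK: "integrable M (indicator K :: 'x \<Rightarrow> real)"
      using indK by (intro integrable_const_bound[of _ 1]) auto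
    have i1: "integrable M (\<lambda>x. \<bar>indicator K x - g x\<bar>)"
      by (intro integrable_abs Bochner_Integration.integrable_diff int[OF g(1,2)] iK)
    have iA: "integrable M (indicator A :: 'x \<Rightarrow> real)"
      using base(1,2) by (simp add: integrable_indicator_iff less_top[symmetric])
    have i2: "integrable M (\<lambda>x. \<bar>indicator A x - indicator K x :: real\<bar>)"
      by (intro integrable_abs Bochner_Integration.integrable_diff iA iK)
    have "(\<integral>x. \<bar>indicator A x - indicator K x :: real\<bar> \<partial>M) = (\<integral>x. indicator (A - K \<inter> X) x \<partial>M)"
      using K(1) D(2) spM by (intro Bochner_Integration.integral_cong) (auto simp: indicator_def)
    also have "\<dots> = measure M A - measure M (K \<inter> X)"
    proof -
      have "(A - K \<inter> X) \<inter> space M = A - K \<inter> X" using D(2) spM by auto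
      moreover have "measure M (A - K \<inter> X) = measure M A - measure M (K \<inter> X)"
        using D(2) K(1) by (intro finite_measure_Diff base(1) KM) auto
      ultimately show ?thesis by simp
    qed
    also have "\<dots> < e'" using K(3) N[OF D(1)] N[OF Kb(1)] D(2) by simp
    finally have AK: "(\<integral>x. \<bar>indicator A x - indicator K x :: real\<bar> \<partial>M) < e'" .
    have "(\<integral>x. \<bar>indicator A x *\<^sub>R c - c * g x\<bar> \<partial>M)
        \<le> (\<integral>x. \<bar>c\<bar> * (\<bar>indicator A x - indicator K x\<bar> + \<bar>indicator K x - g x\<bar>) \<partial>M)"
    proof (rule integral_mono)
      show "integrable M (\<lambda>x. \<bar>indicator A x *\<^sub>R c - c * g x\<bar>)"
        using int[OF g(1,2)] base(1,2)
        by (intro integrable_abs Bochner_Integration.integrable_diff integrable_mult_right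
            integrable_scaleR_left) (auto simp: less_top[symmetric])
      show "integrable M (\<lambda>x. \<bar>c\<bar> * (\<bar>indicator A x - indicator K x\<bar> + \<bar>indicator K x - g x\<bar>))"
        using i1 i2 by auto
      show "\<bar>indicator A x *\<^sub>R c - c * g x\<bar> \<le> \<bar>c\<bar> * (\<bar>indicator A x - indicator K x\<bar> + \<bar>indicator K x - g x\<bar>)" for x
      proof -
        have "indicator A x *\<^sub>R c - c * g x = c * (indicator A x - g x)" by (simp add: algebra_simps)
        then show ?thesis by (auto simp: abs_mult intro!: mult_left_mono)
      qed
    qed
    also have "\<dots> = \<bar>c\<bar> * ((\<integral>x. \<bar>indicator A x - indicator K x\<bar> \<partial>M) + (\<integral>x. \<bar>indicator K x - g x\<bar> \<partial>M))"
      using i1 i2 by simp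
    also have "\<dots> \<le> \<bar>c\<bar> * (e' + e')" using AK g(3) by (intro mult_left_mono) auto
    also have "\<bar>c\<bar> * (e' + e') = e - 2 * e'"
    proof -
      have "2 * (\<bar>c\<bar> + 1) * e' = e" by (simp add: e'_def)
      then show ?thesis by (simp add: algebra_simps)
    qed
    also have "\<dots> < e" using e' by simp
    finally have "(\<integral>x. \<bar>indicator A x *\<^sub>R c - c * g x\<bar> \<partial>M) < e" .
    moreover have "continuous_on UNIV (\<lambda>x. c * g x)" by (intro continuous_intros g(1))
    moreover have "bounded (range (\<lambda>x. c * g x))"
    proof -
      obtain C where C: "\<And>x. norm (g x) \<le> C" using g(2) by (auto simp: bounded_iff)
      have "norm (c * g x) \<le> \<bar>c\<bar> * C" for x
        unfolding norm_mult using C[of x] by (intro mult_mono) auto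
      then show ?thesis by (auto simp: bounded_iff)
    qed
    ultimately show ?case by blast
  next
    case (add f1 f2)
    from add.prems have "0 < e / 2" by simp
    from add.IH(1)[OF this] add.IH(2)[OF this] obtain g1 g2 :: "'x \<Rightarrow> real" where
      g1: "continuous_on UNIV g1" "bounded (range g1)" "(\<integral>x. \<bar>f1 x - g1 x\<bar> \<partial>M) < e / 2" and
      g2: "continuous_on UNIV g2" "bounded (range g2)" "(\<integral>x. \<bar>f2 x - g2 x\<bar> \<partial>M) < e / 2" by blast
    have i: "integrable M g1" "integrable M g2" using g1 g2 by (auto intro: int)
    have "(\<integral>x. \<bar>f1 x + f2 x - (g1 x + g2 x)\<bar> \<partial>M) \<le> (\<integral>x. \<bar>f1 x - g1 x\<bar> + \<bar>f2 x - g2 x\<bar> \<partial>M)"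
      using i add.hyps by (intro integral_mono) auto
    also have "\<dots> < e" using i add.hyps g1(3) g2(3) by simp
    finally show ?case using bounded_plus_comp[OF g1(2) g2(2)] g1 g2
      by (intro exI[of _ "\<lambda>x. g1 x + g2 x"]) (auto intro: continuous_intros)
  next
    case (lim f s)
    have sm: "s i \<in> borel_measurable M" "f \<in> borel_measurable M" for i using lim by auto
    have "(\<lambda>i. \<integral>x. \<bar>f x - s i x\<bar> \<partial>M) \<longlonglongrightarrow> (\<integral>x. 0 \<partial>M)"
    proof (rule integral_dominated_convergence[where w="\<lambda>x. 3 * \<bar>f x\<bar>"])
      show "AE x in M. (\<lambda>i. \<bar>f x - s i x\<bar>) \<longlonglongrightarrow> 0"
      proof (rule AE_I2)
        fix x assume "x \<in> space M"
        from tendsto_rabs[OF tendsto_diff[OF tendsto_const[of "f x"] lim.hyps(2)[OF this]]]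
        show "(\<lambda>i. \<bar>f x - s i x\<bar>) \<longlonglongrightarrow> 0" by simp
      qed
      show "AE x in M. norm \<bar>f x - s i x\<bar> \<le> 3 * \<bar>f x\<bar>" for i
      proof (rule AE_I2)
        fix x assume "x \<in> space M"
        from lim.hyps(3)[OF this, of i] show "norm \<bar>f x - s i x\<bar> \<le> 3 * \<bar>f x\<bar>" by simp
      qed
    qed (use lim.hyps sm in auto)
    from order_tendstoD(2)[OF this, of "e / 2"] lim.prems
    obtain i where i: "(\<integral>x. \<bar>f x - s i x\<bar> \<partial>M) < e / 2" by (auto simp: eventually_sequentially)
    from lim.IH[of "e / 2" i] lim.prems obtain g :: "'x \<Rightarrow> real" where
      g: "continuous_on UNIV g" "bounded (range g)" "(\<integral>x. \<bar>s i x - g x\<bar> \<partial>M) < e / 2" by auto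
    have gi: "integrable M g" using g by (auto intro: int)
    have "(\<integral>x. \<bar>f x - g x\<bar> \<partial>M) \<le> (\<integral>x. \<bar>f x - s i x\<bar> + \<bar>s i x - g x\<bar> \<partial>M)"
      using gi lim.hyps by (intro integral_mono) auto
    also have "\<dots> < e" using gi lim.hyps i g(3) by simp
    finally show ?case using g by blast
  }
qed

text \<open>Truncating the approximant at the bound of \<open>f\<close> only brings it closer to \<open>f\<close>.  The common bound is
what keeps the condition \<open>(1 + \<epsilon>) * C < \<Lambda>\<close> valid for all approximants.\<close>
lemma clamped_continuous_L1_approximation:
  fixes M :: "'x::{complete_space,second_countable_topology} measure"
  assumes sets: "sets M = sets (restrict_space borel X)" and fin: "finite_measure M"
    and f: "f \<in> borel_measurable M" "\<And>x. x \<in> X \<Longrightarrow> \<bar>f x\<bar> \<le> C" and C: "0 \<le> C" and e: "0 < e"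
  shows "\<exists>g::'x \<Rightarrow> real. continuous_on UNIV g \<and> (\<forall>x. \<bar>g x\<bar> \<le> C) \<and> (\<integral>x. \<bar>f x - g x\<bar> \<partial>M) < e"
proof -
  interpret finite_measure M by fact
  have spM: "space M = X" using sets_eq_imp_space_eq[OF sets] by (simp add: space_restrict_space)
  have fi: "integrable M f" using f spM by (intro integrable_const_bound[of _ C]) auto
  obtain g :: "'x \<Rightarrow> real" where g: "continuous_on UNIV g" "bounded (range g)" "(\<integral>x. \<bar>f x - g x\<bar> \<partial>M) < e"
    using continuous_L1_approximation[OF sets fin fi e] by blast
  have gm: "g \<in> borel_measurable M"
    using g by (intro measurable_of_restrict_borel[OF sets] borel_measurable_continuous_onI)
  from g(2) obtain D where D: "\<And>x. norm (g x) \<le> D" by (auto simp: bounded_iff)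
  have gi: "integrable M g" using gm D by (intro integrable_const_bound[of _ D]) auto
  let ?h = "\<lambda>x. max (- C) (min C (g x))"
  have "(\<integral>x. \<bar>f x - ?h x\<bar> \<partial>M) \<le> (\<integral>x. \<bar>f x - g x\<bar> \<partial>M)"
  proof (rule integral_mono)
    have "integrable M ?h" using gm C by (intro integrable_const_bound[of _ C]) auto
    then show "integrable M (\<lambda>x. \<bar>f x - ?h x\<bar>)" using fi by auto
    show "\<bar>f x - ?h x\<bar> \<le> \<bar>f x - g x\<bar>" if "x \<in> space M" for x
      using f(2)[of x] that spM by auto
  qed (use fi gi in auto)
  with g(3) C show ?thesis
    by (intro exI[of _ ?h]) (auto intro!: continuous_intros g(1))
qed

section \<open>The modified scalar product\<close>

text \<open>For fixed position, \<open>f - \<Pi>f\<close> is a random variable in the velocity minus its mean, and its variance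
is at most its second moment.\<close>
lemma velocity_fluct_contraction:
  fixes \<nu> :: "'q measure" and \<rho> :: "'p measure"
  assumes pn: "prob_space \<nu>" and pr: "prob_space \<rho>" and f: "f \<in> L2 (\<nu> \<Otimes>\<^sub>M \<rho>)"
  shows "L2_norm (\<nu> \<Otimes>\<^sub>M \<rho>) (velocity_fluct \<rho> f) \<le> L2_norm (\<nu> \<Otimes>\<^sub>M \<rho>) f"
proof -
  interpret N: prob_space \<nu> by fact
  interpret R: prob_space \<rho> by fact
  interpret P: pair_prob_space \<nu> \<rho> ..
  have [measurable]: "f \<in> borel_measurable (\<nu> \<Otimes>\<^sub>M \<rho>)" using f by (rule L2_measurable)
  have sq: "integrable (\<nu> \<Otimes>\<^sub>M \<rho>) (\<lambda>x. (f x)\<^sup>2)" using f by (rule L2_square_integrable)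
  have [measurable]: "velocity_fluct \<rho> f \<in> borel_measurable (\<nu> \<Otimes>\<^sub>M \<rho>)"
    unfolding velocity_fluct_def[abs_def] velocity_avg_def by measurable
  have "AE q in \<nu>. integrable \<rho> (\<lambda>p. (f (q, p))\<^sup>2)"
    using P.AE_integrable_fst'[OF sq] .
  then have AE: "AE q in \<nu>. (\<integral>\<^sup>+p. ennreal ((velocity_fluct \<rho> f (q, p))\<^sup>2) \<partial>\<rho>) \<le> (\<integral>\<^sup>+p. ennreal ((f (q, p))\<^sup>2) \<partial>\<rho>)"
    using AE_space
  proof eventually_elim
    case (elim q)
    then have fm[measurable]: "(\<lambda>p. f (q, p)) \<in> borel_measurable \<rho>" by measurable
    let ?m = "\<integral>p. f (q, p) \<partial>\<rho>"
    have fi: "integrable \<rho> (\<lambda>p. f (q, p))"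
      by (rule R.square_integrable_imp_integrable[OF fm elim(1)])
    have eq: "velocity_fluct \<rho> f (q, p) = f (q, p) - ?m" for p
      by (simp add: velocity_fluct_def velocity_avg_def)
    have i: "integrable \<rho> (\<lambda>p. (f (q, p) - ?m)\<^sup>2)"
      using elim(1) fi by (simp add: power2_diff)
    have "(\<integral>p. (f (q, p) - ?m)\<^sup>2 \<partial>\<rho>) = (\<integral>p. (f (q, p))\<^sup>2 \<partial>\<rho>) - ?m\<^sup>2"
      by (rule R.variance_eq[OF fi elim(1)])
    then have "(\<integral>p. (f (q, p) - ?m)\<^sup>2 \<partial>\<rho>) \<le> (\<integral>p. (f (q, p))\<^sup>2 \<partial>\<rho>)" by simp
    then show ?case
      using nn_integral_eq_integral[OF i] nn_integral_eq_integral[OF elim(1)]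
      by (simp add: eq ennreal_leI)
  qed
  have "(\<integral>\<^sup>+x. ennreal ((velocity_fluct \<rho> f x)\<^sup>2) \<partial>(\<nu> \<Otimes>\<^sub>M \<rho>)) =
      (\<integral>\<^sup>+q. \<integral>\<^sup>+p. ennreal ((velocity_fluct \<rho> f (q, p))\<^sup>2) \<partial>\<rho> \<partial>\<nu>)"
    by (rule R.nn_integral_fst[symmetric]) measurable
  also have "\<dots> \<le> (\<integral>\<^sup>+q. \<integral>\<^sup>+p. ennreal ((f (q, p))\<^sup>2) \<partial>\<rho> \<partial>\<nu>)"
    by (rule nn_integral_mono_AE[OF AE])
  also have "\<dots> = (\<integral>\<^sup>+x. ennreal ((f x)\<^sup>2) \<partial>(\<nu> \<Otimes>\<^sub>M \<rho>))"
    by (rule R.nn_integral_fst) measurable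
  also have "\<dots> = ennreal (\<integral>x. (f x)\<^sup>2 \<partial>(\<nu> \<Otimes>\<^sub>M \<rho>))"
    by (rule nn_integral_eq_integral[OF sq]) auto
  finally have "(\<integral>x. (velocity_fluct \<rho> f x)\<^sup>2 \<partial>(\<nu> \<Otimes>\<^sub>M \<rho>)) \<le> (\<integral>x. (f x)\<^sup>2 \<partial>(\<nu> \<Otimes>\<^sub>M \<rho>))"
    by (subst integral_eq_nn_integral) (auto intro!: enn2real_leI)
  then show ?thesis
    unfolding L2_norm_def L2_inner_def by (intro real_sqrt_le_mono) (simp add: power2_eq_square)
qed

text \<open>The properties of the modified scalar product on which the analysis rests.  The last one says that
\<open>G1 = 0\<close>: pairing with the constant \<open>1\<close> is the same as in \<open>L\<^sup>2\<close>.\<close>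
locale coercive_L2_form = prob_space M for M :: "'a measure" +
  fixes E :: "('a \<Rightarrow> real) \<Rightarrow> ('a \<Rightarrow> real) \<Rightarrow> real" and \<epsilon> :: real
  assumes eps: "0 \<le> \<epsilon>" "\<epsilon> < 1"
    and form_lincomb: "f \<in> L2 M \<Longrightarrow> g \<in> L2 M \<Longrightarrow> h \<in> L2 M \<Longrightarrow>
      E (\<lambda>x. a * f x + b * g x) h = a * E f h + b * E g h"
    and form_commute: "f \<in> L2 M \<Longrightarrow> g \<in> L2 M \<Longrightarrow> E f g = E g f"
    and form_upper: "f \<in> L2 M \<Longrightarrow> g \<in> L2 M \<Longrightarrow> \<bar>E f g\<bar> \<le> (1 + \<epsilon>) * L2_norm M f * L2_norm M g"
    and form_lower: "f \<in> L2 M \<Longrightarrow> (1 - \<epsilon>) * (L2_norm M f)\<^sup>2 \<le> E f f"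
    and form_one: "f \<in> L2 M \<Longrightarrow> E f (\<lambda>_. 1) = (\<integral>x. f x \<partial>M)"
begin

lemma L2_const: "(\<lambda>_. c) \<in> L2 M"
  by (rule L2_bounded[where C="\<bar>c\<bar>"]) (auto intro: finite_measure_axioms)

lemma form_lincomb_right:
  assumes "f \<in> L2 M" "g \<in> L2 M" "h \<in> L2 M"
  shows "E h (\<lambda>x. a * f x + b * g x) = a * E h f + b * E h g"
  using form_commute[OF assms(3) L2_lincomb[OF assms(1,2), of a b]]
    form_commute[OF assms(3,1)] form_commute[OF assms(3,2)] form_lincomb[OF assms]
  by simp

text \<open>Write \<open>g = m + u\<close> with \<open>m\<close> the mean of \<open>g\<close>.  In \<open>E (v g) g\<close> the part quadratic in \<open>m\<close> is
\<open>m\<^sup>2 \<integral>v\<close>, the part quadratic in \<open>u\<close> is at most \<open>(1 + \<epsilon>) C \<parallel>u\<parallel>\<^sup>2\<close>, and the mixed part is at most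
\<open>(2 + \<epsilon>) \<parallel>v\<parallel> \<bar>m\<bar> \<parallel>u\<parallel>\<close>.  Since \<open>Var g = \<parallel>u\<parallel>\<^sup>2\<close> and \<open>m\<^sup>2 \<le> E g g\<close>, completing the square removes
\<open>u\<close>.\<close>
lemma perturbed_form_bound:
  assumes v: "v \<in> borel_measurable M" "\<And>x. x \<in> space M \<Longrightarrow> \<bar>v x\<bar> \<le> C" and C: "0 \<le> C"
    and gap: "(1 + \<epsilon>) * C < \<Lambda>" and g: "g \<in> L2 M"
  shows "- \<Lambda> * Var M g + E (\<lambda>x. v x * g x) g
    \<le> (\<bar>\<integral>x. v x \<partial>M\<bar> + (2 + \<epsilon>)\<^sup>2 * (\<integral>x. (v x)\<^sup>2 \<partial>M) / (4 * (\<Lambda> - (1 + \<epsilon>) * C))) * E g g"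
proof -
  define m where "m = (\<integral>x. g x \<partial>M)"
  define u where "u = (\<lambda>x. g x - m)"
  define a where "a = L2_norm M u"
  define D where "D = (2 + \<epsilon>) * L2_norm M v"
  define L where "L = \<Lambda> - (1 + \<epsilon>) * C"
  define v\<^sub>0 where "v\<^sub>0 = \<bar>\<integral>x. v x \<partial>M\<bar>"
  have L: "0 < L" using gap by (simp add: L_def)
  have one: "(\<lambda>_. 1) \<in> L2 M" by (rule L2_const)
  have u: "u \<in> L2 M" unfolding u_def by (rule L2_diff[OF g L2_const])
  have v2: "v \<in> L2 M" by (rule L2_bounded[OF finite_measure_axioms v])
  have vu: "(\<lambda>x. v x * u x) \<in> L2 M" by (rule L2_bounded_mult[OF v u])
  have gi: "integrable M g"
    using L2_mult_integrable[OF g one] by simp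
  have geq: "(\<lambda>x. m + u x) = g" by (simp add: u_def)
  have vgeq: "(\<lambda>x. m * v x + v x * u x) = (\<lambda>x. v x * g x)"
    by (rule ext) (simp add: u_def algebra_simps)
  have "(\<integral>x. u x \<partial>M) = 0" unfolding u_def using gi by (simp add: m_def prob_space)
  then have u1: "E u (\<lambda>_. 1) = 0" by (simp add: form_one[OF u])
  have Var: "Var M g = a\<^sup>2"
    unfolding a_def L2_norm_power2 by (simp add: Var_def L2_inner_def u_def m_def power2_eq_square)
  have "E g g = m * E g (\<lambda>_. 1) + E g u"
    using form_lincomb_right[OF one u g, of m 1] by (simp add: geq)
  also have "E g (\<lambda>_. 1) = m" by (simp add: form_one[OF g] m_def)
  also have "E g u = m * E (\<lambda>_. 1) u + E u u"
    using form_lincomb[OF one u u, of m 1] by (simp add: geq)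
  also have "E (\<lambda>_. 1) u = 0" using form_commute[OF one u] u1 by simp
  finally have Egg: "E g g = m\<^sup>2 + E u u" by (simp add: power2_eq_square)
  have "0 \<le> (1 - \<epsilon>) * a\<^sup>2" using eps by simp
  with form_lower[OF u] Egg have Egg_ge: "m\<^sup>2 \<le> E g g" by (simp add: a_def)
  have "E (\<lambda>x. v x * g x) g = m * E v g + E (\<lambda>x. v x * u x) g"
    using form_lincomb[OF v2 vu g, of m 1] by (simp add: vgeq)
  also have "E v g = m * E v (\<lambda>_. 1) + E v u"
    using form_lincomb_right[OF one u v2, of m 1] by (simp add: geq)
  also have "E (\<lambda>x. v x * u x) g = m * E (\<lambda>x. v x * u x) (\<lambda>_. 1) + E (\<lambda>x. v x * u x) u"
    using form_lincomb_right[OF one u vu, of m 1] by (simp add: geq)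
  also have "E v (\<lambda>_. 1) = (\<integral>x. v x \<partial>M)" by (rule form_one[OF v2])
  also have "E (\<lambda>x. v x * u x) (\<lambda>_. 1) = L2_inner M v u" by (simp add: form_one[OF vu] L2_inner_def)
  finally have expand: "E (\<lambda>x. v x * g x) g =
    m\<^sup>2 * (\<integral>x. v x \<partial>M) + m * (E v u + L2_inner M v u) + E (\<lambda>x. v x * u x) u"
    by (simp add: power2_eq_square algebra_simps)
  have t1: "m\<^sup>2 * (\<integral>x. v x \<partial>M) \<le> m\<^sup>2 * v\<^sub>0"
    by (intro mult_left_mono) (auto simp: v\<^sub>0_def)
  have "\<bar>E v u + L2_inner M v u\<bar> \<le> D * a"
    using form_upper[OF v2 u] L2_Cauchy_Schwarz[OF v2 u] by (simp add: D_def a_def algebra_simps)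
  then have "\<bar>m\<bar> * \<bar>E v u + L2_inner M v u\<bar> \<le> \<bar>m\<bar> * (D * a)"
    by (intro mult_left_mono) auto
  then have t2: "m * (E v u + L2_inner M v u) \<le> \<bar>m\<bar> * D * a"
    by (simp add: abs_mult[symmetric] abs_le_iff mult.assoc)
  have "L2_norm M (\<lambda>x. v x * u x) \<le> C * a"
  proof -
    have "L2_inner M (\<lambda>x. v x * u x) (\<lambda>x. v x * u x) \<le> (\<integral>x. C\<^sup>2 * (u x * u x) \<partial>M)"
      unfolding L2_inner_def
    proof (rule integral_mono)
      fix x assume "x \<in> space M"
      from power_mono[OF v(2)[OF this], of 2] have "(v x)\<^sup>2 \<le> C\<^sup>2" by simp
      from mult_right_mono[OF this, of "(u x)\<^sup>2"]
      show "v x * u x * (v x * u x) \<le> C\<^sup>2 * (u x * u x)" by (simp add: power2_eq_square mult_ac)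
    qed (use L2_mult_integrable[OF vu vu] L2_mult_integrable[OF u u] in auto)
    also have "\<dots> = (C * a)\<^sup>2" unfolding a_def power_mult_distrib L2_norm_power2
      by (simp add: L2_inner_def)
    finally have "L2_norm M (\<lambda>x. v x * u x) \<le> sqrt ((C * a)\<^sup>2)"
      unfolding L2_norm_def[of _ "\<lambda>x. v x * u x"] by (rule real_sqrt_le_mono)
    then show ?thesis using C by (simp add: a_def)
  qed
  then have "(1 + \<epsilon>) * L2_norm M (\<lambda>x. v x * u x) * L2_norm M u \<le> (1 + \<epsilon>) * (C * a) * a"
    using eps unfolding a_def by (intro mult_right_mono mult_left_mono) auto
  with form_upper[OF vu u] have t3: "E (\<lambda>x. v x * u x) u \<le> (1 + \<epsilon>) * C * a\<^sup>2"
    by (simp add: power2_eq_square mult.assoc)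
  have "0 \<le> (2 * L * a - \<bar>m\<bar> * D)\<^sup>2 / (4 * L)" using L by simp
  also have "\<dots> = L * a\<^sup>2 - \<bar>m\<bar> * D * a + m\<^sup>2 * (D\<^sup>2 / (4 * L))"
    using L by (simp add: field_simps power2_eq_square)
  finally have Young: "\<bar>m\<bar> * D * a - L * a\<^sup>2 \<le> m\<^sup>2 * (D\<^sup>2 / (4 * L))" by simp
  have "- \<Lambda> * Var M g + E (\<lambda>x. v x * g x) g \<le> m\<^sup>2 * v\<^sub>0 + (\<bar>m\<bar> * D * a - L * a\<^sup>2)"
    using t1 t2 t3 unfolding Var expand L_def by (simp add: algebra_simps)
  also have "\<dots> \<le> (v\<^sub>0 + D\<^sup>2 / (4 * L)) * m\<^sup>2" using Young by (simp add: algebra_simps)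
  also have "\<dots> \<le> (v\<^sub>0 + D\<^sup>2 / (4 * L)) * E g g"
    using L by (intro mult_left_mono Egg_ge) (auto simp: v\<^sub>0_def)
  also have "D\<^sup>2 = (2 + \<epsilon>)\<^sup>2 * (\<integral>x. (v x)\<^sup>2 \<partial>M)"
    unfolding D_def power_mult_distrib L2_norm_power2 by (simp add: L2_inner_def power2_eq_square)
  finally show ?thesis by (simp add: v\<^sub>0_def L_def)
qed

text \<open>The energy \<open>E (u t) (u t)\<close> has right derivative \<open>2 * E (w t) (u t)\<close>, because \<open>E\<close> is continuous
in norm, and is continuous in \<open>t\<close> because \<open>u\<close> is Lipschitz; Gronwall's inequality applies.\<close>
lemma form_growth:
  assumes T: "0 \<le> T"
    and u: "\<And>t. u t \<in> L2 M" and w: "\<And>t. w t \<in> L2 M"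
    and lip: "\<And>s t. 0 \<le> s \<Longrightarrow> s \<le> t \<Longrightarrow> t \<le> T + 1 \<Longrightarrow> L2_norm M (\<lambda>x. u t x - u s x) \<le> K * (t - s)"
    and bnd: "\<And>t. 0 \<le> t \<Longrightarrow> t \<le> T \<Longrightarrow> L2_norm M (u t) \<le> K'"
    and der: "\<And>t. 0 \<le> t \<Longrightarrow> t < T \<Longrightarrow>
      ((\<lambda>h. L2_norm M (\<lambda>x. (u (t + h) x - u t x) / h - w t x)) \<longlongrightarrow> 0) (at_right 0)"
    and dissip: "\<And>t. 0 \<le> t \<Longrightarrow> t < T \<Longrightarrow> E (w t) (u t) \<le> k * E (u t) (u t)"
  shows "E (u T) (u T) \<le> E (u 0) (u 0) * exp (2 * k * T)"
proof -
  have K': "0 \<le> K'" using bnd[of 0] T L2_norm_nonneg[of M "u 0"] by linarith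
  have K: "0 \<le> K" using lip[of 0 "T + 1"] T
      order_trans[OF L2_norm_nonneg lip[of 0 "T + 1"]] by (simp add: zero_le_mult_iff)
  have increment: "E (u t) (u t) - E (u s) (u s) = E (\<lambda>x. u t x - u s x) (u t) + E (\<lambda>x. u t x - u s x) (u s)" for s t
    using form_lincomb[OF u[of t] u[of s] u[of t], of 1 "-1"]
      form_lincomb[OF u[of t] u[of s] u[of s], of 1 "-1"] form_commute[OF u u, of t s] by simp
  have "\<bar>E (u t) (u t) - E (u s) (u s)\<bar> \<le> 2 * (1 + \<epsilon>) * K * K' * \<bar>t - s\<bar>"
    if "0 \<le> s" "s \<le> t" "t \<le> T" for s t
  proof -
    have "\<bar>E (\<lambda>x. u t x - u s x) (u r)\<bar> \<le> (1 + \<epsilon>) * (K * (t - s)) * K'" if r: "r = s \<or> r = t" for r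
    proof -
      have "\<bar>E (\<lambda>x. u t x - u s x) (u r)\<bar> \<le> (1 + \<epsilon>) * L2_norm M (\<lambda>x. u t x - u s x) * L2_norm M (u r)"
        by (rule form_upper[OF L2_diff[OF u u] u])
      also have "\<dots> \<le> (1 + \<epsilon>) * (K * (t - s)) * K'"
        using that \<open>0 \<le> s\<close> \<open>s \<le> t\<close> \<open>t \<le> T\<close> eps K by (intro mult_mono lip bnd mult_nonneg_nonneg) auto
      finally show ?thesis .
    qed
    from this[of s] this[of t] show ?thesis using that unfolding increment
      by (simp add: algebra_simps)
  qed
  note lipN = this
  have "continuous_on {0..T} (\<lambda>t. E (u t) (u t))"
  proof (rule lipschitz_on_continuous_on[OF lipschitz_onI])
    show "0 \<le> 2 * (1 + \<epsilon>) * K * K'" using K K' eps by simp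
    show "dist (E (u s) (u s)) (E (u t) (u t)) \<le> 2 * (1 + \<epsilon>) * K * K' * dist s t"
      if "s \<in> {0..T}" "t \<in> {0..T}" for s t
      using that lipN[of s t] lipN[of t s] by (cases "s \<le> t") (auto simp: dist_real_def abs_minus_commute)
  qed
  then show ?thesis
  proof (rule Gronwall_right_derivative[OF T])
    fix t assume t: "0 \<le> t" "t < T"
    define q where "q h = (\<lambda>x. (u (t + h) x - u t x) / h)" for h
    have q: "q h \<in> L2 M" for h
      using L2_cmult[OF L2_diff[OF u u], of "1 / h"] by (simp add: q_def)
    have "((\<lambda>h. E (q h) (u t) - E (w t) (u t)) \<longlongrightarrow> 0) (at_right 0)"
    proof (rule Lim_null_comparison)
      show "\<forall>\<^sub>F h in at_right 0. norm (E (q h) (u t) - E (w t) (u t))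
          \<le> (1 + \<epsilon>) * L2_norm M (\<lambda>x. q h x - w t x) * L2_norm M (u t)"
      proof (rule always_eventually, rule allI)
        fix h
        have "E (q h) (u t) - E (w t) (u t) = E (\<lambda>x. q h x - w t x) (u t)"
          using form_lincomb[OF q[of h] w[of t] u[of t], of 1 "-1"] by simp
        then show "norm (E (q h) (u t) - E (w t) (u t))
            \<le> (1 + \<epsilon>) * L2_norm M (\<lambda>x. q h x - w t x) * L2_norm M (u t)"
          using form_upper[OF L2_diff[OF q[of h] w[of t]] u[of t]] by simp
      qed
      have "((\<lambda>h. (1 + \<epsilon>) * L2_norm M (\<lambda>x. q h x - w t x) * L2_norm M (u t))
          \<longlongrightarrow> (1 + \<epsilon>) * 0 * L2_norm M (u t)) (at_right 0)"
        using der[OF t] unfolding q_def by (intro tendsto_intros)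
      then show "((\<lambda>h. (1 + \<epsilon>) * L2_norm M (\<lambda>x. q h x - w t x) * L2_norm M (u t)) \<longlongrightarrow> 0) (at_right 0)"
        by simp
    qed
    then have lim1: "((\<lambda>h. E (q h) (u t)) \<longlongrightarrow> E (w t) (u t)) (at_right 0)"
      by (rule LIM_zero_cancel)
    have qb: "L2_norm M (q h) \<le> K" if "0 < h" "h < 1" for h
    proof -
      have "L2_norm M (q h) = 1 / h * L2_norm M (\<lambda>x. u (t + h) x - u t x)"
        using L2_norm_cmult[of M "1 / h" "\<lambda>x. u (t + h) x - u t x"] that by (simp add: q_def)
      also have "\<dots> \<le> 1 / h * (K * h)" using lip[of t "t + h"] t that by (intro mult_left_mono) auto
      finally show ?thesis using that by simp
    qed
    have lim2: "((\<lambda>h. h * E (q h) (q h)) \<longlongrightarrow> 0) (at_right 0)"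
    proof (rule Lim_null_comparison)
      show "\<forall>\<^sub>F h in at_right 0. norm (h * E (q h) (q h)) \<le> h * ((1 + \<epsilon>) * K * K)"
      proof (rule eventually_at_rightI[of 0 1])
        fix h :: real assume h: "h \<in> {0<..<1}"
        have "\<bar>E (q h) (q h)\<bar> \<le> (1 + \<epsilon>) * L2_norm M (q h) * L2_norm M (q h)" by (rule form_upper[OF q q])
        also have "\<dots> \<le> (1 + \<epsilon>) * K * K" using qb[of h] h eps K by (intro mult_mono) auto
        finally show "norm (h * E (q h) (q h)) \<le> h * ((1 + \<epsilon>) * K * K)"
          using h by (simp add: abs_mult mult_left_mono)
      qed simp
      have "((\<lambda>h. h * ((1 + \<epsilon>) * K * K)) \<longlongrightarrow> 0 * ((1 + \<epsilon>) * K * K)) (at_right 0)"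
        by (intro tendsto_intros)
      then show "((\<lambda>h. h * ((1 + \<epsilon>) * K * K)) \<longlongrightarrow> 0) (at_right 0)" by simp
    qed
    have lim: "((\<lambda>h. 2 * E (q h) (u t) + h * E (q h) (q h)) \<longlongrightarrow> 2 * E (w t) (u t) + 0) (at_right 0)"
      by (intro tendsto_add tendsto_mult tendsto_const lim1 lim2)
    have eq: "2 * E (q h) (u t) + h * E (q h) (q h) = (E (u (t + h)) (u (t + h)) - E (u t) (u t)) / h"
      if "0 < h" for h
    proof -
      have uh: "(\<lambda>x. u t x + h * q h x) = u (t + h)" using that by (simp add: q_def)
      have "E (u (t + h)) (u (t + h)) = E (u t) (u (t + h)) + h * E (q h) (u (t + h))"
        using form_lincomb[OF u[of t] q[of h] u[of "t + h"], of 1 h] by (simp add: uh)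
      also have "E (u t) (u (t + h)) = E (u t) (u t) + h * E (u t) (q h)"
        using form_lincomb_right[OF u[of t] q[of h] u[of t], of 1 h] by (simp add: uh)
      also have "E (q h) (u (t + h)) = E (q h) (u t) + h * E (q h) (q h)"
        using form_lincomb_right[OF u[of t] q[of h] q[of h], of 1 h] by (simp add: uh)
      also have "E (u t) (q h) = E (q h) (u t)" by (rule form_commute[OF u q])
      finally show ?thesis using that by (simp add: field_simps)
    qed
    have "((\<lambda>h. (E (u (t + h)) (u (t + h)) - E (u t) (u t)) / h) \<longlongrightarrow> 2 * E (w t) (u t)) (at_right 0)"
      using lim eq by (intro Lim_transform_eventually[OF lim[unfolded add_0_right]] eventually_at_rightI[of 0 1]) auto
    moreover have "2 * E (w t) (u t) \<le> 2 * k * E (u t) (u t)" using dissip[OF t] by simp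
    ultimately show "\<exists>d\<le>2 * k * E (u t) (u t).
        ((\<lambda>h. (E (u (t + h)) (u (t + h)) - E (u t) (u t)) / h) \<longlongrightarrow> d) (at_right 0)" by blast
  qed
qed

end

text \<open>Since \<open>\<parallel>B\<parallel> \<le> 1/2\<close>, the perturbation \<open>\<langle>f, Gg\<rangle> = \<langle>f, Bg\<rangle> + \<langle>Bf, g\<rangle>\<close> is at most \<open>\<parallel>f\<parallel> \<parallel>g\<parallel>\<close>; written in
this way it is visibly symmetric.\<close>
lemma modified_inner_coercive_form:
  fixes \<nu> :: "'q measure" and \<rho> :: "'p measure"
  assumes pn: "prob_space \<nu>" and pr: "prob_space \<rho>" and eps: "0 \<le> \<epsilon>" "\<epsilon> < 1"
    and B: "hypocoercive_B (\<nu> \<Otimes>\<^sub>M \<rho>) \<rho> A B B'"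
  shows "coercive_L2_form (\<nu> \<Otimes>\<^sub>M \<rho>) (modified_inner (\<nu> \<Otimes>\<^sub>M \<rho>) B B' \<epsilon>) \<epsilon>"
proof -
  define \<mu> where "\<mu> = \<nu> \<Otimes>\<^sub>M \<rho>"
  interpret prob_space \<mu> unfolding \<mu>_def by (rule prob_space_pair[OF pn pr])
  have opB: "L2_bounded_operator \<mu> B" and opB': "L2_bounded_operator \<mu> B'"
    and adj: "L2_graph \<mu> B' = L2_adjoint \<mu> (L2_graph \<mu> B)"
    and half: "\<And>f. f \<in> L2 \<mu> \<Longrightarrow> L2_norm \<mu> (B f) \<le> 1/2 * L2_norm \<mu> (velocity_fluct \<rho> f)"
    and B1: "AE x in \<mu>. B (\<lambda>_. 1) x = 0" and B'1: "AE x in \<mu>. B' (\<lambda>_. 1) x = 0"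
    using B[folded \<mu>_def] by (auto simp: hypocoercive_B_def)
  have BL: "B f \<in> L2 \<mu>" and B'L: "B' f \<in> L2 \<mu>" if "f \<in> L2 \<mu>" for f
    using opB opB' that by (auto simp: L2_bounded_operator_def)
  have Blin: "AE x in \<mu>. B (\<lambda>y. a * f y + b * g y) x = a * B f x + b * B g x"
    if "f \<in> L2 \<mu>" "g \<in> L2 \<mu>" for f g a b
    using opB that by (auto simp: L2_bounded_operator_def)
  have adjoint: "L2_inner \<mu> f (B' g) = L2_inner \<mu> (B f) g" if "f \<in> L2 \<mu>" "g \<in> L2 \<mu>" for f g
  proof -
    have "(g, B' g) \<in> L2_adjoint \<mu> (L2_graph \<mu> B)"
      unfolding adj[symmetric] using that B'L by (simp add: L2_graph_def)
    moreover have "(f, B f) \<in> L2_graph \<mu> B" using that BL by (simp add: L2_graph_def)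
    ultimately show ?thesis by (auto simp: L2_adjoint_def)
  qed
  have form: "modified_inner \<mu> B B' \<epsilon> f g = L2_inner \<mu> f g + \<epsilon> * (L2_inner \<mu> f (B g) + L2_inner \<mu> (B f) g)"
    if fg: "f \<in> L2 \<mu>" "g \<in> L2 \<mu>" for f g
  proof -
    have "modified_inner \<mu> B B' \<epsilon> f g = (\<integral>x. f x * g x + \<epsilon> * (f x * B g x + f x * B' g x) \<partial>\<mu>)"
      by (simp add: modified_inner_def L2_inner_def algebra_simps)
    also have "\<dots> = L2_inner \<mu> f g + \<epsilon> * (L2_inner \<mu> f (B g) + L2_inner \<mu> f (B' g))"
      using L2_mult_integrable[OF fg] L2_mult_integrable[OF fg(1) BL[OF fg(2)]]
        L2_mult_integrable[OF fg(1) B'L[OF fg(2)]]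
      by (simp add: L2_inner_def)
    finally show ?thesis by (simp add: adjoint[OF fg])
  qed
  have Bn: "L2_norm \<mu> (B f) \<le> 1/2 * L2_norm \<mu> f" if "f \<in> L2 \<mu>" for f
    using half[OF that] velocity_fluct_contraction[OF pn pr, of f] that by (simp add: \<mu>_def)
  have cross: "\<bar>L2_inner \<mu> f (B g)\<bar> \<le> 1/2 * (L2_norm \<mu> f * L2_norm \<mu> g)" if "f \<in> L2 \<mu>" "g \<in> L2 \<mu>" for f g
  proof -
    have "\<bar>L2_inner \<mu> f (B g)\<bar> \<le> L2_norm \<mu> f * L2_norm \<mu> (B g)"
      by (rule L2_Cauchy_Schwarz[OF that(1) BL[OF that(2)]])
    also have "\<dots> \<le> L2_norm \<mu> f * (1/2 * L2_norm \<mu> g)" by (intro mult_left_mono Bn that) auto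
    finally show ?thesis by simp
  qed
  have G: "\<bar>\<epsilon> * (L2_inner \<mu> f (B g) + L2_inner \<mu> (B f) g)\<bar> \<le> \<epsilon> * (L2_norm \<mu> f * L2_norm \<mu> g)"
    if "f \<in> L2 \<mu>" "g \<in> L2 \<mu>" for f g
    unfolding abs_mult using cross[OF that] cross[OF that(2,1)] eps
    by (intro mult_mono) (auto simp: L2_inner_commute[of \<mu> "B f" g] mult.commute[of "L2_norm \<mu> g"])
  have "coercive_L2_form \<mu> (modified_inner \<mu> B B' \<epsilon>) \<epsilon>"
  proof unfold_locales
    fix f g h :: "'q \<times> 'p \<Rightarrow> real" and a b :: real
    assume L: "f \<in> L2 \<mu>" "g \<in> L2 \<mu>"
    show "modified_inner \<mu> B B' \<epsilon> f g = modified_inner \<mu> B B' \<epsilon> g f"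
      using L by (simp add: form L2_inner_commute[of \<mu> f g] L2_inner_commute[of \<mu> f "B g"]
          L2_inner_commute[of \<mu> "B f" g] algebra_simps)
    show "\<bar>modified_inner \<mu> B B' \<epsilon> f g\<bar> \<le> (1 + \<epsilon>) * L2_norm \<mu> f * L2_norm \<mu> g"
      using L2_Cauchy_Schwarz[OF L] G[OF L] by (simp add: form L algebra_simps abs_le_iff)
    assume h: "h \<in> L2 \<mu>"
    have "L2_inner \<mu> (B (\<lambda>x. a * f x + b * g x)) h = L2_inner \<mu> (\<lambda>x. a * B f x + b * B g x) h"
      using L h by (intro L2_inner_cong_AE Blin L2_measurable BL L2_lincomb)
    then show "modified_inner \<mu> B B' \<epsilon> (\<lambda>x. a * f x + b * g x) h =
        a * modified_inner \<mu> B B' \<epsilon> f h + b * modified_inner \<mu> B B' \<epsilon> g h"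
      using L h by (simp add: form L2_lincomb L2_inner_lincomb_left BL algebra_simps)
  next
    fix f :: "'q \<times> 'p \<Rightarrow> real" assume f: "f \<in> L2 \<mu>"
    show "(1 - \<epsilon>) * (L2_norm \<mu> f)\<^sup>2 \<le> modified_inner \<mu> B B' \<epsilon> f f"
      using G[OF f f] L2_norm_power2[of \<mu> f] by (simp add: form f power2_eq_square algebra_simps abs_le_iff)
    have one: "(\<lambda>_. 1) \<in> L2 \<mu>" by (rule L2_bounded[where C=1]) (auto intro: finite_measure_axioms)
    have "L2_inner \<mu> (B (\<lambda>_. 1)) f = L2_inner \<mu> (\<lambda>_. 0) f"
      by (rule L2_inner_cong_AE[OF B1 L2_measurable[OF BL[OF one]] _ L2_measurable[OF f]]) simp
    moreover have "L2_inner \<mu> (B' (\<lambda>_. 1)) f = L2_inner \<mu> (\<lambda>_. 0) f"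
      by (rule L2_inner_cong_AE[OF B'1 L2_measurable[OF B'L[OF one]] _ L2_measurable[OF f]]) simp
    moreover have "L2_inner \<mu> (B f) (\<lambda>_. 1) = L2_inner \<mu> (B' (\<lambda>_. 1)) f"
      using adjoint[OF f one] by (simp add: L2_inner_commute[of \<mu> f])
    ultimately show "modified_inner \<mu> B B' \<epsilon> f (\<lambda>_. 1) = (\<integral>x. f x \<partial>\<mu>)"
      using f one by (simp add: form L2_inner_commute[of \<mu> f "B (\<lambda>_. 1)"]) (simp add: L2_inner_def)
  qed (use eps in auto)
  then show ?thesis by (simp add: \<mu>_def)
qed

section \<open>The Markov property\<close>

locale stationary_markov = prob_space \<mu>
  for \<Omega> :: "'w measure" and X :: "'x::metric_space set" and \<xi> :: "real \<Rightarrow> 'w \<Rightarrow> 'x"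
    and Pr :: "'x \<Rightarrow> 'w measure" and \<mu> :: "'x measure" +
  assumes markov: "cadlag_markov_process \<Omega> X \<xi> Pr"
    and sets_mu: "sets \<mu> = sets (restrict_space borel X)"
    and invariant: "invariant_measure \<xi> Pr \<mu>"
begin

abbreviation "BX \<equiv> restrict_space borel X"

abbreviation "P\<mu> \<equiv> \<mu> \<bind> Pr"

lemma space_mu: "space \<mu> = X"
  using sets_eq_imp_space_eq[OF sets_mu] by (simp add: space_restrict_space)

lemma measurable_mu: "h \<in> BX \<rightarrow>\<^sub>M N \<longleftrightarrow> h \<in> \<mu> \<rightarrow>\<^sub>M N"
  using measurable_cong_sets[OF sets_mu refl] by blast

lemma xi_measurable: "0 \<le> t \<Longrightarrow> \<xi> t \<in> \<Omega> \<rightarrow>\<^sub>M BX"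
  and xi_cadlag: "\<omega> \<in> space \<Omega> \<Longrightarrow> cadlag_on {0..} X (\<lambda>t. \<xi> t \<omega>)"
  and kernel: "Pr \<in> BX \<rightarrow>\<^sub>M prob_algebra \<Omega>"
  and start: "x \<in> X \<Longrightarrow> AE \<omega> in Pr x. \<xi> 0 \<omega> = x"
  using markov by (auto simp: cadlag_markov_process_def cadlag_process_def)

lemma xi_in_X: "0 \<le> t \<Longrightarrow> \<omega> \<in> space \<Omega> \<Longrightarrow> \<xi> t \<omega> \<in> X"
  using cadlag_right_limit(2)[OF xi_cadlag] by auto

lemma prob_Pr: "x \<in> X \<Longrightarrow> prob_space (Pr x)"
  and sets_Pr: "x \<in> X \<Longrightarrow> sets (Pr x) = sets \<Omega>"
  using measurable_space[OF kernel, of x] by (auto simp: space_prob_algebra space_restrict_space)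

lemma space_Pr: "x \<in> X \<Longrightarrow> space (Pr x) = space \<Omega>"
  using sets_eq_imp_space_eq[OF sets_Pr] .

lemma measurable_Pr: "x \<in> X \<Longrightarrow> h \<in> \<Omega> \<rightarrow>\<^sub>M N \<Longrightarrow> h \<in> Pr x \<rightarrow>\<^sub>M N"
  using measurable_cong_sets[OF sets_Pr refl] by blast

lemma kernel_subprob: "Pr \<in> \<mu> \<rightarrow>\<^sub>M subprob_algebra \<Omega>"
  using kernel measurable_prob_algebraD by (auto simp: measurable_mu)

lemma expectation_measurable:
  fixes h :: "'w \<Rightarrow> real"
  assumes "h \<in> borel_measurable \<Omega>"
  shows "(\<lambda>x. \<integral>\<omega>. h \<omega> \<partial>Pr x) \<in> borel_measurable \<mu>"
  using measurable_compose[OF kernel_subprob integral_measurable_subprob_algebra[OF assms]] .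

lemma Pr_integrable:
  fixes h :: "'w \<Rightarrow> real"
  assumes "x \<in> X" "h \<in> borel_measurable \<Omega>" "\<And>\<omega>. \<omega> \<in> space \<Omega> \<Longrightarrow> \<bar>h \<omega>\<bar> \<le> C"
  shows "integrable (Pr x) h"
proof -
  interpret P: prob_space "Pr x" by (rule prob_Pr[OF assms(1)])
  show ?thesis
    using assms by (intro P.integrable_const_bound[of _ C] measurable_Pr AE_I2) (auto simp: space_Pr)
qed

lemma Pr_expectation_bound:
  fixes h :: "'w \<Rightarrow> real"
  assumes "x \<in> X" "h \<in> borel_measurable \<Omega>" "\<And>\<omega>. \<omega> \<in> space \<Omega> \<Longrightarrow> \<bar>h \<omega>\<bar> \<le> C"
  shows "\<bar>\<integral>\<omega>. h \<omega> \<partial>Pr x\<bar> \<le> C"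
proof -
  interpret P: prob_space "Pr x" by (rule prob_Pr[OF assms(1)])
  have "\<bar>\<integral>\<omega>. h \<omega> \<partial>Pr x\<bar> \<le> (\<integral>\<omega>. \<bar>h \<omega>\<bar> \<partial>Pr x)" by (rule integral_abs_bound)
  also have "\<dots> \<le> (\<integral>\<omega>. C \<partial>Pr x)"
    using Pr_integrable[OF assms] assms by (intro integral_mono) (auto simp: space_Pr)
  finally show ?thesis by (simp add: P.prob_space)
qed

definition bounded_observable :: "('x \<Rightarrow> real) \<Rightarrow> bool" where
  "bounded_observable g \<longleftrightarrow> g \<in> borel_measurable BX \<and> bounded (g ` X)"

lemma bounded_observable_bound:
  assumes "bounded_observable g" obtains C where "\<And>x. x \<in> X \<Longrightarrow> \<bar>g x\<bar> \<le> C"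
  using assms by (auto simp: bounded_observable_def bounded_iff)

lemma bounded_observable_xi:
  assumes "bounded_observable g" "0 \<le> t" shows "(\<lambda>\<omega>. g (\<xi> t \<omega>)) \<in> borel_measurable \<Omega>"
  using measurable_compose[OF xi_measurable[OF assms(2)]] assms(1) by (auto simp: bounded_observable_def)

lemma bounded_observable_mult:
  assumes "bounded_observable g" "bounded_observable h"
  shows "bounded_observable (\<lambda>x. g x * h x)"
proof -
  obtain C D where "\<And>x. x \<in> X \<Longrightarrow> \<bar>g x\<bar> \<le> C" "\<And>x. x \<in> X \<Longrightarrow> \<bar>h x\<bar> \<le> D"
    using bounded_observable_bound[OF assms(1)] bounded_observable_bound[OF assms(2)] by metis
  then have "\<bar>g x * h x\<bar> \<le> \<bar>C\<bar> * \<bar>D\<bar>" if "x \<in> X" for x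
    unfolding abs_mult using that by (intro mult_mono) force+
  then show ?thesis using assms by (auto simp: bounded_observable_def bounded_iff)
qed

lemma bounded_observable_transition:
  assumes "bounded_observable g" "0 \<le> t"
  shows "bounded_observable (transition \<xi> Pr t g)"
proof -
  obtain C where C: "\<And>x. x \<in> X \<Longrightarrow> \<bar>g x\<bar> \<le> C" using bounded_observable_bound[OF assms(1)] by blast
  note m = bounded_observable_xi[OF assms]
  have "transition \<xi> Pr t g \<in> borel_measurable BX"
    unfolding measurable_mu using expectation_measurable[OF m] by (simp add: transition_def[abs_def])
  moreover have "\<bar>transition \<xi> Pr t g x\<bar> \<le> C" if "x \<in> X" for x
    unfolding transition_def by (rule Pr_expectation_bound[OF that m]) (use C xi_in_X assms(2) in auto)
  ultimately show ?thesis by (auto simp: bounded_observable_def bounded_iff)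
qed

abbreviation "\<F> \<equiv> natural_filtration \<Omega> X \<xi>"

lemma xi_filtration_measurable:
  assumes "0 \<le> r" "r \<le> s" shows "\<xi> r \<in> \<F> s \<rightarrow>\<^sub>M BX"
proof (rule measurableI)
  let ?G = "\<Union>u\<in>{0..s}. {\<xi> u -` B \<inter> space \<Omega> |B. B \<in> sets BX}"
  have G: "?G \<subseteq> Pow (space \<Omega>)" by auto
  show "\<xi> r \<omega> \<in> space BX" if "\<omega> \<in> space (\<F> s)" for \<omega>
    using that xi_in_X[OF assms(1)] G by (auto simp: natural_filtration_def space_restrict_space space_measure_of)
  show "\<xi> r -` A \<inter> space (\<F> s) \<in> sets (\<F> s)"
    if "A \<in> sets BX" for A
    using that assms G unfolding natural_filtration_def
    by (auto simp: space_measure_of sets_measure_of intro!: sigma_sets.Basic bexI[of _ r] exI[of _ A])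
qed

lemma filtration_subalgebra:
  assumes "x \<in> X" shows "subalgebra (Pr x) (\<F> s)"
proof -
  let ?G = "\<Union>u\<in>{0..s}. {\<xi> u -` B \<inter> space \<Omega> |B. B \<in> sets BX}"
  have G: "?G \<subseteq> Pow (space \<Omega>)" by auto
  have "?G \<subseteq> sets \<Omega>" using measurable_sets[OF xi_measurable] by auto
  then have "sigma_sets (space \<Omega>) ?G \<subseteq> sets \<Omega>" by (rule sets.sigma_sets_subset)
  then show ?thesis using assms G
    by (simp add: subalgebra_def natural_filtration_def space_measure_of sets_measure_of space_Pr sets_Pr)
qed

lemma filtration_mono:
  assumes "s \<le> t" "h \<in> borel_measurable (\<F> s)"
  shows "h \<in> borel_measurable (\<F> t)"
proof (rule measurable_mono[THEN subsetD, OF order_refl refl _ _ assms(2)])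
  let ?G = "\<lambda>s. \<Union>u\<in>{0..s}. {\<xi> u -` B \<inter> space \<Omega> |B. B \<in> sets BX}"
  have G: "?G s \<subseteq> Pow (space \<Omega>)" for s by auto
  show "space (\<F> s) = space (\<F> t)"
    by (simp add: natural_filtration_def space_measure_of G)
  have "?G s \<subseteq> ?G t" using assms(1) by fastforce
  then show "sets (\<F> s) \<subseteq> sets (\<F> t)"
    unfolding natural_filtration_def sets_measure_of[OF G] by (rule sigma_sets_mono')
qed

text \<open>The Markov property is given through conditional expectations of a function of one later state;
here it is tested against bounded functions of the past.\<close>
lemma markov_step:
  assumes x: "x \<in> X" and st: "0 \<le> s" "0 \<le> t" and g: "bounded_observable g"
    and Z: "Z \<in> borel_measurable (\<F> s)" "\<And>\<omega>. \<omega> \<in> space \<Omega> \<Longrightarrow> \<bar>Z \<omega>\<bar> \<le> C"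
  shows "(\<integral>\<omega>. Z \<omega> * g (\<xi> (s + t) \<omega>) \<partial>Pr x) = (\<integral>\<omega>. Z \<omega> * transition \<xi> Pr t g (\<xi> s \<omega>) \<partial>Pr x)"
proof -
  interpret P: prob_space "Pr x" by (rule prob_Pr[OF x])
  interpret finite_measure_subalgebra "Pr x" "\<F> s"
    by unfold_locales (rule filtration_subalgebra[OF x])
  obtain D where D: "\<And>x. x \<in> X \<Longrightarrow> \<bar>g x\<bar> \<le> D" using bounded_observable_bound[OF g] by blast
  have Zm: "Z \<in> borel_measurable (Pr x)"
    using measurable_from_subalg[OF filtration_subalgebra[OF x] Z(1)] .
  have gm: "(\<lambda>\<omega>. g (\<xi> (s + t) \<omega>)) \<in> borel_measurable (Pr x)"
    using st by (intro measurable_Pr[OF x] bounded_observable_xi[OF g]) auto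
  have tm: "(\<lambda>\<omega>. transition \<xi> Pr t g (\<xi> s \<omega>)) \<in> borel_measurable (Pr x)"
    using st by (intro measurable_Pr[OF x] bounded_observable_xi[OF bounded_observable_transition[OF g]]) auto
  have "\<bar>Z \<omega> * g (\<xi> (s + t) \<omega>)\<bar> \<le> \<bar>C\<bar> * \<bar>D\<bar>" if "\<omega> \<in> space (Pr x)" for \<omega>
    unfolding abs_mult using Z(2)[of \<omega>] D[OF xi_in_X, of "s + t" \<omega>] that st
    by (intro mult_mono) (auto simp: space_Pr[OF x])
  then have "integrable (Pr x) (\<lambda>\<omega>. Z \<omega> * g (\<xi> (s + t) \<omega>))"
    using Zm gm by (intro P.integrable_const_bound[of _ "\<bar>C\<bar> * \<bar>D\<bar>"]) auto
  from real_cond_exp_intg(2)[OF this Z(1) gm]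
  have "(\<integral>\<omega>. Z \<omega> * g (\<xi> (s + t) \<omega>) \<partial>Pr x) = (\<integral>\<omega>. Z \<omega> * real_cond_exp (Pr x) (\<F> s)
      (\<lambda>\<omega>'. g (\<xi> (s + t) \<omega>')) \<omega> \<partial>Pr x)" by simp
  also have "\<dots> = (\<integral>\<omega>. Z \<omega> * transition \<xi> Pr t g (\<xi> s \<omega>) \<partial>Pr x)"
  proof (rule integral_cong_AE)
    have "AE \<omega> in Pr x. real_cond_exp (Pr x) (\<F> s) (\<lambda>\<omega>'. g (\<xi> (s + t) \<omega>')) \<omega>
             = transition \<xi> Pr t g (\<xi> s \<omega>)"
      using markov x st g unfolding cadlag_markov_process_def bounded_observable_def by blast
    then show "AE \<omega> in Pr x. Z \<omega> * real_cond_exp (Pr x) (\<F> s) (\<lambda>\<omega>'. g (\<xi> (s + t) \<omega>')) \<omega>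
             = Z \<omega> * transition \<xi> Pr t g (\<xi> s \<omega>)"
      by eventually_elim simp
  qed (use Zm tm in auto)
  finally show ?thesis .
qed

text \<open>The expectation, from a given starting point, of the product of the values of \<open>g\<close> at the first
\<open>n\<close> points of the grid with mesh \<open>\<delta>\<close>.\<close>
primrec grid_expectation :: "real \<Rightarrow> ('x \<Rightarrow> real) \<Rightarrow> nat \<Rightarrow> 'x \<Rightarrow> real" where
  "grid_expectation \<delta> g 0 = (\<lambda>_. 1)"
| "grid_expectation \<delta> g (Suc n) = transition \<xi> Pr \<delta> (\<lambda>y. g y * grid_expectation \<delta> g n y)"

lemma bounded_observable_grid_expectation:
  assumes "bounded_observable g" "0 \<le> \<delta>" shows "bounded_observable (grid_expectation \<delta> g n)"
proof (induction n)
  case 0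
  show ?case by (auto simp: bounded_observable_def bounded_iff)
qed (use assms in \<open>auto intro: bounded_observable_transition bounded_observable_mult\<close>)

text \<open>The factor at the first grid point is moved into the function \<open>Z\<close> of the past, the induction
hypothesis is applied from that point on, and the Markov property moves the result back.\<close>
lemma markov_grid:
  assumes x: "x \<in> X" and g: "bounded_observable g" and \<delta>: "0 \<le> \<delta>"
  shows "0 \<le> s \<Longrightarrow> Z \<in> borel_measurable (\<F> s) \<Longrightarrow>
      (\<And>\<omega>. \<omega> \<in> space \<Omega> \<Longrightarrow> \<bar>Z \<omega>\<bar> \<le> C) \<Longrightarrow>
    (\<integral>\<omega>. Z \<omega> * (\<Prod>k<n. g (\<xi> (s + \<delta> * (real k + 1)) \<omega>)) \<partial>Pr x)
      = (\<integral>\<omega>. Z \<omega> * grid_expectation \<delta> g n (\<xi> s \<omega>) \<partial>Pr x)"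
proof (induction n arbitrary: s Z C)
  case (Suc n)
  obtain D where D: "\<And>x. x \<in> X \<Longrightarrow> \<bar>g x\<bar> \<le> D" using bounded_observable_bound[OF g] by blast
  let ?Z = "\<lambda>\<omega>. Z \<omega> * g (\<xi> (s + \<delta>) \<omega>)"
  have Z'm: "?Z \<in> borel_measurable (\<F> (s + \<delta>))"
  proof (rule borel_measurable_times)
    show "Z \<in> borel_measurable (\<F> (s + \<delta>))"
      using filtration_mono[OF _ Suc.prems(2)] \<delta> by simp
    show "(\<lambda>\<omega>. g (\<xi> (s + \<delta>) \<omega>)) \<in> borel_measurable (\<F> (s + \<delta>))"
      using measurable_compose[OF xi_filtration_measurable[of "s + \<delta>" "s + \<delta>"]] g Suc.prems(1) \<delta>
      by (auto simp: bounded_observable_def)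
  qed
  have Z'b: "\<bar>?Z \<omega>\<bar> \<le> \<bar>C\<bar> * \<bar>D\<bar>" if "\<omega> \<in> space \<Omega>" for \<omega>
    unfolding abs_mult using Suc.prems(3)[OF that] D[OF xi_in_X[OF _ that], of "s + \<delta>"] Suc.prems(1) \<delta>
    by (intro mult_mono) auto
  have "(\<integral>\<omega>. Z \<omega> * (\<Prod>k<Suc n. g (\<xi> (s + \<delta> * (real k + 1)) \<omega>)) \<partial>Pr x)
      = (\<integral>\<omega>. ?Z \<omega> * (\<Prod>k<n. g (\<xi> ((s + \<delta>) + \<delta> * (real k + 1)) \<omega>)) \<partial>Pr x)"
    unfolding prod.lessThan_Suc_shift by (simp add: algebra_simps)
  also have "\<dots> = (\<integral>\<omega>. ?Z \<omega> * grid_expectation \<delta> g n (\<xi> (s + \<delta>) \<omega>) \<partial>Pr x)"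
    using Suc.prems(1) \<delta> by (intro Suc.IH[OF _ Z'm Z'b]) auto
  also have "\<dots> = (\<integral>\<omega>. Z \<omega> * (g (\<xi> (s + \<delta>) \<omega>) * grid_expectation \<delta> g n (\<xi> (s + \<delta>) \<omega>)) \<partial>Pr x)"
    by (simp add: mult.assoc)
  also have "\<dots> = (\<integral>\<omega>. Z \<omega> * grid_expectation \<delta> g (Suc n) (\<xi> s \<omega>) \<partial>Pr x)"
    using markov_step[OF x Suc.prems(1) \<delta> bounded_observable_mult[OF g
        bounded_observable_grid_expectation[OF g \<delta>]] Suc.prems(2,3)] by simp
  finally show ?case .
qed simp

text \<open>Both sides equal the expectation of \<open>grid_expectation \<delta> g n\<close> at the state at time \<open>s\<close>; in particular
(\<open>s = 0\<close>) this function is the expectation of the unshifted product.\<close>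
lemma markov_product:
  assumes x: "x \<in> X" and g: "bounded_observable g" and \<delta>: "0 \<le> \<delta>" and s: "0 \<le> s"
  shows "(\<integral>\<omega>. (\<Prod>k<n. g (\<xi> (s + \<delta> * (real k + 1)) \<omega>)) \<partial>Pr x) =
    transition \<xi> Pr s (\<lambda>y. \<integral>\<omega>. (\<Prod>k<n. g (\<xi> (\<delta> * (real k + 1)) \<omega>)) \<partial>Pr y) x"
proof -
  have one: "(\<lambda>_. 1) \<in> borel_measurable (\<F> s)" for s by simp
  have *: "(\<integral>\<omega>. (\<Prod>k<n. g (\<xi> (s + \<delta> * (real k + 1)) \<omega>)) \<partial>Pr y) = (\<integral>\<omega>. grid_expectation \<delta> g n (\<xi> s \<omega>) \<partial>Pr y)"
    if "y \<in> X" "0 \<le> s" for y s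
    using markov_grid[OF that(1) g \<delta> that(2) one, of 1 n] by simp
  have "(\<integral>\<omega>. (\<Prod>k<n. g (\<xi> (\<delta> * (real k + 1)) \<omega>)) \<partial>Pr y) = grid_expectation \<delta> g n y" if y: "y \<in> X" for y
  proof -
    interpret P: prob_space "Pr y" by (rule prob_Pr[OF y])
    have "(\<integral>\<omega>. grid_expectation \<delta> g n (\<xi> 0 \<omega>) \<partial>Pr y) = (\<integral>\<omega>. grid_expectation \<delta> g n y \<partial>Pr y)"
      using start[OF y] bounded_observable_xi[OF bounded_observable_grid_expectation[OF g \<delta>], of 0]
      by (intro integral_cong_AE measurable_Pr[OF y]) (auto elim: eventually_mono)
    then show ?thesis using *[OF y, of 0] by (simp add: P.prob_space)
  qed
  then show ?thesis unfolding *[OF x s] transition_def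
    using xi_in_X[OF s] by (intro Bochner_Integration.integral_cong) (auto simp: space_Pr[OF x])
qed

text \<open>Differentiation under the expectation.  The Lipschitz bound makes the difference quotients
uniformly bounded, so that dominated convergence can be used twice: for the expectation at each
\<open>x\<close>, and then for the \<open>L\<^sup>2\<close> norm.\<close>
lemma L2_right_derivative_expectation:
  fixes F :: "real \<Rightarrow> 'w \<Rightarrow> real"
  assumes F: "\<And>h. 0 \<le> h \<Longrightarrow> F h \<in> borel_measurable \<Omega>" and F': "F' \<in> borel_measurable \<Omega>"
    and F0: "\<And>\<omega>. \<omega> \<in> space \<Omega> \<Longrightarrow> \<bar>F 0 \<omega>\<bar> \<le> L"
    and F'b: "\<And>\<omega>. \<omega> \<in> space \<Omega> \<Longrightarrow> \<bar>F' \<omega>\<bar> \<le> L"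
    and lip: "\<And>\<omega> h. \<omega> \<in> space \<Omega> \<Longrightarrow> 0 \<le> h \<Longrightarrow> h \<le> 1 \<Longrightarrow> \<bar>F h \<omega> - F 0 \<omega>\<bar> \<le> L * h"
    and der: "\<And>\<omega>. \<omega> \<in> space \<Omega> \<Longrightarrow> ((\<lambda>h. F h \<omega>) has_real_derivative F' \<omega>) (at 0 within {0..})"
  shows "((\<lambda>h. L2_norm \<mu> (\<lambda>x. ((\<integral>\<omega>. F h \<omega> \<partial>Pr x) - (\<integral>\<omega>. F 0 \<omega> \<partial>Pr x)) / h - (\<integral>\<omega>. F' \<omega> \<partial>Pr x)))
    \<longlongrightarrow> 0) (at_right 0)"
proof -
  have "((\<lambda>h. L2_norm \<mu> (\<lambda>x. ((\<integral>\<omega>. F h \<omega> \<partial>Pr x) - (\<integral>\<omega>. F 0 \<omega> \<partial>Pr x)) / h - (\<integral>\<omega>. F' \<omega> \<partial>Pr x)))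
    \<longlongrightarrow> 0) (at 0 within {0..1})"
    unfolding tendsto_at_iff_sequentially comp_def
  proof (intro allI impI L2_norm_tendsto_0)
    fix H :: "nat \<Rightarrow> real" and n and x
    assume H: "\<forall>i. H i \<in> {0..1} - {0}" "H \<longlonglongrightarrow> 0"
    have Hi: "0 < H i" "H i \<le> 1" for i using H(1) by (auto simp: less_le)
    define q where "q i \<omega> = (F (H i) \<omega> - F 0 \<omega>) / H i" for i \<omega>
    have qm: "q i \<in> borel_measurable \<Omega>" for i
      using F[of "H i"] F[of 0] Hi(1)[of i] unfolding q_def[abs_def] by auto
    have qb: "\<bar>q i \<omega>\<bar> \<le> L" if "\<omega> \<in> space \<Omega>" for i \<omega>
      using lip[OF that, of "H i"] Hi[of i] by (simp add: q_def field_simps)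
    have int: "integrable (Pr x) (F h)" if "x \<in> X" "0 \<le> h" "h \<le> 1" for h x
    proof (rule Pr_integrable[OF that(1) F[OF that(2)]])
      fix \<omega> assume \<omega>: "\<omega> \<in> space \<Omega>"
      show "\<bar>F h \<omega>\<bar> \<le> L + L * h" using lip[OF \<omega> that(2,3)] F0[OF \<omega>] by linarith
    qed
    have eq: "((\<integral>\<omega>. F (H i) \<omega> \<partial>Pr x) - (\<integral>\<omega>. F 0 \<omega> \<partial>Pr x)) / H i - (\<integral>\<omega>. F' \<omega> \<partial>Pr x)
        = (\<integral>\<omega>. q i \<omega> - F' \<omega> \<partial>Pr x)" if "x \<in> X" for i x
      using int[OF that, of "H i"] int[OF that, of 0] Hi[of i] Pr_integrable[OF that F' F'b]
      by (simp add: q_def)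
    show "(\<lambda>x. ((\<integral>\<omega>. F (H n) \<omega> \<partial>Pr x) - (\<integral>\<omega>. F 0 \<omega> \<partial>Pr x)) / H n - (\<integral>\<omega>. F' \<omega> \<partial>Pr x)) \<in> borel_measurable \<mu>"
      using F[of "H n"] F[of 0] F' Hi(1)[of n] by (auto intro!: borel_measurable_diff borel_measurable_divide expectation_measurable)
    assume x: "x \<in> space \<mu>"
    then have xX: "x \<in> X" by (simp add: space_mu)
    show "\<bar>((\<integral>\<omega>. F (H n) \<omega> \<partial>Pr x) - (\<integral>\<omega>. F 0 \<omega> \<partial>Pr x)) / H n - (\<integral>\<omega>. F' \<omega> \<partial>Pr x)\<bar> \<le> L + L"
      unfolding eq[OF xX]
    proof (rule Pr_expectation_bound[OF xX])
      fix \<omega> assume "\<omega> \<in> space \<Omega>"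
      with qb[OF this, of n] F'b[OF this] show "\<bar>q n \<omega> - F' \<omega>\<bar> \<le> L + L" by linarith
    qed (use qm F' in auto)
    have "(\<lambda>n. \<integral>\<omega>. q n \<omega> - F' \<omega> \<partial>Pr x) \<longlonglongrightarrow> (\<integral>\<omega>. 0 \<partial>Pr x)"
    proof (rule integral_dominated_convergence[where w="\<lambda>_. L + L"])
      interpret P: prob_space "Pr x" by (rule prob_Pr[OF xX])
      show "integrable (Pr x) (\<lambda>_. L + L)" by simp
      show "(\<lambda>\<omega>. q n \<omega> - F' \<omega>) \<in> borel_measurable (Pr x)" for n
        using qm F' by (intro measurable_Pr[OF xX]) auto
      show "AE \<omega> in Pr x. (\<lambda>n. q n \<omega> - F' \<omega>) \<longlonglongrightarrow> 0"
      proof (rule AE_I2)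
        fix \<omega> assume "\<omega> \<in> space (Pr x)"
        then have \<omega>: "\<omega> \<in> space \<Omega>" by (simp add: space_Pr[OF xX])
        have "((\<lambda>h. (F h \<omega> - F 0 \<omega>) / h) \<longlongrightarrow> F' \<omega>) (at 0 within {0..})"
          using der[OF \<omega>] by (simp add: has_field_derivative_iff)
        then have "(\<lambda>n. q n \<omega>) \<longlonglongrightarrow> F' \<omega>"
          unfolding tendsto_at_iff_sequentially comp_def q_def using H Hi(1) less_imp_le[OF Hi(1)]
          by (auto simp: less_imp_neq)
        then show "(\<lambda>n. q n \<omega> - F' \<omega>) \<longlonglongrightarrow> 0" by (rule LIM_zero)
      qed
      show "AE \<omega> in Pr x. norm (q n \<omega> - F' \<omega>) \<le> L + L" for n
      proof (rule AE_I2)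
        fix \<omega> assume "\<omega> \<in> space (Pr x)"
        then have \<omega>: "\<omega> \<in> space \<Omega>" by (simp add: space_Pr[OF xX])
        with qb[OF this, of n] F'b[OF this] show "norm (q n \<omega> - F' \<omega>) \<le> L + L" by simp
      qed
    qed simp
    then show "(\<lambda>n. ((\<integral>\<omega>. F (H n) \<omega> \<partial>Pr x) - (\<integral>\<omega>. F 0 \<omega> \<partial>Pr x)) / H n - (\<integral>\<omega>. F' \<omega> \<partial>Pr x)) \<longlonglongrightarrow> 0"
      by (simp add: eq[OF xX])
  qed
  then show ?thesis by (simp add: at_within_Icc_at_right)
qed

end

section \<open>The Feynman--Kac function of a continuous potential\<close>

lemma exp_diff_le:
  fixes p q m :: real
  assumes "p \<le> m" "q \<le> m"
  shows "\<bar>exp p - exp q\<bar> \<le> exp m * \<bar>p - q\<bar>"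
proof -
  have one: "exp x - exp y \<le> exp m * (x - y)" if "y \<le> x" "x \<le> m" for x y
  proof -
    have "exp x - exp y = exp x * (1 - exp (y - x))" by (simp add: algebra_simps exp_add[symmetric])
    also have "\<dots> \<le> exp x * (x - y)"
    proof (rule mult_left_mono)
      show "1 - exp (y - x) \<le> x - y" using exp_ge_add_one_self[of "y - x"] by linarith
    qed simp
    also have "\<dots> \<le> exp m * (x - y)" using that by (intro mult_right_mono) auto
    finally show ?thesis .
  qed
  show ?thesis using one[of p q] one[of q p] assms
    by (cases "p \<le> q") (auto simp: abs_if)
qed


text \<open>The potential is bounded by the same constant on the whole space and not only on \<open>X\<close>, which is
convenient because the truncated approximants are of this kind.\<close>
locale feynman_kac = stationary_markov +
  fixes V :: "'b \<Rightarrow> real" and C :: real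
  assumes V_cont: "continuous_on UNIV V" and V_bound: "\<And>x. \<bar>V x\<bar> \<le> C"
begin

lemma C_nonneg: "0 \<le> C"
  using order_trans[OF abs_ge_zero V_bound] .

definition Y :: "real \<Rightarrow> 'a \<Rightarrow> real" where
  "Y s \<omega> = V (\<xi> (max 0 s) \<omega>)"

definition J :: "real \<Rightarrow> 'a \<Rightarrow> real" where
  "J a \<omega> = (LINT s:{0..a}|lborel. Y s \<omega>)"

text \<open>The Feynman--Kac semigroup with potential \<open>V\<close>, applied to the constant function \<open>1\<close>.\<close>
definition u :: "real \<Rightarrow> 'b \<Rightarrow> real" where
  "u t x = (\<integral>\<omega>. exp (J t \<omega>) \<partial>Pr x)"

text \<open>The right derivative of \<open>u\<close> in time.\<close>
definition w :: "real \<Rightarrow> 'b \<Rightarrow> real" where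
  "w t x = (\<integral>\<omega>. exp (J t \<omega>) * Y t \<omega> \<partial>Pr x)"

lemma V_measurable: "V \<in> borel_measurable \<mu>"
  by (intro measurable_of_restrict_borel[OF sets_mu] borel_measurable_continuous_onI V_cont)

lemma Y_measurable: "Y s \<in> borel_measurable \<Omega>"
  unfolding Y_def[abs_def]
  by (rule measurable_compose[OF xi_measurable])
    (auto intro!: measurable_restrict_space1 borel_measurable_continuous_onI V_cont)

lemma Y_bound: "\<bar>Y s \<omega>\<bar> \<le> C"
  by (simp add: Y_def V_bound)

lemma Y_right_continuous:
  assumes "\<omega> \<in> space \<Omega>" shows "((\<lambda>r. Y r \<omega>) \<longlongrightarrow> Y s \<omega>) (at_right s)"
proof -
  have "isCont V (\<xi> (max 0 s) \<omega>)" using V_cont by (simp add: continuous_on_eq_continuous_at)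
  from isCont_tendsto_compose[OF this cadlag_clamp_right_continuous[OF xi_cadlag[OF assms]]]
  show ?thesis by (simp add: Y_def)
qed

lemma Y_path_measurable: "\<omega> \<in> space \<Omega> \<Longrightarrow> (\<lambda>s. Y s \<omega>) \<in> borel_measurable borel"
  by (intro right_continuous_borel_measurable Y_right_continuous)

lemma J_measurable: "J a \<in> borel_measurable \<Omega>"
  unfolding J_def[abs_def]
  by (rule set_integral_jointly_measurable[OF right_continuous_jointly_measurable[OF Y_measurable Y_right_continuous]]) auto

lemma J_0: "J 0 \<omega> = 0"
  unfolding J_def set_lebesgue_integral_def
  by (rule integral_eq_zero_AE, rule eventually_mono[OF AE_lborel_singleton[of 0]]) (auto simp: indicator_def)

lemma J_bound: "\<omega> \<in> space \<Omega> \<Longrightarrow> 0 \<le> a \<Longrightarrow> \<bar>J a \<omega>\<bar> \<le> C * a"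
  using abs_set_integral_le[of 0 a "\<lambda>s. Y s \<omega>" C] Y_bound by (simp add: J_def)

lemma J_add:
  "\<omega> \<in> space \<Omega> \<Longrightarrow> 0 \<le> a \<Longrightarrow> 0 \<le> h \<Longrightarrow> J (a + h) \<omega> = J a \<omega> + (LINT s:{a..a+h}|lborel. Y s \<omega>)"
  unfolding J_def by (rule integral_0_add[OF Y_path_measurable Y_bound])

lemma J_Lipschitz:
  "\<omega> \<in> space \<Omega> \<Longrightarrow> 0 \<le> a \<Longrightarrow> 0 \<le> h \<Longrightarrow> \<bar>J (a + h) \<omega> - J a \<omega>\<bar> \<le> C * h"
  using abs_set_integral_le[of a "a + h" "\<lambda>s. Y s \<omega>" C] Y_bound by (simp add: J_add)

lemma J_right_derivative:
  "\<omega> \<in> space \<Omega> \<Longrightarrow> 0 \<le> a \<Longrightarrow> ((\<lambda>h. J (a + h) \<omega>) has_real_derivative Y a \<omega>) (at 0 within {0..})"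
  unfolding J_def
  by (rule right_derivative_integral[OF Y_path_measurable Y_bound Y_right_continuous])

text \<open>The exponential of a Riemann sum is a product of functions of the states at grid points.  In this
form the exponential functional is accessible to the Markov property.\<close>
lemma grid_product_tendsto:
  assumes \<omega>: "\<omega> \<in> space \<Omega>" and h: "0 \<le> h" and t: "0 < t"
  shows "(\<lambda>n. exp (\<Sum>k<Suc n. t / real (Suc n) * Y (h + t / real (Suc n) * (real k + 1)) \<omega>))
    \<longlonglongrightarrow> exp (J (h + t) \<omega> - J h \<omega>)"
proof -
  let ?\<phi> = "\<lambda>s. Y (h + s) \<omega>"
  have rc: "(?\<phi> \<longlongrightarrow> ?\<phi> s) (at_right s)" for s
  proof -
    have "filterlim (\<lambda>r. h + r) (at_right (h + s)) (at_right s)"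
      by (auto simp: filterlim_at eventually_at_filter intro!: tendsto_intros)
    from filterlim_compose[OF Y_right_continuous[OF \<omega>] this] show ?thesis .
  qed
  note m = right_continuous_borel_measurable[OF rc]
  have "(LINT s:{0..t}|lborel. ?\<phi> s) = integral {0..t} ((\<lambda>s. Y s \<omega>) \<circ> (+) h)"
    using set_borel_integral_eq_integral(2)[OF bounded_measurable_set_integrable[OF m Y_bound, of "{0..t}"]]
    by (simp add: comp_def)
  also have "\<dots> = integral {h..h+t} (\<lambda>s. Y s \<omega>)"
    unfolding integral_shift_Icc_real by (simp add: add.commute)
  also have "\<dots> = (LINT s:{h..h+t}|lborel. Y s \<omega>)"
    by (intro set_borel_integral_eq_integral(2)[symmetric]
        bounded_measurable_set_integrable[OF Y_path_measurable[OF \<omega>] Y_bound]) auto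
  also have "\<dots> = J (h + t) \<omega> - J h \<omega>" using J_add[OF \<omega> h less_imp_le[OF t]] by simp
  finally have "(LINT s:{0..t}|lborel. ?\<phi> s) = J (h + t) \<omega> - J h \<omega>" .
  with Riemann_sum_tendsto_integral[OF m Y_bound rc t] show ?thesis
    by (intro tendsto_exp) simp
qed

lemma u_measurable: "u t \<in> borel_measurable \<mu>"
  unfolding u_def[abs_def] using J_measurable[of t] by (intro expectation_measurable) auto

text \<open>The Markov property at time \<open>h\<close> for the exponential functional: it holds for the products over
grids by \<open>markov_product\<close>, and both sides converge as the mesh tends to \<open>0\<close>.\<close>
lemma transition_u:
  assumes x: "x \<in> X" and h: "0 \<le> h" and t: "0 \<le> t"
  shows "transition \<xi> Pr h (u t) x = (\<integral>\<omega>. exp (J (h + t) \<omega> - J h \<omega>) \<partial>Pr x)"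
proof (cases "t = 0")
  case True
  have "u 0 y = 1" if "y \<in> X" for y
    using prob_space.prob_space[OF prob_Pr[OF that]] by (simp add: u_def J_0)
  then have "transition \<xi> Pr h (u t) x = (\<integral>\<omega>. 1 \<partial>Pr x)"
    unfolding transition_def True using xi_in_X[OF h]
    by (intro Bochner_Integration.integral_cong) (auto simp: space_Pr[OF x])
  then show ?thesis by (simp add: True)
next
  case False
  with t have t: "0 < t" by simp
  define \<delta> where "\<delta> n = t / real (Suc n)" for n
  have \<delta>: "0 \<le> \<delta> n" "\<delta> n * real (Suc n) = t" for n using t by (auto simp: \<delta>_def)
  define g where "g n = (\<lambda>x. exp (\<delta> n * V x))" for n
  have g: "bounded_observable (g n)" for n
  proof -
    have "\<bar>g n x\<bar> \<le> exp (\<delta> n * C)" for x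
      using mult_left_mono[of "V x" C "\<delta> n"] V_bound[of x] \<delta>(1)[of n] by (auto simp: g_def)
    moreover have "g n \<in> borel_measurable BX"
      unfolding measurable_mu g_def using V_measurable by measurable
    ultimately show ?thesis by (auto simp: bounded_observable_def bounded_iff)
  qed
  define S where "S n r \<omega> = (\<Sum>k<Suc n. \<delta> n * Y (r + \<delta> n * (real k + 1)) \<omega>)" for n r \<omega>
  have prod: "(\<Prod>k<Suc n. g n (\<xi> (r + \<delta> n * (real k + 1)) \<omega>)) = exp (S n r \<omega>)" if "0 \<le> r" for n r \<omega>
  proof -
    have "max 0 (r + \<delta> n * (real k + 1)) = r + \<delta> n * (real k + 1)" for k
      using that \<delta>(1)[of n] by (intro max_absorb2 add_nonneg_nonneg mult_nonneg_nonneg) auto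
    then show ?thesis unfolding S_def g_def Y_def exp_sum[OF finite_lessThan] by simp
  qed
  have Sm: "S n r \<in> borel_measurable \<Omega>" for n r
    unfolding S_def[abs_def] using Y_measurable by (intro borel_measurable_sum borel_measurable_times) auto
  have Sb: "exp (S n r \<omega>) \<le> exp (C * t)" for n r \<omega>
  proof -
    have "S n r \<omega> \<le> (\<Sum>k<Suc n. \<delta> n * C)"
      unfolding S_def using \<delta>(1) Y_bound by (intro sum_mono mult_left_mono) (auto simp: abs_le_iff)
    also have "\<dots> = C * t" using \<delta>(2)[of n] by (simp add: mult.commute mult.assoc)
    finally show ?thesis by simp
  qed
  have lim: "(\<lambda>n. \<integral>\<omega>. exp (S n r \<omega>) \<partial>Pr y) \<longlonglongrightarrow> (\<integral>\<omega>. exp (J (r + t) \<omega> - J r \<omega>) \<partial>Pr y)"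
    if y: "y \<in> X" and r: "0 \<le> r" for y r
  proof (rule integral_dominated_convergence[where w="\<lambda>_. exp (C * t)"])
    interpret P: prob_space "Pr y" by (rule prob_Pr[OF y])
    show "integrable (Pr y) (\<lambda>_. exp (C * t))" by simp
    show "AE \<omega> in Pr y. (\<lambda>n. exp (S n r \<omega>)) \<longlonglongrightarrow> exp (J (r + t) \<omega> - J r \<omega>)"
      using grid_product_tendsto[OF _ r t] by (intro AE_I2) (simp add: space_Pr[OF y] S_def \<delta>_def)
    show "(\<lambda>\<omega>. exp (J (r + t) \<omega> - J r \<omega>)) \<in> borel_measurable (Pr y)"
      using J_measurable by (intro measurable_Pr[OF y]) auto
    show "(\<lambda>\<omega>. exp (S n r \<omega>)) \<in> borel_measurable (Pr y)" for n
      using Sm by (intro measurable_Pr[OF y]) auto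
    show "AE \<omega> in Pr y. norm (exp (S n r \<omega>)) \<le> exp (C * t)" for n using Sb by simp
  qed
  define \<Phi> where "\<Phi> n y = (\<integral>\<omega>. exp (S n 0 \<omega>) \<partial>Pr y)" for n y
  have \<Phi>: "(\<lambda>n. \<Phi> n y) \<longlonglongrightarrow> u t y" if "y \<in> X" for y
    using lim[OF that, of 0] by (simp add: \<Phi>_def u_def J_0)
  have \<Phi>b: "\<bar>\<Phi> n y\<bar> \<le> exp (C * t)" if "y \<in> X" for n y
    unfolding \<Phi>_def using Sm Sb by (intro Pr_expectation_bound[OF that]) auto
  have \<Phi>m: "\<Phi> n \<in> borel_measurable \<mu>" for n
    unfolding \<Phi>_def[abs_def] using Sm by (intro expectation_measurable) auto
  have eq: "transition \<xi> Pr h (\<Phi> n) x = (\<integral>\<omega>. exp (S n h \<omega>) \<partial>Pr x)" for n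
    using markov_product[OF x g \<delta>(1) h, of n n "Suc n"] prod[OF h, of n] prod[of 0 n]
    by (simp add: \<Phi>_def[abs_def])
  have "(\<lambda>n. transition \<xi> Pr h (\<Phi> n) x) \<longlonglongrightarrow> transition \<xi> Pr h (u t) x"
    unfolding transition_def
  proof (rule integral_dominated_convergence[where w="\<lambda>_. exp (C * t)"])
    interpret P: prob_space "Pr x" by (rule prob_Pr[OF x])
    show "integrable (Pr x) (\<lambda>_. exp (C * t))" by simp
    show "(\<lambda>\<omega>. \<Phi> n (\<xi> h \<omega>)) \<in> borel_measurable (Pr x)" "(\<lambda>\<omega>. u t (\<xi> h \<omega>)) \<in> borel_measurable (Pr x)" for n
      using \<Phi>m u_measurable by (auto intro!: measurable_Pr[OF x] measurable_compose[OF xi_measurable[OF h]] simp: measurable_mu)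
    show "AE \<omega> in Pr x. (\<lambda>n. \<Phi> n (\<xi> h \<omega>)) \<longlonglongrightarrow> u t (\<xi> h \<omega>)"
      using \<Phi> xi_in_X[OF h] by (intro AE_I2) (simp add: space_Pr[OF x])
    show "AE \<omega> in Pr x. norm (\<Phi> n (\<xi> h \<omega>)) \<le> exp (C * t)" for n
      using \<Phi>b xi_in_X[OF h] by (intro AE_I2) (simp add: space_Pr[OF x])
  qed
  moreover have "(\<lambda>n. transition \<xi> Pr h (\<Phi> n) x) \<longlonglongrightarrow> (\<integral>\<omega>. exp (J (h + t) \<omega> - J h \<omega>) \<partial>Pr x)"
    unfolding eq by (rule lim[OF x h])
  ultimately show ?thesis by (rule LIMSEQ_unique)
qed

lemma exp_J_abs: "\<omega> \<in> space \<Omega> \<Longrightarrow> 0 \<le> t \<Longrightarrow> \<bar>exp (J t \<omega>)\<bar> \<le> exp (C * t)"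
  using J_bound[of \<omega> t] by (simp add: abs_le_iff)

lemma J_neg: "t < 0 \<Longrightarrow> J t \<omega> = 0"
  by (simp add: J_def set_lebesgue_integral_def)

lemma exp_J_abs_max: "\<omega> \<in> space \<Omega> \<Longrightarrow> \<bar>exp (J t \<omega>)\<bar> \<le> exp (C * max 0 t)"
  using exp_J_abs[of \<omega> t] J_neg[of t \<omega>] by (cases "0 \<le> t") (auto simp: max_def)

lemma u_bound: "x \<in> X \<Longrightarrow> \<bar>u t x\<bar> \<le> exp (C * max 0 t)"
  unfolding u_def using J_measurable[of t] exp_J_abs_max
  by (intro Pr_expectation_bound) auto

lemma u_L2: "u t \<in> L2 \<mu>"
  by (rule L2_bounded[OF finite_measure_axioms u_measurable u_bound]) (simp add: space_mu)

lemma exp_J_Y_measurable: "(\<lambda>\<omega>. exp (J t \<omega>) * Y t \<omega>) \<in> borel_measurable \<Omega>"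
  using J_measurable[of t] Y_measurable[of t] by measurable

lemma exp_J_Y_bound:
  assumes "\<omega> \<in> space \<Omega>" shows "\<bar>exp (J t \<omega>) * Y s \<omega>\<bar> \<le> exp (C * max 0 t) * C"
  unfolding abs_mult using exp_J_abs_max[OF assms, of t] Y_bound[of s \<omega>]
  by (intro mult_mono) auto

lemma w_L2: "w t \<in> L2 \<mu>"
proof (rule L2_bounded[OF finite_measure_axioms])
  show "w t \<in> borel_measurable \<mu>"
    unfolding w_def[abs_def] by (rule expectation_measurable[OF exp_J_Y_measurable])
  show "\<bar>w t x\<bar> \<le> exp (C * max 0 t) * C" if "x \<in> space \<mu>" for x
    unfolding w_def using that
    by (intro Pr_expectation_bound exp_J_Y_measurable exp_J_Y_bound) (auto simp: space_mu)
qed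

lemma u_Lipschitz:
  assumes "0 \<le> s" "s \<le> t" "t \<le> T"
  shows "L2_norm \<mu> (\<lambda>x. u t x - u s x) \<le> exp (C * T) * C * (t - s)"
proof (rule L2_norm_le_bound)
  show "(\<lambda>x. u t x - u s x) \<in> borel_measurable \<mu>" using u_measurable by measurable
  fix x assume "x \<in> space \<mu>"
  then have x: "x \<in> X" by (simp add: space_mu)
  have m: "(\<lambda>\<omega>. exp (J r \<omega>)) \<in> borel_measurable \<Omega>" for r using J_measurable[of r] by measurable
  have "u t x - u s x = (\<integral>\<omega>. exp (J t \<omega>) - exp (J s \<omega>) \<partial>Pr x)"
    using Pr_integrable[OF x m exp_J_abs_max] by (simp add: u_def)
  also have "\<bar>\<dots>\<bar> \<le> exp (C * T) * C * (t - s)"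
  proof (rule Pr_expectation_bound[OF x])
    fix \<omega> assume \<omega>: "\<omega> \<in> space \<Omega>"
    have J: "J r \<omega> \<le> C * T" if "r = s \<or> r = t" for r
    proof -
      have "J r \<omega> \<le> C * r" using J_bound[OF \<omega>, of r] that assms by (auto simp: abs_le_iff)
      also have "\<dots> \<le> C * T" using that assms C_nonneg by (intro mult_left_mono) auto
      finally show ?thesis .
    qed
    have "\<bar>exp (J t \<omega>) - exp (J s \<omega>)\<bar> \<le> exp (C * T) * \<bar>J t \<omega> - J s \<omega>\<bar>"
      using J by (intro exp_diff_le) auto
    also have "\<dots> \<le> exp (C * T) * (C * (t - s))"
      using J_Lipschitz[OF \<omega>, of s "t - s"] assms by (intro mult_left_mono) auto
    finally show "\<bar>exp (J t \<omega>) - exp (J s \<omega>)\<bar> \<le> exp (C * T) * C * (t - s)" by (simp add: mult.assoc)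
  qed (use m in measurable)
  finally show "\<bar>u t x - u s x\<bar> \<le> exp (C * T) * C * (t - s)" .
qed

text \<open>Along a path, \<open>exp (J (t + h))\<close> has right derivative \<open>exp (J t) * Y t\<close> at \<open>h = 0\<close>.\<close>
lemma u_right_derivative:
  assumes t: "0 \<le> t"
  shows "((\<lambda>h. L2_norm \<mu> (\<lambda>x. (u (t + h) x - u t x) / h - w t x)) \<longlongrightarrow> 0) (at_right 0)"
proof -
  define L where "L = exp (C * (t + 1)) * (C + 1)"
  have "((\<lambda>h. L2_norm \<mu> (\<lambda>x. ((\<integral>\<omega>. exp (J (t + h) \<omega>) \<partial>Pr x) - (\<integral>\<omega>. exp (J (t + 0) \<omega>) \<partial>Pr x)) / h
      - (\<integral>\<omega>. exp (J t \<omega>) * Y t \<omega> \<partial>Pr x))) \<longlongrightarrow> 0) (at_right 0)"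
  proof (rule L2_right_derivative_expectation[where L=L])
    show "(\<lambda>\<omega>. exp (J (t + h) \<omega>)) \<in> borel_measurable \<Omega>" for h
      using J_measurable[of "t + h"] by measurable
    show "(\<lambda>\<omega>. exp (J t \<omega>) * Y t \<omega>) \<in> borel_measurable \<Omega>" by (rule exp_J_Y_measurable)
    fix \<omega> assume \<omega>: "\<omega> \<in> space \<Omega>"
    have e1: "exp (J (t + h) \<omega>) \<le> exp (C * (t + 1))" if "0 \<le> h" "h \<le> 1" for h
    proof -
      have "J (t + h) \<omega> \<le> C * (t + h)" using J_bound[OF \<omega>, of "t + h"] that t by (auto simp: abs_le_iff)
      also have "\<dots> \<le> C * (t + 1)" using that C_nonneg by (intro mult_left_mono) auto
      finally show ?thesis by simp
    qed
    show "\<bar>exp (J (t + 0) \<omega>)\<bar> \<le> L"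
      using mult_mono[OF e1[of 0], of 1 "C + 1"] C_nonneg by (simp add: L_def)
    show "\<bar>exp (J t \<omega>) * Y t \<omega>\<bar> \<le> L"
      unfolding L_def abs_mult using e1[of 0] Y_bound[of t \<omega>] C_nonneg by (intro mult_mono) auto
    show "\<bar>exp (J (t + h) \<omega>) - exp (J (t + 0) \<omega>)\<bar> \<le> L * h" if h: "0 \<le> h" "h \<le> 1" for h
    proof -
      have "\<bar>exp (J (t + h) \<omega>) - exp (J (t + 0) \<omega>)\<bar> \<le> exp (C * (t + 1)) * \<bar>J (t + h) \<omega> - J (t + 0) \<omega>\<bar>"
        using e1[OF h] e1[of 0] by (intro exp_diff_le) auto
      also have "\<dots> \<le> exp (C * (t + 1)) * ((C + 1) * h)"
        using J_Lipschitz[OF \<omega> t h(1)] h by (intro mult_left_mono) (auto simp: algebra_simps)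
      finally show ?thesis by (simp add: L_def mult.assoc)
    qed
    show "((\<lambda>h. exp (J (t + h) \<omega>)) has_real_derivative exp (J t \<omega>) * Y t \<omega>) (at 0 within {0..})"
      using DERIV_chain2[OF DERIV_exp J_right_derivative[OF \<omega> t]] by simp
  qed
  then show ?thesis by (simp add: u_def w_def)
qed

text \<open>By \<open>transition_u\<close> the difference quotient that defines the generator is the expectation of the
difference quotient of \<open>exp (J (t + h) - J h)\<close> at \<open>h = 0\<close>.  Its limit is the expectation of
\<open>exp (J t) * (Y t - Y 0)\<close>, and \<open>Y 0 = V x\<close> almost surely when the process starts at \<open>x\<close>.\<close>
lemma u_generator:
  assumes t: "0 \<le> t"
  shows "(u t, \<lambda>x. w t x - V x * u t x) \<in> generator \<mu> (transition \<xi> Pr)"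
proof -
  define L where "L = exp (C * (t + 2)) * (2 * C + 1)"
  have "((\<lambda>h. L2_norm \<mu> (\<lambda>x. ((\<integral>\<omega>. exp (J (t + h) \<omega> - J (0 + h) \<omega>) \<partial>Pr x)
      - (\<integral>\<omega>. exp (J (t + 0) \<omega> - J (0 + 0) \<omega>) \<partial>Pr x)) / h
      - (\<integral>\<omega>. exp (J t \<omega>) * (Y t \<omega> - Y 0 \<omega>) \<partial>Pr x))) \<longlongrightarrow> 0) (at_right 0)"
  proof (rule L2_right_derivative_expectation[where L=L])
    show "(\<lambda>\<omega>. exp (J (t + h) \<omega> - J (0 + h) \<omega>)) \<in> borel_measurable \<Omega>" for h
      using J_measurable[of "t + h"] J_measurable[of "0 + h"] by measurable
    show "(\<lambda>\<omega>. exp (J t \<omega>) * (Y t \<omega> - Y 0 \<omega>)) \<in> borel_measurable \<Omega>"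
      using J_measurable[of t] Y_measurable by measurable
    fix \<omega> assume \<omega>: "\<omega> \<in> space \<Omega>"
    have e0: "J (t + h) \<omega> - J (0 + h) \<omega> \<le> C * (t + 2)" if "0 \<le> h" "h \<le> 1" for h
    proof -
      have "J (t + h) \<omega> - J (0 + h) \<omega> \<le> C * (t + h) + C * h"
        using J_bound[OF \<omega>, of "t + h"] J_bound[OF \<omega>, of h] that t by (auto simp: abs_le_iff)
      also have "\<dots> = C * (t + 2 * h)" by (simp add: algebra_simps)
      also have "\<dots> \<le> C * (t + 2)" using that C_nonneg by (intro mult_left_mono) auto
      finally show ?thesis .
    qed
    have e1: "exp (J t \<omega>) \<le> exp (C * (t + 2))" using e0[of 0] by (simp add: J_0)
    show "\<bar>exp (J (t + 0) \<omega> - J (0 + 0) \<omega>)\<bar> \<le> L"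
      using mult_mono[OF e1, of 1 "2 * C + 1"] C_nonneg by (simp add: L_def J_0)
    show "\<bar>exp (J t \<omega>) * (Y t \<omega> - Y 0 \<omega>)\<bar> \<le> L"
      unfolding L_def abs_mult using e1 Y_bound[of t \<omega>] Y_bound[of 0 \<omega>] C_nonneg
      by (intro mult_mono) auto
    show "\<bar>exp (J (t + h) \<omega> - J (0 + h) \<omega>) - exp (J (t + 0) \<omega> - J (0 + 0) \<omega>)\<bar> \<le> L * h"
      if h: "0 \<le> h" "h \<le> 1" for h
    proof -
      have "\<bar>exp (J (t + h) \<omega> - J (0 + h) \<omega>) - exp (J (t + 0) \<omega> - J (0 + 0) \<omega>)\<bar>
          \<le> exp (C * (t + 2)) * \<bar>(J (t + h) \<omega> - J (0 + h) \<omega>) - (J (t + 0) \<omega> - J (0 + 0) \<omega>)\<bar>"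
        using e0[OF h] e0[of 0] by (intro exp_diff_le) auto
      also have "\<dots> \<le> exp (C * (t + 2)) * ((2 * C + 1) * h)"
        using J_Lipschitz[OF \<omega> t h(1)] J_Lipschitz[OF \<omega> order_refl h(1)] h
        by (intro mult_left_mono) (auto simp: algebra_simps J_0 abs_le_iff)
      finally show ?thesis by (simp add: L_def mult.assoc)
    qed
    show "((\<lambda>h. exp (J (t + h) \<omega> - J (0 + h) \<omega>)) has_real_derivative exp (J t \<omega>) * (Y t \<omega> - Y 0 \<omega>))
        (at 0 within {0..})"
      using DERIV_chain2[OF DERIV_exp DERIV_diff[OF J_right_derivative[OF \<omega> t] J_right_derivative[OF \<omega> order_refl]]]
      by (simp add: J_0)
  qed
  moreover have "L2_norm \<mu> (\<lambda>x. ((\<integral>\<omega>. exp (J (t + h) \<omega> - J (0 + h) \<omega>) \<partial>Pr x)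
      - (\<integral>\<omega>. exp (J (t + 0) \<omega> - J (0 + 0) \<omega>) \<partial>Pr x)) / h
      - (\<integral>\<omega>. exp (J t \<omega>) * (Y t \<omega> - Y 0 \<omega>) \<partial>Pr x))
    = L2_norm \<mu> (\<lambda>x. (transition \<xi> Pr h (u t) x - u t x) / h - (w t x - V x * u t x))" if h: "0 < h" for h
  proof -
    have "(\<integral>\<omega>. exp (J t \<omega>) * (Y t \<omega> - Y 0 \<omega>) \<partial>Pr x) = w t x - V x * u t x" if x: "x \<in> X" for x
    proof -
      have m: "(\<lambda>\<omega>. exp (J t \<omega>)) \<in> borel_measurable \<Omega>" using J_measurable[of t] by measurable
      have "(\<integral>\<omega>. exp (J t \<omega>) * (Y t \<omega> - Y 0 \<omega>) \<partial>Pr x) = (\<integral>\<omega>. exp (J t \<omega>) * Y t \<omega> - V x * exp (J t \<omega>) \<partial>Pr x)"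
      proof (rule integral_cong_AE)
        show "AE \<omega> in Pr x. exp (J t \<omega>) * (Y t \<omega> - Y 0 \<omega>) = exp (J t \<omega>) * Y t \<omega> - V x * exp (J t \<omega>)"
          using start[OF x] by eventually_elim (simp add: Y_def algebra_simps)
      qed (use m Y_measurable in \<open>auto intro!: measurable_Pr[OF x]\<close>)
      also have "\<dots> = w t x - V x * u t x"
        using Pr_integrable[OF x exp_J_Y_measurable exp_J_Y_bound] Pr_integrable[OF x m exp_J_abs_max]
        by (simp add: w_def u_def)
      finally show ?thesis .
    qed
    moreover have "transition \<xi> Pr h (u t) x = (\<integral>\<omega>. exp (J (t + h) \<omega> - J (0 + h) \<omega>) \<partial>Pr x)" if "x \<in> X" for x
      using transition_u[OF that less_imp_le[OF h] t] by (simp add: add.commute)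
    ultimately show ?thesis
      unfolding L2_norm_def L2_inner_def
      by (intro arg_cong[where f=sqrt] Bochner_Integration.integral_cong)
        (auto simp: space_mu u_def J_0)
  qed
  ultimately have "((\<lambda>h. L2_norm \<mu> (\<lambda>x. (transition \<xi> Pr h (u t) x - u t x) / h - (w t x - V x * u t x)))
      \<longlongrightarrow> 0) (at_right 0)"
    by (elim Lim_transform_eventually) (auto intro!: eventually_at_rightI[of 0 1])
  moreover have "(\<lambda>x. w t x - V x * u t x) \<in> L2 \<mu>"
    by (intro L2_diff w_L2 L2_bounded_mult[OF V_measurable V_bound] u_L2)
  ultimately show ?thesis by (simp add: generator_def u_L2)
qed

lemma J_eq: "J T \<omega> = (LINT s:{0..T}|lborel. V (\<xi> s \<omega>))"
  unfolding J_def Y_def by (rule set_lebesgue_integral_cong) (auto simp: max_def)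

text \<open>The exponential moment is \<open>\<integral> u T d\<mu> \<le> \<parallel>u T\<parallel>\<close>, and \<open>\<parallel>u T\<parallel>\<^sup>2 \<le> \<langle>u T, u T\<rangle>\<^sub>\<epsilon> / (1 - \<epsilon>)\<close>, where the energy is
controlled by \<open>form_growth\<close> from its initial value \<open>1\<close>.\<close>
lemma exponential_moment_continuous:
  assumes form: "coercive_L2_form \<mu> E \<epsilon>" and T: "0 \<le> T"
    and hypo: "\<And>g h. (g, h) \<in> generator \<mu> (transition \<xi> Pr) \<Longrightarrow> \<Lambda> * Var \<mu> g \<le> E (\<lambda>x. - h x) g"
    and gap: "(1 + \<epsilon>) * C < \<Lambda>"
  shows "(\<integral>\<omega>. exp (LINT s:{0..T}|lborel. V (\<xi> s \<omega>)) \<partial>P\<mu>) \<le> (1 - \<epsilon>) powr (- 1 / 2) *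
    exp (T * (\<bar>\<integral>x. V x \<partial>\<mu>\<bar> + (2 + \<epsilon>)\<^sup>2 * (\<integral>x. (V x)\<^sup>2 \<partial>\<mu>) / (4 * (\<Lambda> - (1 + \<epsilon>) * C))))"
proof -
  interpret F: coercive_L2_form \<mu> E \<epsilon> by (rule form)
  define k where "k = \<bar>\<integral>x. V x \<partial>\<mu>\<bar> + (2 + \<epsilon>)\<^sup>2 * (\<integral>x. (V x)\<^sup>2 \<partial>\<mu>) / (4 * (\<Lambda> - (1 + \<epsilon>) * C))"
  have dissip: "E (w t) (u t) \<le> k * E (u t) (u t)" if t: "0 \<le> t" for t
  proof -
    have g: "(\<lambda>x. w t x - V x * u t x) \<in> L2 \<mu>" and Vu: "(\<lambda>x. V x * u t x) \<in> L2 \<mu>"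
      by (intro L2_diff w_L2 L2_bounded_mult[OF V_measurable V_bound] u_L2)+
    have "E (w t) (u t) = - E (\<lambda>x. - (w t x - V x * u t x)) (u t) + E (\<lambda>x. V x * u t x) (u t)"
      using F.form_lincomb[OF w_L2[of t] Vu u_L2[of t], of "-1" 1] by simp
    also have "\<dots> \<le> - \<Lambda> * Var \<mu> (u t) + E (\<lambda>x. V x * u t x) (u t)"
      using hypo[OF u_generator[OF t]] by simp
    also have "\<dots> \<le> k * E (u t) (u t)"
      unfolding k_def by (rule F.perturbed_form_bound[OF V_measurable V_bound C_nonneg gap u_L2])
    finally show ?thesis .
  qed
  have growth: "E (u T) (u T) \<le> E (u 0) (u 0) * exp (2 * k * T)"
  proof (rule F.form_growth[OF T u_L2 w_L2])
    show "L2_norm \<mu> (\<lambda>x. u t x - u s x) \<le> exp (C * (T + 1)) * C * (t - s)"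
      if "0 \<le> s" "s \<le> t" "t \<le> T + 1" for s t by (rule u_Lipschitz[OF that])
    show "L2_norm \<mu> (u t) \<le> exp (C * T)" if t: "0 \<le> t" "t \<le> T" for t
    proof (rule L2_norm_le_bound[OF u_measurable])
      fix x assume "x \<in> space \<mu>"
      then have "\<bar>u t x\<bar> \<le> exp (C * t)" using u_bound[of x t] t by (simp add: space_mu)
      also have "\<dots> \<le> exp (C * T)" using t C_nonneg by (simp add: mult_left_mono)
      finally show "\<bar>u t x\<bar> \<le> exp (C * T)" .
    qed
  qed (use u_right_derivative dissip in auto)
  have u0: "u 0 x = 1" if "x \<in> X" for x
    using prob_space.prob_space[OF prob_Pr[OF that]] by (simp add: u_def J_0)
  \<comment> \<open>\<open>u 0\<close> equals \<open>1\<close> only on the state space, so it is replaced by \<open>1\<close> through the norm bound of the form\<close>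
  have "E (u 0) (u 0) = 1"
  proof -
    have one: "(\<lambda>_. 1) \<in> L2 \<mu>" by (rule F.L2_const)
    have "L2_norm \<mu> (\<lambda>x. u 0 x - 1) \<le> 0"
      using u0 u_measurable[of 0] by (intro L2_norm_le_bound) (auto simp: space_mu)
    then have "E (\<lambda>x. u 0 x - 1) (u 0) = 0"
      using F.form_upper[OF L2_diff[OF u_L2[of 0] one] u_L2[of 0]] L2_norm_nonneg[of \<mu> "\<lambda>x. u 0 x - 1"]
      by (simp add: antisym)
    then have "E (u 0) (u 0) = E (u 0) (\<lambda>_. 1)"
      using F.form_lincomb[OF u_L2[of 0] one u_L2[of 0], of 1 "-1"] F.form_commute[OF one u_L2[of 0]] by simp
    also have "\<dots> = (\<integral>x. 1 \<partial>\<mu>)" unfolding F.form_one[OF u_L2]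
      using u0 by (intro Bochner_Integration.integral_cong) (auto simp: space_mu)
    finally show ?thesis by (simp add: prob_space)
  qed
  with growth have growth: "E (u T) (u T) \<le> (exp (k * T))\<^sup>2"
    by (simp add: power2_eq_square exp_add[symmetric] algebra_simps)
  have eps: "0 < 1 - \<epsilon>" using F.eps by simp
  have "(\<integral>x. u T x \<partial>\<mu>) = L2_inner \<mu> (u T) (\<lambda>_. 1)" by (simp add: L2_inner_def)
  also have "\<dots> \<le> L2_norm \<mu> (u T) * L2_norm \<mu> (\<lambda>_. 1)"
    using L2_Cauchy_Schwarz[OF u_L2[of T] F.L2_const[of 1]] by simp
  also have "L2_norm \<mu> (\<lambda>_. 1) = 1" by (simp add: L2_norm_def L2_inner_def prob_space)
  finally have le: "(\<integral>x. u T x \<partial>\<mu>) \<le> L2_norm \<mu> (u T)" by simp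
  have "(L2_norm \<mu> (u T))\<^sup>2 \<le> (exp (k * T))\<^sup>2 / (1 - \<epsilon>)"
    using order_trans[OF F.form_lower[OF u_L2[of T]] growth] eps by (simp add: field_simps)
  then have "sqrt ((L2_norm \<mu> (u T))\<^sup>2) \<le> sqrt ((exp (k * T))\<^sup>2 / (1 - \<epsilon>))" by (rule real_sqrt_le_mono)
  also have "sqrt ((exp (k * T))\<^sup>2 / (1 - \<epsilon>)) = (1 - \<epsilon>) powr (- 1 / 2) * exp (T * k)"
  proof -
    have "(1 - \<epsilon>) powr (- 1 / 2) = 1 / sqrt (1 - \<epsilon>)"
      using powr_minus_divide[of "1 - \<epsilon>" "1 / 2"] powr_half_sqrt[of "1 - \<epsilon>"] eps by simp
    then show ?thesis by (simp add: real_sqrt_divide mult.commute)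
  qed
  finally have le2: "L2_norm \<mu> (u T) \<le> (1 - \<epsilon>) powr (- 1 / 2) * exp (T * k)" by simp
  have "(\<integral>\<omega>. exp (LINT s:{0..T}|lborel. V (\<xi> s \<omega>)) \<partial>P\<mu>) = (\<integral>\<omega>. exp (J T \<omega>) \<partial>P\<mu>)"
    by (simp only: J_eq)
  also have "\<dots> = (\<integral>x. u T x \<partial>\<mu>)"
    unfolding u_def
  proof (rule integral_bind[OF _ _ kernel_subprob finite_measure_axioms, where B="exp (C * T)" and B'=1])
    show "(\<lambda>\<omega>. exp (J T \<omega>)) \<in> borel_measurable \<Omega>" using J_measurable[of T] by measurable
    show "\<bar>exp (J T \<omega>)\<bar> \<le> exp (C * T)" if "\<omega> \<in> space \<Omega>" for \<omega> using exp_J_abs[OF that T] .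
    show "AE x in \<mu>. emeasure (Pr x) (space (Pr x)) \<le> ennreal 1"
      using prob_space.emeasure_space_1[OF prob_Pr] by (intro AE_I2) (simp add: space_mu)
  qed
  finally show ?thesis using le le2 by (simp add: k_def)
qed

end

section \<open>Occupation integrals of bounded measurable functions\<close>

lemma cadlag_process_jointly_measurable:
  fixes X :: "'x::metric_space set"
  assumes proc: "cadlag_process N X \<zeta>" and f: "f \<in> borel_measurable (restrict_space borel X)"
  shows "(\<lambda>(s, \<omega>). f (\<zeta> (max 0 s) \<omega>)) \<in> borel_measurable (borel \<Otimes>\<^sub>M N)"
proof -
  have m: "\<zeta> t \<in> N \<rightarrow>\<^sub>M restrict_space borel X" if "0 \<le> t" for t
    using proc that by (simp add: cadlag_process_def)
  have c: "cadlag_on {0..} X (\<lambda>t. \<zeta> t \<omega>)" if "\<omega> \<in> space N" for \<omega>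
    using proc that by (simp add: cadlag_process_def)
  have "(\<lambda>(s, \<omega>). \<zeta> (max 0 s) \<omega>) \<in> borel_measurable (borel \<Otimes>\<^sub>M N)"
  proof (rule right_continuous_jointly_measurable)
    show "\<zeta> (max 0 s) \<in> borel_measurable N" for s
      using measurable_compose[OF m[of "max 0 s"] measurable_restrict_space1[of "\<lambda>x. x"]] by simp
  qed (rule cadlag_clamp_right_continuous[OF c])
  then have "(\<lambda>(s, \<omega>). \<zeta> (max 0 s) \<omega>) \<in> borel \<Otimes>\<^sub>M N \<rightarrow>\<^sub>M restrict_space borel X"
    using cadlag_right_limit(2)[OF c]
    by (intro measurable_restrict_space2) (auto simp: space_pair_measure)
  from measurable_compose[OF this f] show ?thesis by (simp add: case_prod_beta')
qed

lemma occupation_integral_clamp: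
  fixes T :: real
  shows   "(LINT s:{0..T}|lborel. f (\<zeta> (max 0 s) \<omega>)) = (LINT s:{0..T}|lborel. f (\<zeta> s \<omega>))"
  by (rule set_lebesgue_integral_cong) (auto simp: max_def)

lemma occupation_integral_measurable:
  fixes X :: "'x::metric_space set" and f :: "'x \<Rightarrow> real"
  assumes "cadlag_process N X \<zeta>" "f \<in> borel_measurable (restrict_space borel X)"
  shows "(\<lambda>\<omega>. LINT s:{0..T}|lborel. f (\<zeta> s \<omega>)) \<in> borel_measurable N"
  using set_integral_jointly_measurable[OF cadlag_process_jointly_measurable[OF assms] atLeastAtMost_borel[of 0 T]]
  by (simp add: occupation_integral_clamp)

lemma process_path_measurable:
  fixes X :: "'x::metric_space set" and f :: "'x \<Rightarrow> real"
  assumes "cadlag_process N X \<zeta>" "f \<in> borel_measurable (restrict_space borel X)" "\<omega> \<in> space N"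
  shows "(\<lambda>s. f (\<zeta> (max 0 s) \<omega>)) \<in> borel_measurable borel"
  using measurable_compose[OF measurable_Pair2'[OF assms(3)] cadlag_process_jointly_measurable[OF assms(1,2)]]
  by simp

lemma process_in_space:
  "cadlag_process N X \<zeta> \<Longrightarrow> \<omega> \<in> space N \<Longrightarrow> 0 \<le> t \<Longrightarrow> \<zeta> t \<omega> \<in> X"
  by (auto simp: cadlag_process_def cadlag_on_def)

lemma occupation_integral_bound:
  fixes f :: "'x::metric_space \<Rightarrow> real"
  assumes "cadlag_process N X \<zeta>" "\<omega> \<in> space N" "\<And>x. x \<in> X \<Longrightarrow> \<bar>f x\<bar> \<le> C" "0 \<le> T"
  shows "\<bar>LINT s:{0..T}|lborel. f (\<zeta> s \<omega>)\<bar> \<le> C * T"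
  using abs_set_integral_le[of 0 T "\<lambda>s. f (\<zeta> s \<omega>)" C] process_in_space[OF assms(1,2)] assms(3,4) by simp

lemma occupation_set_integrable:
  fixes X :: "'x::metric_space set" and f :: "'x \<Rightarrow> real"
  assumes "cadlag_process N X \<zeta>" "f \<in> borel_measurable (restrict_space borel X)" "\<omega> \<in> space N"
    and "\<And>x. x \<in> X \<Longrightarrow> \<bar>f x\<bar> \<le> C"
  shows "set_integrable lborel {0..T} (\<lambda>s. f (\<zeta> s \<omega>))"
proof -
  have "set_integrable lborel {0..T} (\<lambda>s. f (\<zeta> (max 0 s) \<omega>))"
    using process_in_space[OF assms(1,3)] assms(4)
    by (intro bounded_measurable_set_integrable[where C=C] process_path_measurable[OF assms(1-3)]) auto
  then show ?thesis
    by (rule set_integrable_cong[THEN iffD1, rotated -1]) (auto simp: max_def)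
qed


context stationary_markov
begin

lemma prob_stationary: "prob_space P\<mu>"
  and sets_stationary: "sets P\<mu> = sets \<Omega>"
proof -
  have mu: "\<mu> \<in> space (prob_algebra BX)"
    by (simp add: space_prob_algebra sets_mu prob_space_axioms)
  show "prob_space P\<mu>" by (rule prob_space_bind'[OF mu kernel])
  show "sets P\<mu> = sets \<Omega>" by (rule sets_bind'[OF mu kernel])
qed

lemma cadlag_stationary: "cadlag_process P\<mu> X \<xi>"
  using xi_measurable xi_cadlag measurable_cong_sets[OF sets_stationary refl]
    sets_eq_imp_space_eq[OF sets_stationary]
  by (auto simp: cadlag_process_def)

lemma stationary_expectation:
  fixes h :: "'x \<Rightarrow> real"
  assumes "h \<in> borel_measurable BX" "0 \<le> t"
  shows "(\<integral>\<omega>. h (\<xi> t \<omega>) \<partial>P\<mu>) = (\<integral>x. h x \<partial>\<mu>)"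
proof -
  have "\<xi> t \<in> P\<mu> \<rightarrow>\<^sub>M \<mu>"
    using xi_measurable[OF assms(2)] measurable_cong_sets[OF sets_stationary sets_mu] by blast
  moreover have "h \<in> borel_measurable \<mu>" using assms(1) by (simp add: measurable_mu)
  ultimately have "(\<integral>\<omega>. h (\<xi> t \<omega>) \<partial>P\<mu>) = (\<integral>x. h x \<partial>distr P\<mu> \<mu> (\<xi> t))"
    by (simp add: integral_distr)
  then show ?thesis using invariant assms(2) by (simp add: invariant_measure_def)
qed

lemma exp_occupation_integral_integrable:
  fixes h :: "'x \<Rightarrow> real"
  assumes h: "h \<in> borel_measurable BX" "\<And>x. x \<in> X \<Longrightarrow> \<bar>h x\<bar> \<le> C" and T: "0 \<le> T"
  shows "integrable P\<mu> (\<lambda>\<omega>. exp (LINT s:{0..T}|lborel. h (\<xi> s \<omega>)))"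
proof -
  interpret S: prob_space "P\<mu>" by (rule prob_stationary)
  show ?thesis
  proof (rule S.integrable_const_bound[of _ "exp (C * T)"])
    show "AE \<omega> in P\<mu>. norm (exp (LINT s:{0..T}|lborel. h (\<xi> s \<omega>))) \<le> exp (C * T)"
      using occupation_integral_bound[where f=h, OF cadlag_stationary _ h(2) T]
      by (intro AE_I2) (auto simp: abs_le_iff)
  qed (use occupation_integral_measurable[OF cadlag_stationary h(1), of T] in measurable)
qed

text \<open>Fubini's theorem and invariance: at each time the state has distribution \<open>\<mu>\<close>.\<close>
lemma stationary_occupation_integral:
  fixes h :: "'x \<Rightarrow> real"
  assumes h: "h \<in> borel_measurable BX" "\<And>x. x \<in> X \<Longrightarrow> \<bar>h x\<bar> \<le> C" and T: "0 \<le> T"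
  shows "(\<integral>\<omega>. (LINT s:{0..T}|lborel. h (\<xi> s \<omega>)) \<partial>P\<mu>) = T * (\<integral>x. h x \<partial>\<mu>)"
proof -
  interpret S: prob_space "P\<mu>" by (rule prob_stationary)
  interpret PS: pair_sigma_finite lborel "P\<mu>" ..
  let ?F = "\<lambda>s \<omega>. indicator {0..T} s * h (\<xi> (max 0 s) \<omega>)"
  have "sets (borel \<Otimes>\<^sub>M P\<mu>) = sets (lborel \<Otimes>\<^sub>M P\<mu>)"
    by (intro sets_pair_measure_cong) simp_all
  then have "(\<lambda>(s, \<omega>). h (\<xi> (max 0 s) \<omega>)) \<in> borel_measurable (lborel \<Otimes>\<^sub>M P\<mu>)"
    using measurable_cong_sets[OF _ refl] cadlag_process_jointly_measurable[OF cadlag_stationary h(1)] by blast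
  then have hm: "(\<lambda>p. h (\<xi> (max 0 (fst p)) (snd p))) \<in> borel_measurable (lborel \<Otimes>\<^sub>M P\<mu>)"
    by (simp add: case_prod_beta')
  have "integrable (lborel \<Otimes>\<^sub>M P\<mu>) (case_prod ?F)"
  proof (rule integrableI_bounded_set[where A="{0..T} \<times> space P\<mu>" and B=C])
    show "case_prod ?F \<in> borel_measurable (lborel \<Otimes>\<^sub>M P\<mu>)"
      unfolding case_prod_beta'
      by (intro borel_measurable_times hm measurable_compose[OF measurable_fst borel_measurable_indicator]) simp
    show "emeasure (lborel \<Otimes>\<^sub>M P\<mu>) ({0..T} \<times> space P\<mu>) < \<infinity>"
      using T by (simp add: S.emeasure_pair_measure_Times S.emeasure_space_1)
    show "AE p\<in>{0..T} \<times> space P\<mu> in lborel \<Otimes>\<^sub>M P\<mu>. norm (case_prod ?F p) \<le> C"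
      using h(2) process_in_space[OF cadlag_stationary] by (intro AE_I2) (auto simp: abs_mult)
    show "AE p in lborel \<Otimes>\<^sub>M P\<mu>. p \<notin> {0..T} \<times> space P\<mu> \<longrightarrow> case_prod ?F p = 0"
      by (intro AE_I2) (auto simp: space_pair_measure indicator_def)
  qed simp
  from PS.Fubini_integral[OF this]
  have "(\<integral>\<omega>. (LINT s:{0..T}|lborel. h (\<xi> (max 0 s) \<omega>)) \<partial>P\<mu>)
      = (\<integral>s. (\<integral>\<omega>. ?F s \<omega> \<partial>P\<mu>) \<partial>lborel)"
    by (simp add: set_lebesgue_integral_def)
  also have "\<dots> = (\<integral>s. indicator {0..T} s * (\<integral>x. h x \<partial>\<mu>) \<partial>lborel)"
    using stationary_expectation[OF h(1)] by simp
  finally show ?thesis using T by (simp add: occupation_integral_clamp)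
qed

end


text \<open>Continuous functions \<open>g n\<close> with the same bound converge to \<open>f\<close> in \<open>L\<^sup>1(\<mu>)\<close>.  The occupation integrals
are bounded by \<open>C * T\<close>, where \<open>exp\<close> is Lipschitz, so the exponential moments differ by at most
\<open>exp (C * T) * T * \<parallel>f - g n\<parallel>\<^sub>1\<close>.\<close>
lemma exponential_moment_bound:
  fixes X :: "'x::{complete_space,second_countable_topology} set" and f :: "'x \<Rightarrow> real"
  assumes sm: "stationary_markov \<Omega> X \<xi> Pr \<mu>" and form: "coercive_L2_form \<mu> E \<epsilon>" and T: "0 \<le> T"
    and hypo: "\<And>g h. (g, h) \<in> generator \<mu> (transition \<xi> Pr) \<Longrightarrow> \<Lambda> * Var \<mu> g \<le> E (\<lambda>x. - h x) g"
    and f: "f \<in> borel_measurable (restrict_space borel X)" "\<And>x. x \<in> X \<Longrightarrow> \<bar>f x\<bar> \<le> C"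
    and mean: "(\<integral>x. f x \<partial>\<mu>) = 0" and gap: "(1 + \<epsilon>) * C < \<Lambda>"
  shows "(\<integral>\<omega>. exp (LINT s:{0..T}|lborel. f (\<xi> s \<omega>)) \<partial>(\<mu> \<bind> Pr)) \<le> (1 - \<epsilon>) powr (- 1 / 2) *
    exp (T * ((2 + \<epsilon>)\<^sup>2 * (\<integral>x. (f x)\<^sup>2 \<partial>\<mu>) / (4 * (\<Lambda> - (1 + \<epsilon>) * C))))"
proof -
  interpret stationary_markov \<Omega> X \<xi> Pr \<mu> by (rule sm)
  interpret S: prob_space "P\<mu>" by (rule prob_stationary)
  obtain x0 where "x0 \<in> X" using not_empty space_mu by auto
  with f(2)[of x0] have C: "0 \<le> C" by linarith
  have fm: "f \<in> borel_measurable \<mu>" using f(1) by (simp add: measurable_mu)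
  have "\<exists>g. continuous_on UNIV g \<and> (\<forall>x. \<bar>g x\<bar> \<le> C) \<and> (\<integral>x. \<bar>f x - g x\<bar> \<partial>\<mu>) < inverse (real (Suc n))" for n
    by (rule clamped_continuous_L1_approximation[OF sets_mu finite_measure_axioms fm f(2) C]) auto
  then obtain g where "continuous_on UNIV (g n) \<and> (\<forall>x. \<bar>g n x\<bar> \<le> C) \<and>
      (\<integral>x. \<bar>f x - g n x\<bar> \<partial>\<mu>) < inverse (real (Suc n))" for n by metis
  then have g: "continuous_on UNIV (g n)" "\<And>x. \<bar>g n x\<bar> \<le> C"
    "(\<integral>x. \<bar>f x - g n x\<bar> \<partial>\<mu>) < inverse (real (Suc n))" for n by blast+
  have gm: "g n \<in> borel_measurable \<mu>" for n
    by (intro measurable_of_restrict_borel[OF sets_mu] borel_measurable_continuous_onI g)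
  have gX: "g n \<in> borel_measurable BX" for n using gm by (simp add: measurable_mu)
  have fi: "integrable \<mu> f" using f(2) fm by (intro integrable_const_bound[of _ C]) (auto simp: space_mu)
  have gi: "integrable \<mu> (g n)" for n using g(2) gm by (intro integrable_const_bound[of _ C]) auto
  have dist0: "(\<lambda>n. \<integral>x. \<bar>f x - g n x\<bar> \<partial>\<mu>) \<longlonglongrightarrow> 0"
    by (rule tendsto_sandwich[of "\<lambda>_. 0" _ _ "\<lambda>n. inverse (real (Suc n))"])
      (use g(3) LIMSEQ_inverse_real_of_nat in \<open>auto intro!: always_eventually less_imp_le\<close>)
  have mean_lim: "(\<lambda>n. \<bar>\<integral>x. g n x \<partial>\<mu>\<bar>) \<longlonglongrightarrow> 0"
  proof (rule tendsto_sandwich[OF _ _ tendsto_const dist0])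
    show "\<forall>\<^sub>F n in sequentially. \<bar>\<integral>x. g n x \<partial>\<mu>\<bar> \<le> (\<integral>x. \<bar>f x - g n x\<bar> \<partial>\<mu>)"
    proof (rule always_eventually, rule allI)
      fix n
      have "\<bar>\<integral>x. g n x \<partial>\<mu>\<bar> = \<bar>\<integral>x. f x - g n x \<partial>\<mu>\<bar>" using fi gi mean by simp
      also have "\<dots> \<le> (\<integral>x. \<bar>f x - g n x\<bar> \<partial>\<mu>)" by (rule integral_abs_bound)
      finally show "\<bar>\<integral>x. g n x \<partial>\<mu>\<bar> \<le> (\<integral>x. \<bar>f x - g n x\<bar> \<partial>\<mu>)" .
    qed
  qed simp
  have f2: "integrable \<mu> (\<lambda>x. (f x)\<^sup>2)"
    using L2_square_integrable[OF L2_bounded[OF finite_measure_axioms fm, where C=C]] f(2) by (simp add: space_mu)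
  have g2: "integrable \<mu> (\<lambda>x. (g n x)\<^sup>2)" for n
    using L2_square_integrable[OF L2_bounded[OF finite_measure_axioms gm, where C=C]] g(2) by simp
  have square_lim: "(\<lambda>n. \<integral>x. (g n x)\<^sup>2 \<partial>\<mu>) \<longlonglongrightarrow> (\<integral>x. (f x)\<^sup>2 \<partial>\<mu>)"
  proof (rule LIM_zero_cancel, rule Lim_null_comparison)
    show "\<forall>\<^sub>F n in sequentially. norm ((\<integral>x. (g n x)\<^sup>2 \<partial>\<mu>) - (\<integral>x. (f x)\<^sup>2 \<partial>\<mu>)) \<le> 2 * C * (\<integral>x. \<bar>f x - g n x\<bar> \<partial>\<mu>)"
    proof (rule always_eventually, rule allI)
      fix n
      have "norm ((\<integral>x. (g n x)\<^sup>2 \<partial>\<mu>) - (\<integral>x. (f x)\<^sup>2 \<partial>\<mu>)) = \<bar>\<integral>x. (g n x)\<^sup>2 - (f x)\<^sup>2 \<partial>\<mu>\<bar>"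
        using f2 g2 by simp
      also have "\<dots> \<le> (\<integral>x. \<bar>(g n x)\<^sup>2 - (f x)\<^sup>2\<bar> \<partial>\<mu>)" by (rule integral_abs_bound)
      also have "\<dots> \<le> (\<integral>x. 2 * C * \<bar>f x - g n x\<bar> \<partial>\<mu>)"
      proof (rule integral_mono)
        fix x assume "x \<in> space \<mu>"
        then have "\<bar>f x + g n x\<bar> \<le> 2 * C" using f(2)[of x] g(2)[of n x] by (simp add: space_mu)
        from mult_right_mono[OF this, of "\<bar>f x - g n x\<bar>"]
        show "\<bar>(g n x)\<^sup>2 - (f x)\<^sup>2\<bar> \<le> 2 * C * \<bar>f x - g n x\<bar>"
          by (simp add: abs_mult[symmetric] power2_eq_square algebra_simps abs_minus_commute)
      qed (use f2 g2 fi gi in auto)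
      finally show "norm ((\<integral>x. (g n x)\<^sup>2 \<partial>\<mu>) - (\<integral>x. (f x)\<^sup>2 \<partial>\<mu>)) \<le> 2 * C * (\<integral>x. \<bar>f x - g n x\<bar> \<partial>\<mu>)" by simp
    qed
    show "(\<lambda>n. 2 * C * (\<integral>x. \<bar>f x - g n x\<bar> \<partial>\<mu>)) \<longlonglongrightarrow> 0"
      using tendsto_mult[OF tendsto_const[of "2 * C"] dist0] by simp
  qed
  define I where "I h \<omega> = (LINT s:{0..T}|lborel. h (\<xi> s \<omega>))" for h :: "'x \<Rightarrow> real" and \<omega>
  have Im: "I h \<in> borel_measurable P\<mu>" if "h \<in> borel_measurable BX" for h
    unfolding I_def[abs_def] by (rule occupation_integral_measurable[OF cadlag_stationary that])
  have Ib: "\<bar>I h \<omega>\<bar> \<le> D * T"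
    if "h \<in> borel_measurable BX" "\<And>x. x \<in> X \<Longrightarrow> \<bar>h x\<bar> \<le> D" "\<omega> \<in> space P\<mu>" for h \<omega> D
    unfolding I_def by (rule occupation_integral_bound[where f=h, OF cadlag_stationary that(3,2) T])
  have Ii: "integrable P\<mu> (I h)"
    if "h \<in> borel_measurable BX" "\<And>x. x \<in> X \<Longrightarrow> \<bar>h x\<bar> \<le> D" for h D
    using Im[OF that(1)] Ib[OF that] by (intro S.integrable_const_bound[of _ "D * T"] AE_I2) auto
  have Ie: "integrable P\<mu> (\<lambda>\<omega>. exp (I h \<omega>))"
    if "h \<in> borel_measurable BX" "\<And>x. x \<in> X \<Longrightarrow> \<bar>h x\<bar> \<le> D" for h D
    unfolding I_def by (rule exp_occupation_integral_integrable[OF that T])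
  define b where "b n = (1 - \<epsilon>) powr (- 1 / 2) * exp (T * (\<bar>\<integral>x. g n x \<partial>\<mu>\<bar> +
      (2 + \<epsilon>)\<^sup>2 * (\<integral>x. (g n x)\<^sup>2 \<partial>\<mu>) / (4 * (\<Lambda> - (1 + \<epsilon>) * C))))" for n
  have approx: "(\<integral>\<omega>. exp (I f \<omega>) \<partial>P\<mu>) \<le> b n + exp (C * T) * (T * (\<integral>x. \<bar>f x - g n x\<bar> \<partial>\<mu>))" for n
  proof -
    interpret feynman_kac \<Omega> X \<xi> Pr \<mu> "g n" C by unfold_locales (use g in auto)
    have gb: "(\<integral>\<omega>. exp (I (g n) \<omega>) \<partial>P\<mu>) \<le> b n"
      unfolding I_def b_def by (rule exponential_moment_continuous[OF form T hypo gap])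
    let ?d = "\<lambda>x. \<bar>f x - g n x\<bar>"
    have d: "?d \<in> borel_measurable BX" "\<And>x. x \<in> X \<Longrightarrow> \<bar>?d x\<bar> \<le> 2 * C"
    proof -
      show "?d \<in> borel_measurable BX" using f(1) gX by measurable
      show "\<bar>?d x\<bar> \<le> 2 * C" if "x \<in> X" for x using f(2)[OF that] g(2)[of n x] by linarith
    qed
    have "(\<integral>\<omega>. exp (I f \<omega>) - exp (I (g n) \<omega>) \<partial>P\<mu>) \<le> (\<integral>\<omega>. exp (C * T) * I ?d \<omega> \<partial>P\<mu>)"
    proof (rule integral_mono)
      show "integrable P\<mu> (\<lambda>\<omega>. exp (I f \<omega>) - exp (I (g n) \<omega>))"
        using Ie[OF f] Ie[OF gX g(2)] by (intro Bochner_Integration.integrable_diff)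
      show "integrable P\<mu> (\<lambda>\<omega>. exp (C * T) * I ?d \<omega>)"
        using Ii[OF d] by (intro integrable_mult_right)
      fix \<omega> assume \<omega>: "\<omega> \<in> space P\<mu>"
      note si = occupation_set_integrable[OF cadlag_stationary _ \<omega>]
      have "\<bar>I f \<omega> - I (g n) \<omega>\<bar> = \<bar>LINT s:{0..T}|lborel. f (\<xi> s \<omega>) - g n (\<xi> s \<omega>)\<bar>"
        unfolding I_def using si[OF f] si[OF gX g(2)] by (simp add: set_integral_diff)
      also have "\<dots> \<le> I ?d \<omega>"
        unfolding I_def using set_integral_norm_bound[OF set_integral_diff(1)[OF si[OF f] si[OF gX g(2)]]]
        by simp
      finally have "\<bar>I f \<omega> - I (g n) \<omega>\<bar> \<le> I ?d \<omega>" .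
      then have "exp (C * T) * \<bar>I f \<omega> - I (g n) \<omega>\<bar> \<le> exp (C * T) * I ?d \<omega>" by (intro mult_left_mono) auto
      moreover have "\<bar>exp (I f \<omega>) - exp (I (g n) \<omega>)\<bar> \<le> exp (C * T) * \<bar>I f \<omega> - I (g n) \<omega>\<bar>"
        using Ib[OF f \<omega>] Ib[OF gX g(2) \<omega>] by (intro exp_diff_le) (auto simp: abs_le_iff)
      ultimately show "exp (I f \<omega>) - exp (I (g n) \<omega>) \<le> exp (C * T) * I ?d \<omega>" by linarith
    qed
    also have "\<dots> = exp (C * T) * (T * (\<integral>x. ?d x \<partial>\<mu>))"
      using stationary_occupation_integral[OF d T] by (simp add: I_def)
    finally show ?thesis using gb Ie[OF f] Ie[OF gX g(2)] by simp
  qed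
  have "(\<lambda>n. b n + exp (C * T) * (T * (\<integral>x. \<bar>f x - g n x\<bar> \<partial>\<mu>))) \<longlonglongrightarrow>
      (1 - \<epsilon>) powr (- 1 / 2) * exp (T * (0 + (2 + \<epsilon>)\<^sup>2 * (\<integral>x. (f x)\<^sup>2 \<partial>\<mu>) / (4 * (\<Lambda> - (1 + \<epsilon>) * C))))
      + exp (C * T) * (T * 0)"
    unfolding b_def using gap by (intro tendsto_intros mean_lim square_lim dist0) auto
  from LIMSEQ_le_const[OF this] approx have "(\<integral>\<omega>. exp (I f \<omega>) \<partial>P\<mu>) \<le>
      (1 - \<epsilon>) powr (- 1 / 2) * exp (T * (0 + (2 + \<epsilon>)\<^sup>2 * (\<integral>x. (f x)\<^sup>2 \<partial>\<mu>) / (4 * (\<Lambda> - (1 + \<epsilon>) * C))))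
      + exp (C * T) * (T * 0)" by blast
  then show ?thesis by (simp add: I_def)
qed

section \<open>Relative entropy on path space\<close>

text \<open>With \<open>D = dQ1/dQ2\<close> and \<open>Z = \<integral> exp Y dQ2\<close>, integrate the inequality
\<open>ln (exp Y / (D * Z)) \<le> exp Y / (D * Z) - 1\<close> against \<open>Q1\<close>: the left-hand side becomes
\<open>\<integral> Y dQ1 - R - ln Z\<close>, and the right-hand side becomes at most \<open>0\<close>.\<close>
lemma Donsker_Varadhan:
  assumes p1: "prob_space Q1" and p2: "prob_space Q2" and sets: "sets Q1 = sets Q2"
    and fin: "rel_entropy Q1 Q2 < \<infinity>"
    and Y: "Y \<in> borel_measurable Q2" "\<And>w. w \<in> space Q2 \<Longrightarrow> \<bar>Y w\<bar> \<le> C"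
  shows "(\<integral>w. Y w \<partial>Q1) \<le> ln (\<integral>w. exp (Y w) \<partial>Q2) + real_of_ereal (rel_entropy Q1 Q2)"
proof -
  interpret Q1: prob_space Q1 by fact
  interpret Q2: prob_space Q2 by fact
  have sp: "space Q1 = space Q2" by (rule sets_eq_imp_space_eq[OF sets])
  have Y1: "Y \<in> borel_measurable Q1" using Y(1) measurable_cong_sets[OF sets refl] by blast
  note [measurable] = Y(1) Y1
  have ac: "absolutely_continuous Q2 Q1" and ie: "integrable Q1 (entropy_density (exp 1) Q2 Q1)"
    and R: "real_of_ereal (rel_entropy Q1 Q2) = KL_divergence (exp 1) Q2 Q1"
    using fin by (auto simp: rel_entropy_def split: if_splits)
  obtain D where D: "D \<in> borel_measurable Q2" "AE x in Q2. RN_deriv Q2 Q1 x = ennreal (D x)"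
    "AE x in Q1. 0 < D x" "\<And>x. 0 \<le> D x"
    using Q2.real_RN_deriv[OF _ ac sets] by (metis Q1.finite_measure_axioms)
  note [measurable] = D(1)
  have D1[measurable]: "D \<in> borel_measurable Q1" using D(1) measurable_cong_sets[OF sets refl] by blast
  have Q1: "Q1 = density Q2 (\<lambda>x. ennreal (D x))"
    using Q2.density_RN_deriv[OF ac sets] density_cong[OF _ _ D(2)] by simp
  define Z where "Z = (\<integral>w. exp (Y w) \<partial>Q2)"
  have ey: "integrable Q2 (\<lambda>w. exp (Y w))"
  proof (rule Q2.integrable_const_bound[of _ "exp C"])
    show "AE x in Q2. norm (exp (Y x)) \<le> exp C" using Y(2) by (intro AE_I2) (auto simp: abs_le_iff)
  qed measurable
  have Z0: "0 < Z" unfolding Z_def by (rule Q2.expectation_greater[OF ey]) simp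
  let ?W = "\<lambda>w. exp (Y w) / D w"
  have "(\<integral>\<^sup>+w. ennreal (?W w) \<partial>Q1) = (\<integral>\<^sup>+w. ennreal (D w) * ennreal (?W w) \<partial>Q2)"
    unfolding Q1 by (intro nn_integral_density) auto
  also have "\<dots> \<le> (\<integral>\<^sup>+w. ennreal (exp (Y w)) \<partial>Q2)"
    using D(4) by (intro nn_integral_mono) (auto simp: ennreal_mult[symmetric] intro!: ennreal_leI)
  also have "\<dots> = ennreal Z" unfolding Z_def by (rule nn_integral_eq_integral[OF ey]) auto
  finally have W: "(\<integral>\<^sup>+w. ennreal (?W w) \<partial>Q1) \<le> ennreal Z" .
  have Wi: "integrable Q1 ?W"
    using D(4) le_less_trans[OF W, of \<infinity>] by (intro integrableI_nonneg) auto
  have WZ: "(\<integral>w. ?W w \<partial>Q1) \<le> Z"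
    using W Z0 D(4) nn_integral_eq_integral[OF Wi] by (auto simp: ennreal_le_iff)
  have Yi: "integrable Q1 Y" using Y(2) sp by (intro Q1.integrable_const_bound[of _ C]) auto
  have "AE x in Q1. RN_deriv Q2 Q1 x = ennreal (D x)"
    using absolutely_continuous_AE[OF sets ac D(2)] .
  then have ed: "AE w in Q1. entropy_density (exp 1) Q2 Q1 w = ln (D w)"
    by eventually_elim (simp add: entropy_density_def log_def D(4))
  have "(\<integral>w. Y w - entropy_density (exp 1) Q2 Q1 w - ln Z \<partial>Q1) \<le> (\<integral>w. ?W w / Z - 1 \<partial>Q1)"
  proof (rule integral_mono_AE)
    show "AE w in Q1. Y w - entropy_density (exp 1) Q2 Q1 w - ln Z \<le> ?W w / Z - 1"
      using ed D(3)
    proof eventually_elim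
      case (elim w)
      have "ln (?W w / Z) \<le> ?W w / Z - 1" using elim Z0 by (intro ln_le_minus_one) auto
      moreover have "ln (?W w / Z) = Y w - ln (D w) - ln Z"
        using elim Z0 by (simp add: ln_div ln_mult)
      ultimately show ?case using elim by simp
    qed
    show "integrable Q1 (\<lambda>w. ?W w / Z - 1)"
      by (intro Bochner_Integration.integrable_diff integrable_divide Wi) simp
  qed (use Yi ie in auto)
  also have "\<dots> = (\<integral>w. ?W w \<partial>Q1) / Z - 1"
    by (subst Bochner_Integration.integral_diff)
      (simp_all only: integral_divide_zero integrable_divide Wi integrable_const Q1.finite_measure_axioms, simp_all add: Q1.prob_space)
  also have "\<dots> \<le> 0" using WZ Z0 by (simp add: divide_le_eq)
  finally have "(\<integral>w. Y w \<partial>Q1) - KL_divergence (exp 1) Q2 Q1 - ln Z \<le> 0"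
    using Yi ie by (simp add: KL_divergence_def Q1.prob_space)
  then show ?thesis by (simp add: R Z_def)
qed


definition path_map :: "real \<Rightarrow> (real \<Rightarrow> 'w \<Rightarrow> 'x) \<Rightarrow> 'w \<Rightarrow> real \<Rightarrow> 'x" where
  "path_map T \<zeta> \<omega> = (\<lambda>t\<in>{0..T}. \<zeta> t \<omega>)"

lemma path_law_eq_distr: "path_law N X \<zeta> T = distr N (path_space X T) (path_map T \<zeta>)"
  by (simp add: path_law_def path_map_def[abs_def])

lemma cadlag_on_restrict:
  assumes "cadlag_on {0..} X w"
  shows "cadlag_on {0..T} X (\<lambda>t\<in>{0..T}. w t)"
  unfolding cadlag_on_def
proof (intro conjI ballI)
  fix t assume t: "t \<in> {0..T}"
  let ?v = "\<lambda>t\<in>{0..T}. w t"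
  have w: "w t \<in> X" "(w \<longlongrightarrow> w t) (at t within ({0..} \<inter> {t..}))"
    "\<exists>l\<in>X. (w \<longlongrightarrow> l) (at t within ({0..} \<inter> {..<t}))"
    using assms t by (auto simp: cadlag_on_def)
  have transfer: "(?v \<longlongrightarrow> l) (at t within ({0..T} \<inter> S))" if "(w \<longlongrightarrow> l) (at t within ({0..} \<inter> S))" for l S
  proof (rule Lim_transform_eventually)
    show "(w \<longlongrightarrow> l) (at t within ({0..T} \<inter> S))"
      by (rule tendsto_within_subset[OF that]) auto
    show "\<forall>\<^sub>F s in at t within ({0..T} \<inter> S). w s = ?v s"
      by (auto simp: eventually_at_filter)
  qed
  show "?v t \<in> X" using w(1) t by simp
  show "(?v \<longlongrightarrow> ?v t) (at t within ({0..T} \<inter> {t..}))"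
    using transfer[OF w(2)] t by simp
  show "\<exists>l\<in>X. (?v \<longlongrightarrow> l) (at t within ({0..T} \<inter> {..<t}))"
    using w(3) transfer by blast
qed

lemma path_map_measurable:
  assumes "cadlag_process N X \<zeta>"
  shows "path_map T \<zeta> \<in> N \<rightarrow>\<^sub>M path_space X T"
  unfolding path_space_def path_map_def[abs_def]
proof (rule measurable_restrict_space2)
  show "(\<lambda>\<omega>. \<lambda>t\<in>{0..T}. \<zeta> t \<omega>) \<in> space N \<rightarrow> {w. cadlag_on {0..T} X w}"
    using assms by (auto simp: cadlag_process_def intro: cadlag_on_restrict)
  show "(\<lambda>\<omega>. \<lambda>t\<in>{0..T}. \<zeta> t \<omega>) \<in> N \<rightarrow>\<^sub>M PiM {0..T} (\<lambda>_. restrict_space borel X)"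
    using assms by (intro measurable_restrict) (auto simp: cadlag_process_def)
qed

text \<open>The \<open>\<sigma>\<close>-algebra of the path space is generated by the evaluations, so the measurability of the
occupation integral comes from the right-continuity of the paths; clamping the time to \<open>{0..T}\<close> makes
the paths right-continuous on the real line.\<close>
lemma path_occupation_integral_measurable:
  fixes X :: "'x::metric_space set" and f :: "'x \<Rightarrow> real"
  assumes f: "f \<in> borel_measurable (restrict_space borel X)" and T: "0 \<le> T"
  shows "(\<lambda>w. LINT s:{0..T}|lborel. f (w s)) \<in> borel_measurable (path_space X T)"
proof -
  let ?c = "\<lambda>s. min T (max 0 s)"
  have c: "?c s \<in> {0..T}" for s using T by auto
  have cad: "cadlag_on {0..T} X w" if "w \<in> space (path_space X T)" for w
    using that by (simp add: path_space_def space_restrict_space)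
  have coord: "(\<lambda>w. w t) \<in> path_space X T \<rightarrow>\<^sub>M restrict_space borel X" if "t \<in> {0..T}" for t
    unfolding path_space_def
    by (rule measurable_restrict_space1[OF measurable_component_singleton[OF that, of "\<lambda>_. restrict_space borel X"]])
  have idm: "(\<lambda>x. x) \<in> restrict_space borel X \<rightarrow>\<^sub>M borel" by (rule measurable_restrict_space1) simp
  have "(\<lambda>(s, w). w (?c s)) \<in> borel_measurable (borel \<Otimes>\<^sub>M path_space X T)"
  proof (rule right_continuous_jointly_measurable)
    show "(\<lambda>w. w (?c s)) \<in> borel_measurable (path_space X T)" for s
      by (rule measurable_compose[OF coord[OF c] idm])
    fix w s assume w: "w \<in> space (path_space X T)"
    consider "s < 0" | "0 \<le> s" "s < T" | "T \<le> s" by linarith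
    then show "((\<lambda>r. w (?c r)) \<longlongrightarrow> w (?c s)) (at_right s)"
    proof cases
      case 1
      then show ?thesis by (intro tendsto_eventually eventually_at_rightI[of s 0]) auto
    next
      case 2
      have "{0..T} \<inter> {s..} = {s..T}" using 2 by auto
      then have "(w \<longlongrightarrow> w s) (at_right s)"
        using cadlag_right_limit(1)[OF cad[OF w], of s] 2 by (simp add: at_within_Icc_at_right)
      moreover have "\<forall>\<^sub>F r in at_right s. w r = w (?c r)"
        using 2 by (intro eventually_at_rightI[of s T]) auto
      ultimately have "((\<lambda>r. w (?c r)) \<longlongrightarrow> w s) (at_right s)" by (rule Lim_transform_eventually)
      then show ?thesis using 2 by simp
    next
      case 3
      then show ?thesis by (intro tendsto_eventually eventually_at_rightI[of s "s + 1"]) auto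
    qed
  qed
  then have "(\<lambda>(s, w). w (?c s)) \<in> borel \<Otimes>\<^sub>M path_space X T \<rightarrow>\<^sub>M restrict_space borel X"
    using cadlag_right_limit(2)[OF cad c]
    by (intro measurable_restrict_space2) (auto simp: space_pair_measure)
  from measurable_compose[OF this f]
  have "(\<lambda>(s, w). f (w (?c s))) \<in> borel_measurable (borel \<Otimes>\<^sub>M path_space X T)"
    by (simp add: case_prod_beta')
  from set_integral_jointly_measurable[OF this atLeastAtMost_borel[of 0 T]]
  have "(\<lambda>w. LINT s:{0..T}|lborel. f (w (?c s))) \<in> borel_measurable (path_space X T)" .
  moreover have "(LINT s:{0..T}|lborel. f (w (?c s))) = (LINT s:{0..T}|lborel. f (w s))" for w
    by (rule set_lebesgue_integral_cong) (auto simp: max_def min_def)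
  ultimately show ?thesis by simp
qed

lemma path_law_occupation_integral:
  fixes X :: "'x::metric_space set" and f :: "'x \<Rightarrow> real" and \<phi> :: "real \<Rightarrow> real"
  assumes proc: "cadlag_process N X \<zeta>" and f: "f \<in> borel_measurable (restrict_space borel X)"
    and T: "0 \<le> T" and \<phi>: "\<phi> \<in> borel_measurable borel"
  shows "(\<integral>w. \<phi> (LINT s:{0..T}|lborel. f (w s)) \<partial>path_law N X \<zeta> T)
    = (\<integral>\<omega>. \<phi> (LINT s:{0..T}|lborel. f (\<zeta> s \<omega>)) \<partial>N)"
proof -
  have "(\<lambda>w. \<phi> (LINT s:{0..T}|lborel. f (w s))) \<in> borel_measurable (path_space X T)"
    by (rule measurable_compose[OF path_occupation_integral_measurable[OF f T] \<phi>])
  from integral_distr[OF path_map_measurable[OF proc] this]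
  have "(\<integral>w. \<phi> (LINT s:{0..T}|lborel. f (w s)) \<partial>path_law N X \<zeta> T)
      = (\<integral>\<omega>. \<phi> (LINT s:{0..T}|lborel. f (path_map T \<zeta> \<omega> s)) \<partial>N)"
    by (simp add: path_law_eq_distr)
  moreover have "(LINT s:{0..T}|lborel. f (path_map T \<zeta> \<omega> s)) = (LINT s:{0..T}|lborel. f (\<zeta> s \<omega>))" for \<omega>
    by (rule set_lebesgue_integral_cong) (auto simp: path_map_def)
  ultimately show ?thesis by simp
qed

lemma occupation_entropy_inequality:
  fixes X :: "'x::metric_space set" and f :: "'x \<Rightarrow> real"
  assumes N: "prob_space N" "cadlag_process N X \<zeta>" and N': "prob_space N'" "cadlag_process N' X \<zeta>'"
    and fin: "rel_entropy (path_law N' X \<zeta>' T) (path_law N X \<zeta> T) < \<infinity>"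
    and f: "f \<in> borel_measurable (restrict_space borel X)" "\<And>x. x \<in> X \<Longrightarrow> \<bar>f x\<bar> \<le> C"
    and T: "0 \<le> T"
  shows "(\<integral>\<omega>. (LINT s:{0..T}|lborel. f (\<zeta>' s \<omega>)) \<partial>N')
    \<le> ln (\<integral>\<omega>. exp (LINT s:{0..T}|lborel. f (\<zeta> s \<omega>)) \<partial>N)
      + real_of_ereal (rel_entropy (path_law N' X \<zeta>' T) (path_law N X \<zeta> T))"
proof -
  have "(\<integral>w. (LINT s:{0..T}|lborel. f (w s)) \<partial>path_law N' X \<zeta>' T)
    \<le> ln (\<integral>w. exp (LINT s:{0..T}|lborel. f (w s)) \<partial>path_law N X \<zeta> T)
      + real_of_ereal (rel_entropy (path_law N' X \<zeta>' T) (path_law N X \<zeta> T))"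
  proof (rule Donsker_Varadhan[OF _ _ _ fin])
    show "prob_space (path_law N' X \<zeta>' T)" "prob_space (path_law N X \<zeta> T)"
      unfolding path_law_eq_distr
      by (rule prob_space.prob_space_distr[OF N'(1) path_map_measurable[OF N'(2)]]
          prob_space.prob_space_distr[OF N(1) path_map_measurable[OF N(2)]])+
    show "sets (path_law N' X \<zeta>' T) = sets (path_law N X \<zeta> T)" by (simp add: path_law_eq_distr)
    show "(\<lambda>w. LINT s:{0..T}|lborel. f (w s)) \<in> borel_measurable (path_law N X \<zeta> T)"
      using path_occupation_integral_measurable[OF f(1) T] by (simp add: path_law_eq_distr)
    fix w assume "w \<in> space (path_law N X \<zeta> T)"
    then have w: "w \<in> space (path_space X T)" by (simp add: path_law_eq_distr)
    then have cad: "cadlag_on {0..T} X w" by (simp add: path_space_def space_restrict_space)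
    show "\<bar>LINT s:{0..T}|lborel. f (w s)\<bar> \<le> C * T"
      using abs_set_integral_le[of 0 T "\<lambda>s. f (w s)" C] f(2) cadlag_right_limit(2)[OF cad] T by simp
  qed
  then show ?thesis
    using path_law_occupation_integral[OF N'(2) f(1) T, of "\<lambda>x. x"]
      path_law_occupation_integral[OF N(2) f(1) T, of exp] by simp
qed

section \<open>The deviation bound\<close>

text \<open>With \<open>1 / c = b + s\<close> the assumption becomes \<open>x \<le> v / (2 * s) + s * \<eta> + b * \<eta>\<close> for every \<open>s > 0\<close>, and the
minimum over \<open>s\<close> of the first two terms is \<open>sqrt (2 * v * \<eta>)\<close>.\<close>
lemma Legendre_optimisation:
  fixes x v b \<eta> :: real
  assumes v: "0 \<le> v" and b: "0 \<le> b" and \<eta>: "0 < \<eta>"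
    and bound: "\<And>c. 0 < c \<Longrightarrow> c * b < 1 \<Longrightarrow> c * x \<le> c\<^sup>2 * v / (2 * (1 - c * b)) + \<eta>"
  shows "x \<le> sqrt (2 * v * \<eta>) + b * \<eta>"
proof -
  have key: "x \<le> v / (2 * s) + s * \<eta> + b * \<eta>" if s: "0 < s" for s
  proof -
    define c where "c = 1 / (b + s)"
    have c: "0 < c" "c * b < 1" "1 - c * b = s * c" using b s by (simp_all add: c_def field_simps)
    have "c * x \<le> c\<^sup>2 * v / (2 * (s * c)) + \<eta>" using bound[OF c(1,2)] c(3) by simp
    also have "\<dots> = c * (v / (2 * s)) + \<eta>" using c(1) s by (simp add: power2_eq_square field_simps)
    also have "\<eta> = c * ((s + b) * \<eta>)" using b s by (simp add: c_def field_simps)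
    finally have "c * x \<le> c * (v / (2 * s) + (s + b) * \<eta>)" by (simp add: algebra_simps)
    then have "x \<le> v / (2 * s) + (s + b) * \<eta>" using c(1) by (simp only: mult_le_cancel_left_pos)
    then show ?thesis by (simp add: algebra_simps)
  qed
  show ?thesis
  proof (cases "v = 0")
    case True
    have "x \<le> b * \<eta> + e" if "0 < e" for e
      using key[of "e / \<eta>"] that \<eta> True by (simp add: field_simps)
    then show ?thesis using True by (auto intro: field_le_epsilon)
  next
    case False
    with v have v: "0 < v" by simp
    define s where "s = sqrt (v / (2 * \<eta>))"
    have s: "0 < s" "s\<^sup>2 = v / (2 * \<eta>)" using v \<eta> by (simp_all add: s_def)
    have "v = 2 * \<eta> * s\<^sup>2" using s(2) \<eta> by simp
    then have "v / (2 * s) + s * \<eta> = 2 * (\<eta> * s)" using s(1) by (simp add: power2_eq_square field_simps)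
    also have "\<dots> = sqrt ((2 * (\<eta> * s))\<^sup>2)"
      unfolding real_sqrt_abs using s(1) \<eta> by simp
    also have "(2 * (\<eta> * s))\<^sup>2 = 2 * v * \<eta>"
      using s(2) \<eta> by (simp add: power_mult_distrib) (simp add: power2_eq_square)
    finally show ?thesis using key[OF s(1)] by simp
  qed
qed

text \<open>\<open>Lam\<close> is the smaller eigenvalue of a symmetric \<open>2 \<times> 2\<close> matrix; the smallness of \<open>\<epsilon>\<close> says that its
determinant is positive and implies that its trace is positive.\<close>
lemma Lam_pos:
  assumes "0 < l\<^sub>q" "0 < l\<^sub>p" "0 < R\<^sub>0" "0 < \<epsilon>" "\<epsilon> < 4 * l\<^sub>q * l\<^sub>p / (4 * l\<^sub>q + R\<^sub>0\<^sup>2)"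
  shows "0 < Lam l\<^sub>q l\<^sub>p R\<^sub>0 \<epsilon>"
proof -
  let ?tr = "(l\<^sub>q - 1) * \<epsilon> + l\<^sub>p"
  let ?disc = "((l\<^sub>q + 1) * \<epsilon> - l\<^sub>p)\<^sup>2 + \<epsilon>\<^sup>2 * R\<^sub>0\<^sup>2"
  have den: "0 < 4 * l\<^sub>q + R\<^sub>0\<^sup>2" using assms by (simp add: add_pos_pos)
  have h: "\<epsilon> * (4 * l\<^sub>q + R\<^sub>0\<^sup>2) < 4 * l\<^sub>q * l\<^sub>p" using assms(5) den by (simp add: pos_less_divide_eq)
  then have det: "0 < \<epsilon> * (4 * l\<^sub>q * l\<^sub>p - \<epsilon> * (4 * l\<^sub>q + R\<^sub>0\<^sup>2))" using assms(4) by simp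
  have "?tr\<^sup>2 - ?disc = \<epsilon> * (4 * l\<^sub>q * l\<^sub>p - \<epsilon> * (4 * l\<^sub>q + R\<^sub>0\<^sup>2))"
    by (simp add: power2_eq_square algebra_simps)
  with det have lt: "?disc < ?tr\<^sup>2" by simp
  have "0 \<le> \<epsilon> * R\<^sub>0\<^sup>2" using assms by simp
  with h have "l\<^sub>q * \<epsilon> < l\<^sub>q * l\<^sub>p" by (simp add: algebra_simps)
  then have "\<epsilon> < l\<^sub>p" using assms(1) by simp
  moreover have "0 < l\<^sub>q * \<epsilon>" using assms by simp
  ultimately have "0 < ?tr" by (simp add: algebra_simps)
  then have "sqrt ?disc < ?tr" using real_sqrt_less_mono[OF lt] by simp
  then show ?thesis by (simp add: Lam_def)
qed

text \<open>The entropy inequality is applied to \<open>c * f\<close> for all \<open>c > 0\<close> with \<open>c * b < 1\<close>, where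
\<open>b = (1 + \<epsilon>) * C / \<Lambda>\<close>; this is exactly the range in which \<open>exponential_moment_bound\<close> applies.
Applied to the zero function it shows that the relative entropy is nonnegative.\<close>
lemma ergodic_average_upper_bound:
  fixes X :: "'x::{complete_space,second_countable_topology} set" and f :: "'x \<Rightarrow> real"
  assumes sm: "stationary_markov \<Omega> X \<xi> Pr \<mu>" and form: "coercive_L2_form \<mu> E \<epsilon>"
    and hypo: "\<And>g h. (g, h) \<in> generator \<mu> (transition \<xi> Pr) \<Longrightarrow> \<Lambda> * Var \<mu> g \<le> E (\<lambda>x. - h x) g"
    and \<Lambda>: "0 < \<Lambda>" and \<epsilon>: "0 < \<epsilon>"
    and N': "prob_space N'" "cadlag_process N' X \<xi>'" and T: "0 < T"
    and fin: "rel_entropy (path_law N' X \<xi>' T) (path_law (\<mu> \<bind> Pr) X \<xi> T) < \<infinity>"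
    and f: "f \<in> borel_measurable (restrict_space borel X)" "\<And>x. x \<in> X \<Longrightarrow> \<bar>f x\<bar> \<le> C"
    and mean: "(\<integral>x. f x \<partial>\<mu>) = 0"
  defines "\<eta> \<equiv> 1 / T * (ln ((1 - \<epsilon>) powr (- 1 / 2)) +
      real_of_ereal (rel_entropy (path_law N' X \<xi>' T) (path_law (\<mu> \<bind> Pr) X \<xi> T)))"
  shows "0 < \<eta>"
    and "1 / T * (\<integral>\<omega>. (LINT s:{0..T}|lborel. f (\<xi>' s \<omega>)) \<partial>N')
      \<le> sqrt (2 * ((2 + \<epsilon>)\<^sup>2 * (\<integral>x. (f x)\<^sup>2 \<partial>\<mu>) / (2 * \<Lambda>)) * \<eta>) + (1 + \<epsilon>) * C / \<Lambda> * \<eta>"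
proof -
  interpret stationary_markov \<Omega> X \<xi> Pr \<mu> by (rule sm)
  interpret F: coercive_L2_form \<mu> E \<epsilon> by (rule form)
  interpret N': prob_space N' by (rule N'(1))
  interpret S: prob_space "P\<mu>" by (rule prob_stationary)
  define R where "R = real_of_ereal (rel_entropy (path_law N' X \<xi>' T) (path_law P\<mu> X \<xi> T))"
  define p where "p = (1 - \<epsilon>) powr (- 1 / 2)"
  note entropy = occupation_entropy_inequality[OF prob_stationary cadlag_stationary N' fin, folded R_def]
  obtain x0 where "x0 \<in> X" using not_empty space_mu by auto
  with f(2)[of x0] have C: "0 \<le> C" by linarith
  have eps: "0 < 1 - \<epsilon>" "1 - \<epsilon> < 1" using F.eps \<epsilon> by auto
  have p: "0 < p" using eps by (simp add: p_def)
  have lnp: "0 < ln p" using eps by (simp add: p_def ln_powr)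
  have "(\<integral>\<omega>. (LINT s:{0..T}|lborel. (\<lambda>_. 0) (\<xi>' s \<omega>)) \<partial>N') \<le>
      ln (\<integral>\<omega>. exp (LINT s:{0..T}|lborel. (\<lambda>_. 0) (\<xi> s \<omega>)) \<partial>P\<mu>) + R"
    by (rule entropy[where C=0]) (use T in auto)
  then have R: "0 \<le> R" by (simp add: S.prob_space set_lebesgue_integral_def)
  show \<eta>: "0 < \<eta>" unfolding \<eta>_def R_def[symmetric] p_def[symmetric] using T R lnp by simp
  define b where "b = (1 + \<epsilon>) * C / \<Lambda>"
  define v where "v = (2 + \<epsilon>)\<^sup>2 * (\<integral>x. (f x)\<^sup>2 \<partial>\<mu>) / (2 * \<Lambda>)"
  have "1 / T * (\<integral>\<omega>. (LINT s:{0..T}|lborel. f (\<xi>' s \<omega>)) \<partial>N') \<le> sqrt (2 * v * \<eta>) + b * \<eta>"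
  proof (rule Legendre_optimisation[OF _ _ \<eta>])
    show "0 \<le> v" "0 \<le> b" using \<Lambda> \<epsilon> C by (simp_all add: v_def b_def)
    fix c :: real assume c: "0 < c" "c * b < 1"
    let ?g = "\<lambda>x. c * f x"
    have g: "?g \<in> borel_measurable BX" "\<And>x. x \<in> X \<Longrightarrow> \<bar>?g x\<bar> \<le> c * C"
      using f c by (auto simp: abs_mult)
    have gap_eq: "\<Lambda> - (1 + \<epsilon>) * (c * C) = \<Lambda> * (1 - c * b)" using \<Lambda> by (simp add: b_def field_simps)
    then have gap: "(1 + \<epsilon>) * (c * C) < \<Lambda>" using c(2) \<Lambda> mult_pos_pos[of \<Lambda> "1 - c * b"] by linarith
    have "(\<integral>\<omega>. exp (LINT s:{0..T}|lborel. ?g (\<xi> s \<omega>)) \<partial>P\<mu>) \<le> p *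
        exp (T * ((2 + \<epsilon>)\<^sup>2 * (\<integral>x. (?g x)\<^sup>2 \<partial>\<mu>) / (4 * (\<Lambda> - (1 + \<epsilon>) * (c * C)))))"
      unfolding p_def using mean
      by (intro exponential_moment_bound[OF sm form less_imp_le[OF T] hypo g _ gap]) simp_all
    also have "(2 + \<epsilon>)\<^sup>2 * (\<integral>x. (?g x)\<^sup>2 \<partial>\<mu>) / (4 * (\<Lambda> - (1 + \<epsilon>) * (c * C))) = c\<^sup>2 * v / (2 * (1 - c * b))"
      unfolding gap_eq using \<Lambda> c(2) by (simp add: v_def power_mult_distrib field_simps)
    finally have mgf: "(\<integral>\<omega>. exp (LINT s:{0..T}|lborel. ?g (\<xi> s \<omega>)) \<partial>P\<mu>)
        \<le> p * exp (T * (c\<^sup>2 * v / (2 * (1 - c * b))))" .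
    have pos: "0 < (\<integral>\<omega>. exp (LINT s:{0..T}|lborel. ?g (\<xi> s \<omega>)) \<partial>P\<mu>)"
      by (intro S.expectation_greater exp_occupation_integral_integrable[OF g less_imp_le[OF T]] AE_I2 exp_gt_zero)
    have "c * (\<integral>\<omega>. (LINT s:{0..T}|lborel. f (\<xi>' s \<omega>)) \<partial>N') = (\<integral>\<omega>. (LINT s:{0..T}|lborel. ?g (\<xi>' s \<omega>)) \<partial>N')"
      by simp
    also have "\<dots> \<le> ln (\<integral>\<omega>. exp (LINT s:{0..T}|lborel. ?g (\<xi> s \<omega>)) \<partial>P\<mu>) + R"
      by (rule entropy[OF g]) (use T in auto)
    also have "\<dots> \<le> ln (p * exp (T * (c\<^sup>2 * v / (2 * (1 - c * b))))) + R"
      using mgf pos by (intro add_right_mono ln_mono) auto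
    also have "\<dots> = T * (c\<^sup>2 * v / (2 * (1 - c * b))) + (ln p + R)" using p by (simp add: ln_mult)
    finally have "1 / T * (c * (\<integral>\<omega>. (LINT s:{0..T}|lborel. f (\<xi>' s \<omega>)) \<partial>N'))
        \<le> 1 / T * (T * (c\<^sup>2 * v / (2 * (1 - c * b))) + (ln p + R))"
      using T by (intro mult_left_mono) auto
    then show "c * (1 / T * (\<integral>\<omega>. (LINT s:{0..T}|lborel. f (\<xi>' s \<omega>)) \<partial>N')) \<le> c\<^sup>2 * v / (2 * (1 - c * b)) + \<eta>"
      using T by (simp add: \<eta>_def R_def p_def algebra_simps add_divide_distrib)
  qed
  then show "1 / T * (\<integral>\<omega>. (LINT s:{0..T}|lborel. f (\<xi>' s \<omega>)) \<partial>N')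
      \<le> sqrt (2 * ((2 + \<epsilon>)\<^sup>2 * (\<integral>x. (f x)\<^sup>2 \<partial>\<mu>) / (2 * \<Lambda>)) * \<eta>) + (1 + \<epsilon>) * C / \<Lambda> * \<eta>"
    by (simp add: v_def b_def)
qed

lemma sets_pair_restrict_space:
  "sets (restrict_space M A \<Otimes>\<^sub>M restrict_space N B) = sets (restrict_space (M \<Otimes>\<^sub>M N) (A \<times> B))"
    (is "sets ?P = sets ?R")
proof
  have space: "space ?P = space ?R" by (auto simp: space_pair_measure space_restrict_space)
  have "(\<lambda>x. (fst x, snd x)) \<in> ?R \<rightarrow>\<^sub>M ?P"
    by (intro measurable_Pair measurable_restrict_space2 measurable_restrict_space1[OF measurable_fst]
        measurable_restrict_space1[OF measurable_snd]) (auto simp: space_restrict_space space_pair_measure)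
  then have R: "(\<lambda>x. x) \<in> ?R \<rightarrow>\<^sub>M ?P" by simp
  have "(\<lambda>x. (fst x, snd x)) \<in> ?P \<rightarrow>\<^sub>M ?R"
    by (intro measurable_restrict_space2 measurable_Pair measurable_compose[OF measurable_fst]
        measurable_compose[OF measurable_snd] measurable_restrict_space1) (auto simp: space_restrict_space space_pair_measure)
  then have P: "(\<lambda>x. x) \<in> ?P \<rightarrow>\<^sub>M ?R" by simp
  show "sets ?P \<subseteq> sets ?R"
    using measurable_sets[OF R] sets.sets_into_space[of _ ?P] space by (force simp: Int_absorb2)
  show "sets ?R \<subseteq> sets ?P"
    using measurable_sets[OF P] sets.sets_into_space[of _ ?R] space by (force simp: Int_absorb2)
qed


theorem theorem1p2:
  fixes Q :: "(real ^ 'd) set" and P :: "'p::euclidean_space set"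
    and \<beta> :: real and V :: "real ^ 'd \<Rightarrow> real"
    and \<nu> :: "(real ^ 'd) measure" and \<rho> :: "'p measure" and \<mu> :: "((real ^ 'd) \<times> 'p) measure"
    and \<Omega> :: "'w measure" and \<xi> :: "real \<Rightarrow> 'w \<Rightarrow> (real ^ 'd) \<times> 'p"
    and Pr :: "(real ^ 'd) \<times> 'p \<Rightarrow> 'w measure"
    and A :: "((real ^ 'd) \<times> 'p) L2_op"
    and B B' :: "((real ^ 'd) \<times> 'p \<Rightarrow> real) \<Rightarrow> ((real ^ 'd) \<times> 'p \<Rightarrow> real)"
    and \<C> :: "((real ^ 'd) \<times> 'p \<Rightarrow> real) set"
    and l\<^sub>q l\<^sub>p R\<^sub>0 \<epsilon> :: real
    and M' :: "'v measure" and \<xi>' :: "real \<Rightarrow> 'v \<Rightarrow> (real ^ 'd) \<times> 'p"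
    and \<mu>' :: "((real ^ 'd) \<times> 'p) measure"
    and T :: real and f :: "(real ^ 'd) \<times> 'p \<Rightarrow> real"
  assumes Polish: "Polish_subset (Q \<times> P)"
    and V: "V \<in> borel_measurable (restrict_space borel Q)"
    and nu: "\<nu> = gibbs_measure Q \<beta> V" "prob_space \<nu>"
    and rho: "sets \<rho> = sets (restrict_space borel P)" "prob_space \<rho>" "centred_nonzero_cov \<rho>"
    and mu: "\<mu> = \<nu> \<Otimes>\<^sub>M \<rho>"
    and baseline: "cadlag_markov_process \<Omega> (Q \<times> P) \<xi> Pr"
    and inv: "invariant_measure \<xi> Pr \<mu>"
    and erg: "ergodic_measure \<xi> Pr \<mu>"
    and semigroup: "strongly_continuous_semigroup \<mu> (transition \<xi> Pr)"
    and A: "A = generator \<mu> (transition \<xi> Pr)"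
    and B: "hypocoercive_B \<mu> \<rho> A B B'"
    and constants: "hypocoercivity_constants \<mu> \<rho> A B \<C> l\<^sub>q l\<^sub>p R\<^sub>0"
    and eps: "0 < \<epsilon>" "\<epsilon> < 1" "\<epsilon> < 4 * l\<^sub>q * l\<^sub>p / (4 * l\<^sub>q + R\<^sub>0\<^sup>2)"
    and hypocoercive:
      "\<And>g h. (g, h) \<in> A \<Longrightarrow>
         modified_inner \<mu> B B' \<epsilon> (\<lambda>x. - h x) g \<ge> Lam l\<^sub>q l\<^sub>p R\<^sub>0 \<epsilon> * Var \<mu> g"
    and alternative: "prob_space M'" "cadlag_process M' (Q \<times> P) \<xi>'"
    and initial: "\<mu>' = distr M' (restrict_space borel (Q \<times> P)) (\<xi>' 0)"
    and T: "0 < T"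
    and entropy: "rel_entropy (path_law M' (Q \<times> P) \<xi>' T) (path_law (\<mu> \<bind> Pr) (Q \<times> P) \<xi> T) < \<infinity>"
    and f: "f \<in> borel_measurable (restrict_space borel (Q \<times> P))" "bounded (f ` (Q \<times> P))"
  shows
    "let \<Lambda> = Lam l\<^sub>q l\<^sub>p R\<^sub>0 \<epsilon>;
         mean = (\<integral>x. f x \<partial>\<mu>);
         f_sup = (SUP x\<in>Q \<times> P. \<bar>f x - mean\<bar>);
         v = (1 + \<epsilon>) * (1 - \<epsilon>\<^sup>2 / 4) / (1 - \<epsilon>) * (2 * Var \<mu> f / \<Lambda>);
         b = (1 + \<epsilon>)\<^sup>2 / (1 - \<epsilon>) * (f_sup / \<Lambda>);
         R = real_of_ereal
               (rel_entropy (path_law M' (Q \<times> P) \<xi>' T) (path_law (\<mu> \<bind> Pr) (Q \<times> P) \<xi> T));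
         \<eta> = 1 / T * (ln ((1 - \<epsilon>) powr (- 1 / 2)) + R)
     in \<bar>(\<integral>\<omega>. 1 / T * (\<integral>t\<in>{0..T}. f (\<xi>' t \<omega>) \<partial>lborel) \<partial>M') - mean\<bar>
          \<le> sqrt (2 * v * \<eta>) + b * \<eta>"
proof -
  define X where "X = Q \<times> P"
  define \<Lambda> where "\<Lambda> = Lam l\<^sub>q l\<^sub>p R\<^sub>0 \<epsilon>"
  define mean where "mean = (\<integral>x. f x \<partial>\<mu>)"
  define K where "K = (SUP x\<in>X. \<bar>f x - mean\<bar>)"
  define R where "R = real_of_ereal (rel_entropy (path_law M' X \<xi>' T) (path_law (\<mu> \<bind> Pr) X \<xi> T))"
  define \<eta> where "\<eta> = 1 / T * (ln ((1 - \<epsilon>) powr (- 1 / 2)) + R)"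
  define v where "v = (1 + \<epsilon>) * (1 - \<epsilon>\<^sup>2 / 4) / (1 - \<epsilon>) * (2 * Var \<mu> f / \<Lambda>)"
  define b where "b = (1 + \<epsilon>)\<^sup>2 / (1 - \<epsilon>) * (K / \<Lambda>)"
  have "sets \<nu> = sets (restrict_space borel Q)"
    unfolding nu(1) gibbs_measure_def Let_def sets_density by (rule sets_restrict_space_cong) simp
  then have "sets \<mu> = sets (restrict_space borel Q \<Otimes>\<^sub>M restrict_space borel P)"
    unfolding mu by (intro sets_pair_measure_cong rho(1))
  then have sets_mu: "sets \<mu> = sets (restrict_space borel X)"
    unfolding sets_pair_restrict_space borel_prod X_def .
  interpret prob_space \<mu> unfolding mu by (rule prob_space_pair[OF nu(2) rho(2)])
  have sm: "stationary_markov \<Omega> X \<xi> Pr \<mu>"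
    by unfold_locales (use baseline sets_mu inv in \<open>auto simp: X_def\<close>)
  interpret stationary_markov \<Omega> X \<xi> Pr \<mu> by (rule sm)
  interpret M': prob_space M' by (rule alternative(1))
  have form: "coercive_L2_form \<mu> (modified_inner \<mu> B B' \<epsilon>) \<epsilon>"
    unfolding mu using eps B by (intro modified_inner_coercive_form[OF nu(2) rho(2), where A=A]) (auto simp: mu)
  have hypo: "\<Lambda> * Var \<mu> g \<le> modified_inner \<mu> B B' \<epsilon> (\<lambda>x. - h x) g"
    if "(g, h) \<in> generator \<mu> (transition \<xi> Pr)" for g h
    using hypocoercive that by (simp add: A \<Lambda>_def)
  have \<Lambda>: "0 < \<Lambda>"
    unfolding \<Lambda>_def using constants eps
    by (intro Lam_pos) (auto simp: hypocoercivity_constants_def Let_def)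
  have proc: "cadlag_process M' X \<xi>'" using alternative(2) by (simp add: X_def)
  have fin: "rel_entropy (path_law M' X \<xi>' T) (path_law (\<mu> \<bind> Pr) X \<xi> T) < \<infinity>"
    using entropy by (simp add: X_def)
  have fm: "f \<in> borel_measurable BX" using f(1) by (simp add: X_def)
  obtain D where D: "\<And>x. x \<in> X \<Longrightarrow> \<bar>f x\<bar> \<le> D" using f(2) by (auto simp: bounded_iff X_def)
  have K: "\<bar>f x - mean\<bar> \<le> K" if "x \<in> X" for x
    unfolding K_def
  proof (rule cSUP_upper[OF that])
    have "\<bar>f y - mean\<bar> \<le> D + \<bar>mean\<bar>" if "y \<in> X" for y using D[OF that] by linarith
    then show "bdd_above ((\<lambda>x. \<bar>f x - mean\<bar>) ` X)" by (auto intro!: bdd_aboveI)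
  qed
  obtain x0 where "x0 \<in> X" using not_empty space_mu by auto
  with K[of x0] have K0: "0 \<le> K" by linarith
  have fmu: "f \<in> borel_measurable \<mu>" using fm by (simp add: measurable_mu)
  have fi: "integrable \<mu> f" using D fmu by (intro integrable_const_bound[of _ D]) (auto simp: space_mu)
  have Var: "Var \<mu> f = (\<integral>x. (f x - mean)\<^sup>2 \<partial>\<mu>)" by (simp add: Var_def mean_def)
  then have Var0: "0 \<le> Var \<mu> f" by simp
  let ?v = "(2 + \<epsilon>)\<^sup>2 * Var \<mu> f / (2 * \<Lambda>)" and ?b = "(1 + \<epsilon>) * K / \<Lambda>"
  have Var': "Var \<mu> f = (\<integral>x. (mean - f x)\<^sup>2 \<partial>\<mu>)"
    unfolding Var by (intro Bochner_Integration.integral_cong refl power2_commute)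
  have centred: "(\<integral>x. f x - mean \<partial>\<mu>) = 0" "(\<integral>x. mean - f x \<partial>\<mu>) = 0"
    using fi by (simp_all add: mean_def prob_space)
  have dev: "(\<lambda>x. f x - mean) \<in> borel_measurable BX" "(\<lambda>x. mean - f x) \<in> borel_measurable BX"
    using fm by simp_all
  have K': "\<bar>mean - f x\<bar> \<le> K" if "x \<in> X" for x using K[OF that] by (simp add: abs_minus_commute)
  note bound = ergodic_average_upper_bound[OF sm form hypo \<Lambda> eps(1) alternative(1) proc T fin, folded R_def, folded \<eta>_def]
  have \<eta>: "0 < \<eta>" by (rule bound(1)[OF _ dev(1) K centred(1)])
  have upper: "1 / T * (\<integral>\<omega>. (LINT s:{0..T}|lborel. f (\<xi>' s \<omega>) - mean) \<partial>M') \<le> sqrt (2 * ?v * \<eta>) + ?b * \<eta>"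
    unfolding Var by (rule bound(2)[OF _ dev(1) K centred(1)])
  \<comment> \<open>the same one-sided bound for \<open>- f\<close>\<close>
  have lower: "1 / T * (\<integral>\<omega>. (LINT s:{0..T}|lborel. mean - f (\<xi>' s \<omega>)) \<partial>M') \<le> sqrt (2 * ?v * \<eta>) + ?b * \<eta>"
    unfolding Var' by (rule bound(2)[OF _ dev(2) K' centred(2)])
  note si = occupation_set_integrable[OF proc fm _ D]
  define I where "I \<omega> = (LINT s:{0..T}|lborel. f (\<xi>' s \<omega>))" for \<omega>
  have Ii: "integrable M' I"
  proof (rule M'.integrable_const_bound[of _ "D * T"])
    show "AE \<omega> in M'. norm (I \<omega>) \<le> D * T"
      using occupation_integral_bound[where f=f, OF proc _ D less_imp_le[OF T]] by (intro AE_I2) (simp add: I_def)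
    show "I \<in> borel_measurable M'"
      unfolding I_def[abs_def] by (rule occupation_integral_measurable[OF proc fm])
  qed
  have const: "set_integrable lborel {0..T} (\<lambda>_. mean)" "(LINT s:{0..T}|lborel. mean) = T * mean"
    using T by (auto intro!: bounded_measurable_set_integrable[where C="\<bar>mean\<bar>"] simp: set_lebesgue_integral_def)
  have "(\<integral>\<omega>. (LINT s:{0..T}|lborel. f (\<xi>' s \<omega>) - mean) \<partial>M') = (\<integral>\<omega>. I \<omega> - T * mean \<partial>M')"
    using si const by (intro Bochner_Integration.integral_cong) (auto simp: set_integral_diff I_def)
  also have "\<dots> = (\<integral>\<omega>. I \<omega> \<partial>M') - T * mean" using Ii by (simp add: M'.prob_space)
  finally have i1: "(\<integral>\<omega>. (LINT s:{0..T}|lborel. f (\<xi>' s \<omega>) - mean) \<partial>M') = (\<integral>\<omega>. I \<omega> \<partial>M') - T * mean" .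
  have "(\<integral>\<omega>. (LINT s:{0..T}|lborel. mean - f (\<xi>' s \<omega>)) \<partial>M') = (\<integral>\<omega>. T * mean - I \<omega> \<partial>M')"
    using si const by (intro Bochner_Integration.integral_cong) (auto simp: set_integral_diff I_def)
  also have "\<dots> = T * mean - (\<integral>\<omega>. I \<omega> \<partial>M')" using Ii by (simp add: M'.prob_space)
  finally have i2: "(\<integral>\<omega>. (LINT s:{0..T}|lborel. mean - f (\<xi>' s \<omega>)) \<partial>M') = T * mean - (\<integral>\<omega>. I \<omega> \<partial>M')" .
  have "1 / T * (\<integral>\<omega>. I \<omega> \<partial>M') - mean \<le> sqrt (2 * ?v * \<eta>) + ?b * \<eta>"
    using upper T unfolding i1 by (simp add: diff_divide_distrib)
  moreover have "mean - 1 / T * (\<integral>\<omega>. I \<omega> \<partial>M') \<le> sqrt (2 * ?v * \<eta>) + ?b * \<eta>"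
    using lower T unfolding i2 by (simp add: diff_divide_distrib)
  ultimately have "\<bar>1 / T * (\<integral>\<omega>. I \<omega> \<partial>M') - mean\<bar> \<le> sqrt (2 * ?v * \<eta>) + ?b * \<eta>" by linarith
  also have "\<dots> \<le> sqrt (2 * v * \<eta>) + b * \<eta>"
  proof (intro add_mono real_sqrt_le_mono mult_right_mono mult_left_mono)
    \<comment> \<open>the quotient of the two sides exceeds \<open>1\<close> because \<open>(1 + \<epsilon>) (1 - \<epsilon>/2) - (1 - \<epsilon>) (1 + \<epsilon>/2) = \<epsilon>\<close>\<close>
    have "(2 + \<epsilon>)\<^sup>2 / 4 \<le> (1 + \<epsilon>) * (1 - \<epsilon>\<^sup>2 / 4) / (1 - \<epsilon>)"
    proof -
      have "(1 + \<epsilon>) * (1 - \<epsilon>\<^sup>2 / 4) - (2 + \<epsilon>)\<^sup>2 / 4 * (1 - \<epsilon>) = (2 + \<epsilon>) * \<epsilon> / 2"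
        by (simp add: power2_eq_square field_simps)
      moreover have "0 \<le> (2 + \<epsilon>) * \<epsilon> / 2" using eps by simp
      ultimately have "(2 + \<epsilon>)\<^sup>2 / 4 * (1 - \<epsilon>) \<le> (1 + \<epsilon>) * (1 - \<epsilon>\<^sup>2 / 4)" by linarith
      then show ?thesis using eps by (subst pos_le_divide_eq) auto
    qed
    then have "(2 + \<epsilon>)\<^sup>2 / 4 * (2 * Var \<mu> f / \<Lambda>) \<le> v"
      unfolding v_def using Var0 \<Lambda> by (intro mult_right_mono) auto
    then show "?v \<le> v" by (simp add: mult.commute)
    have "1 + \<epsilon> \<le> (1 + \<epsilon>)\<^sup>2 / (1 - \<epsilon>)"
      using eps by (simp add: pos_le_divide_eq power2_eq_square algebra_simps)
    then have "(1 + \<epsilon>) * (K / \<Lambda>) \<le> b"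
      unfolding b_def using K0 \<Lambda> by (intro mult_right_mono) auto
    then show "?b \<le> b" by simp
  qed (use \<eta> in auto)
  finally show ?thesis
    unfolding Let_def X_def[symmetric] mean_def[symmetric] \<Lambda>_def[symmetric] K_def[symmetric]
      v_def[symmetric] b_def[symmetric] R_def[symmetric] \<eta>_def[symmetric]
    by (simp add: I_def)
qed

end
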